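(* Let $n \geq 2$ and let $(M_1,g_1)$ and $(M_2,g_2)$ be two flat $n$-tori. If $(M_1,g_1)$ and $(M_2,g_2)$ are focally equivalent, then they are isometric up to rescaling, i.e. there is a constant $c>0$ such that $(M_1,g_1)$ and $(M_2,c\,g_2)$ are isometric.
   Context: A flat $n$-torus is a Riemannian manifold isometric to $\mathbb{R}^n/\Gamma$, where $\Gamma$ is a group of translations of $\mathbb{R}^n$ of rank $n$ (a full-rank lattice acting by translations), with the metric induced from the Euclidean metric of $\mathbb{R}^n$. Let $(M,g)$ be a complete real-analytic Riemannian manifold. For $p\in M$ and $v\in T_pM$, the focal index of $v$ is $$I(p,v)=\#\{w\in T_pM : |w|=|v| \text{ and } \exp_p(w)=\exp_p(v)\}.$$ The focal component of index $i$ at $p$ is $\sigma_i(p)=\{v\in T_pM : I(p,v)=i\}$, $1\le i\le\infty$. Focal equivalence: two complete analytic Riemannian manifolds $(M_1,g_1)$ and $(M_2,g_2)$, with focal components denoted $\sigma_i^1(p)$ and $\sigma_i^2(q)$ respectively, are focally equivalent if there exists an orientation-preserving homeomorphism $\varphi\colon TM_1\to TM_2$, with $\psi\colon M_1\to M_2$ the homeomorphism induced on the zero section, such that for every $p\in M_1$ and $q=\psi(p)\in M_2$: (i) $\varphi$ maps $T_pM_1$ to $T_qM_2$ and $\varphi|_{T_pM_1}(0)=0$; (ii) $\varphi|_{T_pM_1}(\sigma_i^1(p))=\sigma_i^2(q)$ for every $1\le i\le\infty$. *)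

theory Defs
  imports "HOL-Analysis.Analysis" "HOL-Homology.Homology"
begin

section \<open>Smooth and real-analytic functions on open sets\<close>

text \<open>These notions are only meant for open \<open>S\<close> and finite-dimensional domains, where \<open>C\<^sup>k\<close> may
  be phrased through iterated directional derivatives.\<close>

primrec Ck_on :: "nat \<Rightarrow> ('a::real_normed_vector \<Rightarrow> 'b::real_normed_vector) \<Rightarrow> 'a set \<Rightarrow> bool" where
  "Ck_on 0 f S \<longleftrightarrow> continuous_on S f"
| "Ck_on (Suc k) f S \<longleftrightarrow> (\<forall>x\<in>S. f differentiable (at x)) \<and>
     (\<forall>v. Ck_on k (\<lambda>x. frechet_derivative f (at x) v) S)"

definition smooth_on :: "('a::real_normed_vector \<Rightarrow> 'b::real_normed_vector) \<Rightarrow> 'a set \<Rightarrow> bool" where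
  "smooth_on f S \<longleftrightarrow> (\<forall>k. Ck_on k f S)"

text \<open>Smooth, and near each point the sum of a power series in \<open>CARD('n)\<close> variables;
  the multi-indices are the functions \<open>\<alpha> :: 'n \<Rightarrow> nat\<close>.\<close>

definition real_analytic_on :: "(real^'n \<Rightarrow> real) \<Rightarrow> (real^'n) set \<Rightarrow> bool" where
  "real_analytic_on f S \<longleftrightarrow> smooth_on f S \<and>
     (\<forall>a\<in>S. \<exists>c. \<exists>r>0. \<forall>x\<in>ball a r.
        ((\<lambda>\<alpha> :: 'n \<Rightarrow> nat. c \<alpha> * (\<Prod>i\<in>UNIV. (x $ i - a $ i) ^ \<alpha> i)) has_sum f x) UNIV)"

section \<open>Real-analytic Riemannian manifolds\<close>

text \<open>A chart is an injective map \<open>coord\<close> from its domain \<open>cdom\<close> onto an open subset of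
  \<open>real^'n\<close>; the values of \<open>coord\<close> outside \<open>cdom\<close> are irrelevant.
  The Riemannian metric is given by the matrix \<open>(g\<^sub>i\<^sub>j)\<close> in each chart, as a function of
  the coordinates. The atlas need not be maximal.\<close>

datatype ('a, 'n::finite) chart = Chart (cdom: "'a set") (coord: "'a \<Rightarrow> real^'n")

record ('a, 'n::finite) riemannian =
  charts :: "('a, 'n) chart set"
  gmat :: "('a, 'n) chart \<Rightarrow> real^'n \<Rightarrow> real^'n^'n"

definition points :: "('a, 'n::finite) riemannian \<Rightarrow> 'a set" where
  "points M = (\<Union>\<kappa>\<in>charts M. cdom \<kappa>)"

definition charts_at :: "('a, 'n::finite) riemannian \<Rightarrow> 'a \<Rightarrow> ('a, 'n) chart set" where
  "charts_at M p = {\<kappa> \<in> charts M. p \<in> cdom \<kappa>}"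

text \<open>The coordinate expression of a map \<open>f\<close> between manifolds, and its domain.\<close>

definition rep_dom :: "('a, 'n::finite) chart \<Rightarrow> ('a \<Rightarrow> 'b) \<Rightarrow> ('b, 'm::finite) chart \<Rightarrow> (real^'n) set" where
  "rep_dom \<kappa> f \<kappa>' = coord \<kappa> ` {p \<in> cdom \<kappa>. f p \<in> cdom \<kappa>'}"

definition rep :: "('a, 'n::finite) chart \<Rightarrow> ('a \<Rightarrow> 'b) \<Rightarrow> ('b, 'm::finite) chart \<Rightarrow> real^'n \<Rightarrow> real^'m" where
  "rep \<kappa> f \<kappa>' = (\<lambda>x. coord \<kappa>' (f (inv_into (cdom \<kappa>) (coord \<kappa>) x)))"

definition drep :: "('a, 'n::finite) chart \<Rightarrow> ('a \<Rightarrow> 'b) \<Rightarrow> ('b, 'm::finite) chart \<Rightarrow> 'a \<Rightarrow> real^'n \<Rightarrow> real^'m" where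
  "drep \<kappa> f \<kappa>' p = frechet_derivative (rep \<kappa> f \<kappa>') (at (coord \<kappa> p))"

definition mtop :: "('a, 'n::finite) riemannian \<Rightarrow> 'a topology" where
  "mtop M = topology (\<lambda>T. T \<subseteq> points M \<and> (\<forall>\<kappa>\<in>charts M. open (coord \<kappa> ` (T \<inter> cdom \<kappa>))))"

definition ginner :: "('a, 'n::finite) riemannian \<Rightarrow> ('a, 'n) chart \<Rightarrow> 'a \<Rightarrow> real^'n \<Rightarrow> real^'n \<Rightarrow> real" where
  "ginner M \<kappa> p u w = u \<bullet> (gmat M \<kappa> (coord \<kappa> p) *v w)"

definition analytic_manifold :: "('a, 'n::finite) riemannian \<Rightarrow> bool" where
  "analytic_manifold M \<longleftrightarrow>
     (\<forall>\<kappa>\<in>charts M. inj_on (coord \<kappa>) (cdom \<kappa>) \<and> open (coord \<kappa> ` cdom \<kappa>)) \<and>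
     (\<forall>\<kappa>\<in>charts M. \<forall>\<kappa>'\<in>charts M. open (rep_dom \<kappa> id \<kappa>') \<and>
        (\<forall>i. real_analytic_on (\<lambda>x. rep \<kappa> id \<kappa>' x $ i) (rep_dom \<kappa> id \<kappa>'))) \<and>
     Hausdorff_space (mtop M) \<and> second_countable (mtop M)"

definition analytic_riemannian :: "('a, 'n::finite) riemannian \<Rightarrow> bool" where
  "analytic_riemannian M \<longleftrightarrow> analytic_manifold M \<and>
     (\<forall>\<kappa>\<in>charts M. \<forall>i j. real_analytic_on (\<lambda>x. gmat M \<kappa> x $ i $ j) (coord \<kappa> ` cdom \<kappa>)) \<and>
     (\<forall>\<kappa>\<in>charts M. \<forall>p\<in>cdom \<kappa>. \<forall>u w. ginner M \<kappa> p u w = ginner M \<kappa> p w u \<and>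
        (u \<noteq> 0 \<longrightarrow> ginner M \<kappa> p u u > 0)) \<and>
     (\<forall>\<kappa>\<in>charts M. \<forall>\<kappa>'\<in>charts M. \<forall>p \<in> cdom \<kappa> \<inter> cdom \<kappa>'. \<forall>u w.
        ginner M \<kappa>' p (drep \<kappa> id \<kappa>' p u) (drep \<kappa> id \<kappa>' p w) = ginner M \<kappa> p u w)"

definition rescale :: "real \<Rightarrow> ('a, 'n::finite) riemannian \<Rightarrow> ('a, 'n) riemannian" where
  "rescale c M = M\<lparr>gmat := (\<lambda>\<kappa> x. c *\<^sub>R gmat M \<kappa> x)\<rparr>"

subsection \<open>Isometries\<close>

definition smooth_map :: "('a, 'n::finite) riemannian \<Rightarrow> ('b, 'm::finite) riemannian \<Rightarrow> ('a \<Rightarrow> 'b) \<Rightarrow> bool" where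
  "smooth_map M N f \<longleftrightarrow> f ` points M \<subseteq> points N \<and>
     (\<forall>\<kappa>\<in>charts M. \<forall>\<kappa>'\<in>charts N. open (rep_dom \<kappa> f \<kappa>') \<and> smooth_on (rep \<kappa> f \<kappa>') (rep_dom \<kappa> f \<kappa>'))"

definition isometry :: "('a, 'n::finite) riemannian \<Rightarrow> ('b, 'n) riemannian \<Rightarrow> ('a \<Rightarrow> 'b) \<Rightarrow> bool" where
  "isometry M N f \<longleftrightarrow> bij_betw f (points M) (points N) \<and>
     smooth_map M N f \<and> smooth_map N M (inv_into (points M) f) \<and>
     (\<forall>p\<in>points M. \<forall>\<kappa>\<in>charts_at M p. \<forall>\<kappa>'\<in>charts_at N (f p). \<forall>u w.
        ginner N \<kappa>' (f p) (drep \<kappa> f \<kappa>' p u) (drep \<kappa> f \<kappa>' p w) = ginner M \<kappa> p u w)"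

definition isometric :: "('a, 'n::finite) riemannian \<Rightarrow> ('b, 'n) riemannian \<Rightarrow> bool" where
  "isometric M N \<longleftrightarrow> (\<exists>f. isometry M N f)"

subsection \<open>Tangent bundle\<close>

text \<open>A tangent vector at \<open>p\<close> is the family of its components in all charts around \<open>p\<close>,
  related by the Jacobians of the coordinate changes (with \<open>0\<close> at the other charts, to make
  the family unique). The bundle consists of the pairs \<open>(p, v)\<close>.\<close>

type_synonym ('a, 'n) tvec = "('a, 'n) chart \<Rightarrow> real^'n"

definition tspace :: "('a, 'n::finite) riemannian \<Rightarrow> 'a \<Rightarrow> ('a, 'n) tvec set" where
  "tspace M p = {v. (\<forall>\<kappa>. \<kappa> \<notin> charts_at M p \<longrightarrow> v \<kappa> = 0) \<and>
     (\<forall>\<kappa>\<in>charts_at M p. \<forall>\<kappa>'\<in>charts_at M p. v \<kappa>' = drep \<kappa> id \<kappa>' p (v \<kappa>))}"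

definition tnorm :: "('a, 'n::finite) riemannian \<Rightarrow> 'a \<Rightarrow> ('a, 'n) tvec \<Rightarrow> real" where
  "tnorm M p v = (let \<kappa> = (SOME \<kappa>. \<kappa> \<in> charts_at M p) in sqrt (ginner M \<kappa> p (v \<kappa>) (v \<kappa>)))"

definition tbundle :: "('a, 'n::finite) riemannian \<Rightarrow> ('a \<times> ('a, 'n) tvec) set" where
  "tbundle M = Sigma (points M) (tspace M)"

definition tdom :: "('a, 'n::finite) riemannian \<Rightarrow> ('a, 'n) chart \<Rightarrow> ('a \<times> ('a, 'n) tvec) set" where
  "tdom M \<kappa> = Sigma (cdom \<kappa>) (tspace M)"

definition tcoord :: "('a, 'n::finite) chart \<Rightarrow> 'a \<times> ('a, 'n) tvec \<Rightarrow> (real^'n) \<times> (real^'n)" where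
  "tcoord \<kappa> = (\<lambda>(p, v). (coord \<kappa> p, v \<kappa>))"

definition ttop :: "('a, 'n::finite) riemannian \<Rightarrow> ('a \<times> ('a, 'n) tvec) topology" where
  "ttop M = topology (\<lambda>T. T \<subseteq> tbundle M \<and> (\<forall>\<kappa>\<in>charts M. open (tcoord \<kappa> ` (T \<inter> tdom M \<kappa>))))"

subsection \<open>Geodesics and the exponential map\<close>

definition christoffel :: "('a, 'n::finite) riemannian \<Rightarrow> ('a, 'n) chart \<Rightarrow> real^'n \<Rightarrow> 'n \<Rightarrow> 'n \<Rightarrow> 'n \<Rightarrow> real" where
  "christoffel M \<kappa> x k i j =
     (let dg = (\<lambda>l a b. frechet_derivative (\<lambda>y. gmat M \<kappa> y $ a $ b) (at x) (axis l 1))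
      in (1 / 2) * (\<Sum>l\<in>UNIV. matrix_inv (gmat M \<kappa> x) $ k $ l * (dg i j l + dg j i l - dg l i j)))"

text \<open>Geodesics defined on all of \<open>\<real>\<close>; openness of the preimages of the chart domains is
  part of the continuity of the curve.\<close>

definition geodesic :: "('a, 'n::finite) riemannian \<Rightarrow> (real \<Rightarrow> 'a) \<Rightarrow> bool" where
  "geodesic M c \<longleftrightarrow> range c \<subseteq> points M \<and>
     (\<forall>\<kappa>\<in>charts M. open (c -` cdom \<kappa>) \<and>
        (\<exists>c'. \<forall>t \<in> c -` cdom \<kappa>.
           ((\<lambda>s. coord \<kappa> (c s)) has_vector_derivative c' t) (at t) \<and>
           (c' has_vector_derivative
              (\<chi> k. - (\<Sum>i\<in>UNIV. \<Sum>j\<in>UNIV. christoffel M \<kappa> (coord \<kappa> (c t)) k i j * c' t $ i * c' t $ j)))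
             (at t)))"

definition velocity :: "('a, 'n::finite) riemannian \<Rightarrow> (real \<Rightarrow> 'a) \<Rightarrow> real \<Rightarrow> ('a, 'n) tvec" where
  "velocity M c t =
     (\<lambda>\<kappa>. if \<kappa> \<in> charts_at M (c t) then vector_derivative (\<lambda>s. coord \<kappa> (c s)) (at t) else 0)"

text \<open>Completeness is geodesic completeness, i.e. the exponential map is defined on the whole
  tangent bundle; \<open>mexp\<close> is only meaningful for complete manifolds.\<close>

definition complete_riemannian :: "('a, 'n::finite) riemannian \<Rightarrow> bool" where
  "complete_riemannian M \<longleftrightarrow>
     (\<forall>(p, v) \<in> tbundle M. \<exists>c. geodesic M c \<and> c 0 = p \<and> velocity M c 0 = v)"

definition mexp :: "('a, 'n::finite) riemannian \<Rightarrow> 'a \<Rightarrow> ('a, 'n) tvec \<Rightarrow> 'a" where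
  "mexp M p v = (THE q. \<exists>c. geodesic M c \<and> c 0 = p \<and> velocity M c 0 = v \<and> c 1 = q)"

section \<open>Orientation-preserving homeomorphisms of tangent bundles\<close>

text \<open>A homeomorphism \<open>h\<close> from an open set \<open>\<Omega>\<close> in a Euclidean space \<open>E\<close> onto an open set in \<open>E\<close>
  preserves the orientation at \<open>x\<close> iff on \<open>H\<^sub>m(\<Omega>, \<Omega> - {x}) \<cong> \<int>\<close>, where \<open>m = dim E\<close>, it induces the same
  homomorphism into \<open>H\<^sub>m(E, E - {h x})\<close> as the translation taking \<open>x\<close> to \<open>h x\<close>: the translations
  are what identifies the local orientations of \<open>E\<close> at different points.\<close>

definition orientation_preserving_on :: "('e::euclidean_space \<Rightarrow> 'e) \<Rightarrow> 'e set \<Rightarrow> bool" where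
  "orientation_preserving_on h \<Omega> \<longleftrightarrow>
     (\<forall>x\<in>\<Omega>. \<forall>a \<in> carrier (relative_homology_group (int DIM('e)) (top_of_set \<Omega>) (\<Omega> - {x})).
        hom_induced (int DIM('e)) (top_of_set \<Omega>) (\<Omega> - {x}) euclidean (- {h x}) h a =
        hom_induced (int DIM('e)) (top_of_set \<Omega>) (\<Omega> - {x}) euclidean (- {h x}) (\<lambda>z. z + (h x - x)) a)"

text \<open>A tangent bundle carries a canonical orientation: a coordinate change of the charts
  \<open>tcoord \<kappa>\<close> has Jacobian determinant \<open>(det D)\<^sup>2 > 0\<close>, with \<open>D\<close> the Jacobian of the change of base
  coordinates. Hence the orientation can be tested in these charts.\<close>

definition orientation_preserving ::
    "('a, 'n::finite) riemannian \<Rightarrow> ('b, 'n) riemannian \<Rightarrow>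
      ('a \<times> ('a, 'n) tvec \<Rightarrow> 'b \<times> ('b, 'n) tvec) \<Rightarrow> bool" where
  "orientation_preserving M N \<phi> \<longleftrightarrow>
     (\<forall>\<kappa>\<in>charts M. \<forall>\<kappa>'\<in>charts N.
        orientation_preserving_on
          (\<lambda>z. tcoord \<kappa>' (\<phi> (inv_into (tdom M \<kappa>) (tcoord \<kappa>) z)))
          (tcoord \<kappa> ` {e \<in> tdom M \<kappa>. \<phi> e \<in> tdom N \<kappa>'}))"

section \<open>Focal equivalence\<close>

definition focal_index :: "('a, 'n::finite) riemannian \<Rightarrow> 'a \<Rightarrow> ('a, 'n) tvec \<Rightarrow> enat" where
  "focal_index M p v =
     (let W = {w \<in> tspace M p. tnorm M p w = tnorm M p v \<and> mexp M p w = mexp M p v}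
      in if finite W then enat (card W) else \<infinity>)"

definition focal_component :: "('a, 'n::finite) riemannian \<Rightarrow> enat \<Rightarrow> 'a \<Rightarrow> ('a, 'n) tvec set" where
  "focal_component M i p = {v \<in> tspace M p. focal_index M p v = i}"

definition focally_equivalent :: "('a, 'n::finite) riemannian \<Rightarrow> ('b, 'n) riemannian \<Rightarrow> bool" where
  "focally_equivalent M\<^sub>1 M\<^sub>2 \<longleftrightarrow>
     analytic_riemannian M\<^sub>1 \<and> complete_riemannian M\<^sub>1 \<and>
     analytic_riemannian M\<^sub>2 \<and> complete_riemannian M\<^sub>2 \<and>
     (\<exists>\<phi> \<psi>. homeomorphic_map (ttop M\<^sub>1) (ttop M\<^sub>2) \<phi> \<and>
        orientation_preserving M\<^sub>1 M\<^sub>2 \<phi> \<and>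
        homeomorphic_map (mtop M\<^sub>1) (mtop M\<^sub>2) \<psi> \<and>
        (\<forall>p\<in>points M\<^sub>1.
           \<phi> ` ({p} \<times> tspace M\<^sub>1 p) \<subseteq> {\<psi> p} \<times> tspace M\<^sub>2 (\<psi> p) \<and>
           \<phi> (p, \<lambda>_. 0) = (\<psi> p, \<lambda>_. 0) \<and>
           (\<forall>i\<ge>1. \<phi> ` ({p} \<times> focal_component M\<^sub>1 i p) = {\<psi> p} \<times> focal_component M\<^sub>2 i (\<psi> p))))"

section \<open>Flat tori\<close>

definition lattice_of_full_rank :: "(real^'n) set \<Rightarrow> bool" where
  "lattice_of_full_rank \<Gamma> \<longleftrightarrow>
     (\<exists>b :: 'n \<Rightarrow> real^'n. inj b \<and> independent (range b) \<and>
        \<Gamma> = {\<Sum>i\<in>UNIV. of_int (k i) *\<^sub>R b i | k :: 'n \<Rightarrow> int. True})"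

text \<open>The quotient of \<open>real^'n\<close> by the translations in \<open>\<Gamma>\<close>: its points are the orbits, its charts
  the local inverses of the projection, in which the metric induced from the Euclidean one
  has the identity matrix.\<close>

definition orbit :: "(real^'n) set \<Rightarrow> real^'n \<Rightarrow> (real^'n) set" where
  "orbit \<Gamma> x = (\<lambda>\<gamma>. x + \<gamma>) ` \<Gamma>"

definition quotient_torus :: "(real^'n) set \<Rightarrow> ((real^'n) set, 'n) riemannian" where
  "quotient_torus \<Gamma> =
     \<lparr>charts = {Chart (orbit \<Gamma> ` W) (inv_into W (orbit \<Gamma>)) | W. open W \<and> inj_on (orbit \<Gamma>) W},
      gmat = (\<lambda>_ _. mat 1)\<rparr>"

definition flat_torus :: "('a, 'n::finite) riemannian \<Rightarrow> bool" where
  "flat_torus M \<longleftrightarrow> analytic_riemannian M \<and>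
     (\<exists>\<Gamma>. lattice_of_full_rank \<Gamma> \<and> isometric M (quotient_torus \<Gamma>))"

end

theory Submission
  imports Defs "HOL-Real_Asymp.Real_Asymp"
begin

text \<open>
  On a flat torus, developing a tangent space isometrically onto \<open>\<real>\<^sup>n\<close> turns the exponential map into
  the projection modulo the lattice \<open>\<Gamma>\<close>, up to a translation. Hence the focal index of a vector \<open>v\<close> is the number of
  \<open>\<gamma> \<in> \<Gamma>\<close> with \<open>|v - \<gamma>| = |v|\<close>, that is, the number of bisectors \<open>{v. 2 v \<bullet> \<gamma> = \<gamma> \<bullet> \<gamma>}\<close> through \<open>v\<close>,
  where \<open>\<gamma> = 0\<close> always counts (\<open>focal_index_eq_card_bisectors\<close>). On one fibre, a focal equivalence
  is therefore a homeomorphism \<open>h\<close> of \<open>\<real>\<^sup>n\<close> that fixes \<open>0\<close> and preserves the number of bisectors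
  through each point. The theorem holds because such an \<open>h\<close> forces the two lattices to be similar.

  The topological half of the argument counts hyperplanes. Two points on no bisector can be joined,
  after a small perturbation, by a segment that crosses the bisectors between them one at a time.
  Its image under \<open>h\<close> is a path with as many crossings, so \<open>h\<close> does not increase the number of
  bisectors that separate two points, and by symmetry it preserves this number
  (\<open>card_separators\<close>). If \<open>x\<close> and \<open>y\<close> are separated by just one bisector, then a point \<open>z\<close> is on the
  side of \<open>x\<close> if and only if fewer bisectors separate it from \<open>x\<close> than from \<open>y\<close>. So \<open>h\<close> maps
  the half-space beyond the bisector of \<open>\<gamma>\<close> onto the half-space beyond the bisector of some \<open>f \<gamma>\<close>
  (\<open>half_space_image\<close>), and no analysis near intersections of bisectors is involved.

  The algebraic half starts from inclusions and disjointness of half-spaces, which show that \<open>f\<close>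
  commutes with integer multiples. Hence \<open>2 v \<bullet> \<gamma> / (\<gamma> \<bullet> \<gamma>)\<close> and \<open>2 h v \<bullet> f \<gamma> / (f \<gamma> \<bullet> f \<gamma>)\<close> lie between
  the same integers, and with \<open>G \<gamma> = (\<gamma> \<bullet> \<gamma> / (f \<gamma> \<bullet> f \<gamma>)) f \<gamma>\<close> the difference \<open>v \<bullet> \<gamma> - h v \<bullet> G \<gamma>\<close> is
  bounded in \<open>v\<close>. As a bounded linear functional is zero, \<open>G\<close> satisfies the same linear relations as
  the lattice (\<open>G_relation\<close>); in particular it is additive. Finally \<open>f \<gamma>\<close> is \<open>G \<gamma>\<close> times a factor
  \<open>q \<gamma>\<close>, and discreteness of the second lattice forces this factor to be constant (\<open>q_constant\<close>).
  So \<open>f\<close> extends to a linear similarity, which descends to the quotient tori.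

  The link with manifolds given by charts consists of two facts. An isometry to a quotient torus
  carries geodesics to projections of lines (\<open>geodesic_is_line\<close>), by a computation with Christoffel
  symbols that uses the symmetry of second derivatives. And the fibres of the tangent bundle carry the
  topology of \<open>\<real>\<^sup>n\<close> (\<open>fibre_map_continuous\<close>).
\<close>

section \<open>Arrangements of bisector hyperplanes\<close>

definition discrete_subgroup :: "'e::euclidean_space set \<Rightarrow> bool" where
  "discrete_subgroup \<Gamma> \<longleftrightarrow> 0 \<in> \<Gamma> \<and> (\<forall>x\<in>\<Gamma>. \<forall>y\<in>\<Gamma>. x - y \<in> \<Gamma>) \<and> (\<forall>R. finite {\<gamma>\<in>\<Gamma>. norm \<gamma> \<le> R})"

lemma discrete_subgroup_zero: "discrete_subgroup \<Gamma> \<Longrightarrow> 0 \<in> \<Gamma>"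
  by (simp add: discrete_subgroup_def)

lemma discrete_subgroup_diff: "discrete_subgroup \<Gamma> \<Longrightarrow> x \<in> \<Gamma> \<Longrightarrow> y \<in> \<Gamma> \<Longrightarrow> x - y \<in> \<Gamma>"
  by (simp add: discrete_subgroup_def)

lemma discrete_subgroup_minus: "discrete_subgroup \<Gamma> \<Longrightarrow> x \<in> \<Gamma> \<Longrightarrow> - x \<in> \<Gamma>"
  using discrete_subgroup_diff[of \<Gamma> 0 x] discrete_subgroup_zero by force

lemma discrete_subgroup_add: "discrete_subgroup \<Gamma> \<Longrightarrow> x \<in> \<Gamma> \<Longrightarrow> y \<in> \<Gamma> \<Longrightarrow> x + y \<in> \<Gamma>"
  using discrete_subgroup_diff[of \<Gamma> x "- y"] discrete_subgroup_minus by force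

lemma discrete_subgroup_finite: "discrete_subgroup \<Gamma> \<Longrightarrow> finite {\<gamma>\<in>\<Gamma>. norm \<gamma> \<le> R}"
  by (simp add: discrete_subgroup_def)

lemma discrete_subgroup_scaleR_nat: "discrete_subgroup \<Gamma> \<Longrightarrow> x \<in> \<Gamma> \<Longrightarrow> real k *\<^sub>R x \<in> \<Gamma>"
  by (induction k) (auto simp: discrete_subgroup_zero discrete_subgroup_add algebra_simps)

lemma discrete_subgroup_countable:
  assumes "discrete_subgroup \<Gamma>"
  shows "countable \<Gamma>"
proof -
  have "\<Gamma> = (\<Union>k::nat. {\<gamma>\<in>\<Gamma>. norm \<gamma> \<le> real k})"
    by (auto intro: real_arch_simple)
  moreover have "countable (\<Union>k::nat. {\<gamma>\<in>\<Gamma>. norm \<gamma> \<le> real k})"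
    by (rule countable_UN) (auto intro: countable_finite discrete_subgroup_finite[OF assms])
  ultimately show ?thesis by simp
qed

text \<open>The bisector hyperplane of \<open>\<gamma>\<close>: the points at equal distance from
  \<open>0\<close> and \<open>\<gamma>\<close>. For \<open>\<gamma> = 0\<close> it is the whole
  space.\<close>

definition on_bisector :: "'e::euclidean_space \<Rightarrow> 'e \<Rightarrow> bool" where
  "on_bisector \<gamma> v \<longleftrightarrow> 2 * (v \<bullet> \<gamma>) = \<gamma> \<bullet> \<gamma>"

text \<open>The points closer to \<open>\<gamma>\<close> than to \<open>0\<close>.\<close>

definition beyond :: "'e::euclidean_space \<Rightarrow> 'e \<Rightarrow> bool" where
  "beyond \<gamma> v \<longleftrightarrow> 2 * (v \<bullet> \<gamma>) > \<gamma> \<bullet> \<gamma>"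

definition regular :: "'e::euclidean_space set \<Rightarrow> 'e \<Rightarrow> bool" where
  "regular \<Gamma> v \<longleftrightarrow> (\<forall>\<gamma>\<in>\<Gamma>. on_bisector \<gamma> v \<longrightarrow> \<gamma> = 0)"

definition simple :: "'e::euclidean_space set \<Rightarrow> 'e \<Rightarrow> bool" where
  "simple \<Gamma> v \<longleftrightarrow> (\<forall>\<gamma>\<in>\<Gamma>-{0}. \<forall>\<delta>\<in>\<Gamma>-{0}. on_bisector \<gamma> v \<and> on_bisector \<delta> v \<longrightarrow> \<gamma> = \<delta>)"

definition separators :: "'e::euclidean_space set \<Rightarrow> 'e \<Rightarrow> 'e \<Rightarrow> 'e set" where
  "separators \<Gamma> x y = {\<gamma>\<in>\<Gamma>-{0}. beyond \<gamma> x \<noteq> beyond \<gamma> y}"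

text \<open>The bisector of \<open>\<gamma>\<close> has distance \<open>norm \<gamma> / 2\<close> from the
  origin. This is what makes the arrangement of a discrete group locally finite.\<close>

lemma bisector_far:
  fixes \<gamma> v :: "'e::euclidean_space"
  assumes "2 * norm v < norm \<gamma>"
  shows "\<not> beyond \<gamma> v" "\<not> on_bisector \<gamma> v"
proof -
  have "2 * (v \<bullet> \<gamma>) \<le> 2 * norm v * norm \<gamma>"
    using norm_cauchy_schwarz[of v \<gamma>] by simp
  also have "\<dots> < norm \<gamma> * norm \<gamma>"
    using assms by (intro mult_strict_right_mono) (use norm_ge_zero[of v] in linarith)+
  also have "\<dots> = \<gamma> \<bullet> \<gamma>"
    by (simp add: dot_square_norm power2_eq_square)
  finally show "\<not> beyond \<gamma> v" "\<not> on_bisector \<gamma> v"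
    by (auto simp: beyond_def on_bisector_def)
qed

lemma finite_separators:
  assumes "discrete_subgroup \<Gamma>"
  shows "finite (separators \<Gamma> x y)"
proof -
  have "separators \<Gamma> x y \<subseteq> {\<gamma>\<in>\<Gamma>. norm \<gamma> \<le> 2 * (norm x + norm y)}"
  proof
    fix \<gamma> assume *: "\<gamma> \<in> separators \<Gamma> x y"
    then have "beyond \<gamma> x \<or> beyond \<gamma> y" by (auto simp: separators_def)
    then have "norm \<gamma> \<le> 2 * norm x \<or> norm \<gamma> \<le> 2 * norm y"
      by (metis bisector_far(1) not_le)
    then show "\<gamma> \<in> {\<gamma>\<in>\<Gamma>. norm \<gamma> \<le> 2 * (norm x + norm y)}"
      using * norm_ge_zero[of x] norm_ge_zero[of y] unfolding separators_def mem_Collect_eq distrib_left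
      by (metis (no_types, lifting) DiffD1 add_increasing add_increasing2 mult_nonneg_nonneg zero_le_numeral)
  qed
  then show ?thesis
    using discrete_subgroup_finite[OF assms] finite_subset by blast
qed

lemma zero_regular: "regular \<Gamma> (0::'e::euclidean_space)"
  by (auto simp: regular_def on_bisector_def)

lemma zero_not_beyond: "\<not> beyond \<gamma> 0"
  by (auto simp: beyond_def not_less)

lemma beyond_self: "\<gamma> \<noteq> 0 \<Longrightarrow> beyond \<gamma> \<gamma>"
  by (auto simp: beyond_def)

lemma open_beyond: "open {v. beyond \<gamma> v}"
  unfolding beyond_def by (intro open_Collect_less continuous_intros)

text \<open>By local finiteness, a small move from \<open>v\<close> crosses none of the bisectors that avoid
  \<open>v\<close>.\<close>

lemma eventually_same_side:
  fixes \<Gamma> :: "'e::euclidean_space set"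
  assumes "discrete_subgroup \<Gamma>"
  shows "eventually (\<lambda>w. \<forall>\<gamma>\<in>\<Gamma>. \<not> on_bisector \<gamma> v \<longrightarrow> beyond \<gamma> w = beyond \<gamma> v \<and> \<not> on_bisector \<gamma> w) (nhds v)"
proof -
  define F where "F = {\<gamma>\<in>\<Gamma>. norm \<gamma> \<le> 2 * (norm v + 1)}"
  have "finite F" unfolding F_def by (rule discrete_subgroup_finite[OF assms])
  moreover have "eventually (\<lambda>w. \<not> on_bisector \<gamma> v \<longrightarrow> beyond \<gamma> w = beyond \<gamma> v \<and> \<not> on_bisector \<gamma> w) (nhds v)" for \<gamma>
  proof (cases "2 * (v \<bullet> \<gamma>)" "\<gamma> \<bullet> \<gamma>" rule: linorder_cases)
    case less
    have "open {w. 2 * (w \<bullet> \<gamma>) < \<gamma> \<bullet> \<gamma>}" by (intro open_Collect_less continuous_intros)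
    then have "eventually (\<lambda>w. 2 * (w \<bullet> \<gamma>) < \<gamma> \<bullet> \<gamma>) (nhds v)"
      using less eventually_nhds by blast
    then show ?thesis
      by eventually_elim (use less in \<open>auto simp: beyond_def on_bisector_def\<close>)
  next
    case equal
    then show ?thesis by (simp add: on_bisector_def)
  next
    case greater
    have "open {w. 2 * (w \<bullet> \<gamma>) > \<gamma> \<bullet> \<gamma>}" by (intro open_Collect_less continuous_intros)
    then have "eventually (\<lambda>w. 2 * (w \<bullet> \<gamma>) > \<gamma> \<bullet> \<gamma>) (nhds v)"
      using greater eventually_nhds by blast
    then show ?thesis
      by eventually_elim (use greater in \<open>auto simp: beyond_def on_bisector_def\<close>)
  qed
  ultimately have 1: "eventually (\<lambda>w. \<forall>\<gamma>\<in>F. \<not> on_bisector \<gamma> v \<longrightarrow> beyond \<gamma> w = beyond \<gamma> v \<and> \<not> on_bisector \<gamma> w) (nhds v)"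
    by (intro eventually_ball_finite) auto
  have "eventually (\<lambda>w. w \<in> ball v 1) (nhds v)"
    by (intro eventually_nhds_in_open) auto
  then have 2: "eventually (\<lambda>w. norm w < norm v + 1) (nhds v)"
    by eventually_elim (metis add.commute dist_commute dist_norm mem_ball norm_triangle_sub less_diff_eq add_le_cancel_left order_le_less_trans add_less_cancel_left)
  show ?thesis
    using 1 2
  proof eventually_elim
    case (elim w)
    show ?case
    proof (intro ballI impI)
      fix \<gamma> assume \<gamma>: "\<gamma> \<in> \<Gamma>" "\<not> on_bisector \<gamma> v"
      show "beyond \<gamma> w = beyond \<gamma> v \<and> \<not> on_bisector \<gamma> w"
      proof (cases "\<gamma> \<in> F")
        case True
        then show ?thesis using elim(1) \<gamma> by auto
      next
        case False
        then have "2 * norm v < norm \<gamma>" "2 * norm w < norm \<gamma>"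
          using \<gamma> elim(2) by (auto simp: F_def)
        then show ?thesis
          using bisector_far by blast
      qed
    qed
  qed
qed

lemma regular_iff: "regular \<Gamma> v \<longleftrightarrow> (\<forall>\<gamma>\<in>\<Gamma>-{0}. \<not> on_bisector \<gamma> v)"
  by (auto simp: regular_def)

lemma eventually_separators_same:
  fixes \<Gamma> :: "'e::euclidean_space set"
  assumes "discrete_subgroup \<Gamma>" "regular \<Gamma> y"
  shows "eventually (\<lambda>w. \<forall>x. separators \<Gamma> x w = separators \<Gamma> x y) (nhds y)"
  using eventually_same_side[OF assms(1), of y]
  by eventually_elim (use assms(2) in \<open>auto simp: separators_def regular_iff\<close>)

text \<open>A segment from \<open>x\<close> that meets two bisectors at the same point ends in the
  hyperplane spanned by \<open>x\<close> and their intersection. There are countably many such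
  hyperplanes, so they do not cover the open set \<open>U\<close>.\<close>

lemma generic_segment:
  fixes \<Gamma> :: "'e::euclidean_space set"
  assumes \<Gamma>: "discrete_subgroup \<Gamma>" and x: "regular \<Gamma> x" and U: "open U" "U \<noteq> {}"
  shows "\<exists>y\<in>U. regular \<Gamma> y \<and> (\<forall>t. simple \<Gamma> (x + t *\<^sub>R (y - x)))"
proof -
  \<comment> \<open>The pencil of hyperplanes through the intersection of the bisectors of \<open>\<gamma>\<close> and \<open>\<delta>\<close> contains exactly one through \<open>x\<close>; \<open>n \<gamma> \<delta>\<close> is its normal.\<close>
  define P where "P = (\<lambda>\<gamma>. 2 * (x \<bullet> \<gamma>) - \<gamma> \<bullet> \<gamma>)"
  define n where "n = (\<lambda>\<gamma> \<delta>. P \<delta> *\<^sub>R \<gamma> - P \<gamma> *\<^sub>R \<delta>)"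
  define B where "B = (\<Union>\<gamma>\<in>\<Gamma>-{0}. {y. \<gamma> \<bullet> y = \<gamma> \<bullet> \<gamma> / 2}) \<union> (\<Union>(\<gamma>,\<delta>)\<in>{p\<in>\<Gamma>\<times>\<Gamma>. n (fst p) (snd p) \<noteq> 0}. {y. n \<gamma> \<delta> \<bullet> y = n \<gamma> \<delta> \<bullet> x})"
  have cnt: "countable \<Gamma>" using \<Gamma> by (rule discrete_subgroup_countable)
  have "negligible B" unfolding B_def
  proof (intro negligible_Un negligible_countable_Union countable_image)
    show "countable (\<Gamma> - {0})" using cnt by blast
    show "countable {p \<in> \<Gamma> \<times> \<Gamma>. n (fst p) (snd p) \<noteq> 0}"
      by (rule countable_subset[OF _ countable_SIGMA[OF cnt cnt]]) auto
    fix S assume "S \<in> (\<lambda>\<gamma>. {y. \<gamma> \<bullet> y = \<gamma> \<bullet> \<gamma> / 2}) ` (\<Gamma> - {0})"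
    then obtain \<gamma> where "\<gamma> \<noteq> 0" "S = {y. \<gamma> \<bullet> y = \<gamma> \<bullet> \<gamma> / 2}" by blast
    then show "negligible S" using negligible_hyperplane by blast
  next
    fix S assume "S \<in> (\<lambda>(\<gamma>, \<delta>). {y. n \<gamma> \<delta> \<bullet> y = n \<gamma> \<delta> \<bullet> x}) ` {p \<in> \<Gamma> \<times> \<Gamma>. n (fst p) (snd p) \<noteq> 0}"
    then obtain \<gamma> \<delta> where "n \<gamma> \<delta> \<noteq> 0" "S = {y. n \<gamma> \<delta> \<bullet> y = n \<gamma> \<delta> \<bullet> x}" by auto
    then show "negligible S" using negligible_hyperplane by blast
  qed
  then have "\<not> U \<subseteq> B"
    using U open_not_negligible negligible_subset by blast
  then obtain y where y: "y \<in> U" "y \<notin> B" by auto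
  have reg: "regular \<Gamma> y"
    unfolding regular_iff on_bisector_def
  proof (intro ballI notI)
    fix \<gamma> assume "\<gamma> \<in> \<Gamma> - {0}" "2 * (y \<bullet> \<gamma>) = \<gamma> \<bullet> \<gamma>"
    then have "\<gamma> \<in> \<Gamma> - {0}" "\<gamma> \<bullet> y = \<gamma> \<bullet> \<gamma> / 2" by (simp_all add: inner_commute)
    then show False using y(2) unfolding B_def by blast
  qed
  moreover have "simple \<Gamma> (x + t *\<^sub>R (y - x))" for t
    unfolding simple_def
  proof (intro ballI impI)
    fix \<gamma> \<delta> assume *: "\<gamma> \<in> \<Gamma> - {0}" "\<delta> \<in> \<Gamma> - {0}"
      "on_bisector \<gamma> (x + t *\<^sub>R (y - x)) \<and> on_bisector \<delta> (x + t *\<^sub>R (y - x))"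
    have eq: "P \<gamma> + t * (2 * ((y - x) \<bullet> \<gamma>)) = 0" "P \<delta> + t * (2 * ((y - x) \<bullet> \<delta>)) = 0"
      using * by (simp_all add: on_bisector_def P_def algebra_simps)
    have P: "P \<gamma> \<noteq> 0" "P \<delta> \<noteq> 0" using x * by (auto simp: regular_iff on_bisector_def P_def)
    then have "t \<noteq> 0" using eq by auto
    have "n \<gamma> \<delta> \<bullet> (y - x) = P \<delta> * ((y - x) \<bullet> \<gamma>) - P \<gamma> * ((y - x) \<bullet> \<delta>)"
      by (simp add: n_def inner_diff_right inner_commute algebra_simps)
    then have "t * (n \<gamma> \<delta> \<bullet> (y - x)) = 0"
    proof -
      have "P \<gamma> = - (t * (2 * ((y - x) \<bullet> \<gamma>)))" "P \<delta> = - (t * (2 * ((y - x) \<bullet> \<delta>)))"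
        using eq by linarith+
      then show ?thesis unfolding \<open>n \<gamma> \<delta> \<bullet> (y - x) = _\<close> by simp
    qed
    then have "n \<gamma> \<delta> \<bullet> y = n \<gamma> \<delta> \<bullet> x" using \<open>t \<noteq> 0\<close> by (simp add: inner_diff_right)
    then have "n \<gamma> \<delta> = 0"
      using y(2) * by (auto simp: B_def)
    then have n0: "P \<delta> *\<^sub>R \<gamma> = P \<gamma> *\<^sub>R \<delta>" by (simp add: n_def)
    \<comment> \<open>A vanishing normal means parallel bisectors, which have no common point unless they are equal.\<close>
    define s where "s = P \<gamma> / P \<delta>"
    have s: "\<gamma> = s *\<^sub>R \<delta>" "s \<noteq> 0"
      using n0 P unfolding s_def
      by (auto simp: divide_inverse_commute real_vector.scale_scale[symmetric] simp flip: n0)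
    define z where "z = x + t *\<^sub>R (y - x)"
    have "2 * (z \<bullet> \<gamma>) = \<gamma> \<bullet> \<gamma>" "2 * (z \<bullet> \<delta>) = \<delta> \<bullet> \<delta>"
      using * by (auto simp: on_bisector_def z_def)
    then have "s * (\<delta> \<bullet> \<delta>) = s * s * (\<delta> \<bullet> \<delta>)"
      unfolding s(1) by auto
    moreover have "\<delta> \<bullet> \<delta> \<noteq> 0" using *(2) by simp
    ultimately have "s = 1" using s(2) by simp
    then show "\<gamma> = \<delta>" using s by simp
  qed
  ultimately show ?thesis using y(1) by blast
qed

text \<open>A path crosses every hyperplane that separates its ends, by the intermediate value theorem, and
  a path of simple points crosses them one at a time.\<close>

lemma separators_le_crossings:
  fixes g :: "real \<Rightarrow> 'e::euclidean_space"
  assumes cont: "continuous_on {0..1} g" and simple: "\<And>t. t \<in> {0..1} \<Longrightarrow> simple \<Gamma> (g t)"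
    and fin: "finite {t\<in>{0..1}. \<not> regular \<Gamma> (g t)}"
  shows "card (separators \<Gamma> (g 0) (g 1)) \<le> card {t\<in>{0..1}. \<not> regular \<Gamma> (g t)}"
proof -
  have ex: "\<exists>t\<in>{0..1}. on_bisector \<gamma> (g t)" if "\<gamma> \<in> separators \<Gamma> (g 0) (g 1)" for \<gamma>
  proof -
    define \<theta> where "\<theta> = (\<lambda>t. 2 * (g t \<bullet> \<gamma>))"
    have c: "continuous_on {0..1} \<theta>" unfolding \<theta>_def by (intro continuous_intros cont)
    have "(\<theta> 0 \<le> \<gamma> \<bullet> \<gamma> \<and> \<gamma> \<bullet> \<gamma> \<le> \<theta> 1) \<or> (\<theta> 1 \<le> \<gamma> \<bullet> \<gamma> \<and> \<gamma> \<bullet> \<gamma> \<le> \<theta> 0)"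
      using that by (auto simp: separators_def beyond_def \<theta>_def)
    then have "\<exists>t. 0 \<le> t \<and> t \<le> 1 \<and> \<theta> t = \<gamma> \<bullet> \<gamma>"
      using IVT'[of \<theta> 0 "\<gamma> \<bullet> \<gamma>" 1] IVT2'[of \<theta> 1 "\<gamma> \<bullet> \<gamma>" 0] c by auto
    then show ?thesis by (auto simp: on_bisector_def \<theta>_def)
  qed
  then obtain \<tau> where \<tau>: "\<And>\<gamma>. \<gamma> \<in> separators \<Gamma> (g 0) (g 1) \<Longrightarrow> \<tau> \<gamma> \<in> {0..1} \<and> on_bisector \<gamma> (g (\<tau> \<gamma>))"
    by metis
  have "inj_on \<tau> (separators \<Gamma> (g 0) (g 1))"
  proof (rule inj_onI)
    fix \<gamma> \<delta> assume *: "\<gamma> \<in> separators \<Gamma> (g 0) (g 1)" "\<delta> \<in> separators \<Gamma> (g 0) (g 1)" "\<tau> \<gamma> = \<tau> \<delta>"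
    then show "\<gamma> = \<delta>"
      using \<tau>[OF *(1)] \<tau>[OF *(2)] simple[of "\<tau> \<gamma>"] by (auto simp: simple_def separators_def)
  qed
  moreover have "\<tau> ` separators \<Gamma> (g 0) (g 1) \<subseteq> {t\<in>{0..1}. \<not> regular \<Gamma> (g t)}"
    using \<tau> by (auto simp: regular_def separators_def)
  ultimately show ?thesis using fin by (rule card_inj_on_le)
qed

text \<open>A segment meets a hyperplane that contains neither of its ends at most once, and only if the
  hyperplane separates them.\<close>

lemma crossings_le_separators:
  fixes x y :: "'e::euclidean_space"
  assumes \<Gamma>: "discrete_subgroup \<Gamma>" and x: "regular \<Gamma> x" and y: "regular \<Gamma> y"
  shows "finite {t\<in>{0..1}. \<not> regular \<Gamma> (x + t *\<^sub>R (y - x))}"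
    and "card {t\<in>{0..1}. \<not> regular \<Gamma> (x + t *\<^sub>R (y - x))} \<le> card (separators \<Gamma> x y)"
proof -
  let ?S = "{t\<in>{0..1}. \<not> regular \<Gamma> (x + t *\<^sub>R (y - x))}"
  have "\<forall>t\<in>?S. \<exists>\<gamma>\<in>\<Gamma>-{0}. on_bisector \<gamma> (x + t *\<^sub>R (y - x))"
    by (auto simp: regular_def)
  then obtain c where c: "\<And>t. t \<in> ?S \<Longrightarrow> c t \<in> \<Gamma>-{0} \<and> on_bisector (c t) (x + t *\<^sub>R (y - x))"
    by metis
  define a b where "a = (\<lambda>\<gamma>. 2 * (x \<bullet> \<gamma>) - \<gamma> \<bullet> \<gamma>)" and "b = (\<lambda>\<gamma>. 2 * (y \<bullet> \<gamma>) - \<gamma> \<bullet> \<gamma>)"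
  have eq: "(1 - t) * a (c t) + t * b (c t) = 0" if "t \<in> ?S" for t
    using c[OF that] by (auto simp: on_bisector_def a_def b_def algebra_simps)
  have nz: "a (c t) \<noteq> 0" "b (c t) \<noteq> 0" if "t \<in> ?S" for t
    using c[OF that] x y by (auto simp: regular_iff on_bisector_def a_def b_def)
  have img: "c ` ?S \<subseteq> separators \<Gamma> x y"
  proof
    fix \<gamma> assume "\<gamma> \<in> c ` ?S"
    then obtain t where t: "t \<in> ?S" "\<gamma> = c t" by blast
    have "beyond \<gamma> x \<noteq> beyond \<gamma> y"
    proof
      assume "beyond \<gamma> x = beyond \<gamma> y"
      then have "(a \<gamma> > 0 \<and> b \<gamma> > 0) \<or> (a \<gamma> < 0 \<and> b \<gamma> < 0)"
        using nz[OF t(1)] by (auto simp: beyond_def a_def b_def t(2))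
      moreover have "0 \<le> t" "0 \<le> 1 - t" "t + (1 - t) = 1" using t by auto
      ultimately have "(1 - t) * a \<gamma> + t * b \<gamma> \<noteq> 0"
      proof (elim disjE conjE)
        assume *: "a \<gamma> > 0" "b \<gamma> > 0" and t01: "0 \<le> t" "0 \<le> 1 - t"
        then show ?thesis
          by (smt (verit) mult_nonneg_nonneg mult_pos_pos)
      next
        assume *: "a \<gamma> < 0" "b \<gamma> < 0" and t01: "0 \<le> t" "0 \<le> 1 - t"
        then show ?thesis
          by (smt (verit) mult_nonneg_nonpos mult_pos_neg)
      qed
      then show False using eq t by auto
    qed
    then show "\<gamma> \<in> separators \<Gamma> x y" using c t by (auto simp: separators_def)
  qed
  have "inj_on c ?S"
  proof (rule inj_onI)
    fix s t assume *: "s \<in> ?S" "t \<in> ?S" "c s = c t"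
    have "(1 - t) * a (c t) + t * b (c t) = 0" "(1 - s) * a (c t) + s * b (c t) = 0"
      using eq[OF *(1)] eq[OF *(2)] *(3) by auto
    moreover have "(s - t) * (b (c t) - a (c t))
        = ((1 - s) * a (c t) + s * b (c t)) - ((1 - t) * a (c t) + t * b (c t))"
      by (simp add: algebra_simps)
    ultimately have 1: "(s - t) * (b (c t) - a (c t)) = 0" by simp
    have "b (c t) \<noteq> a (c t)"
      using eq[OF *(2)] nz[OF *(2)] by (auto simp: algebra_simps)
    then show "s = t" using 1 by simp
  qed
  note inj = this
  show "finite ?S" by (rule inj_on_finite[OF inj img finite_separators[OF \<Gamma>]])
  show "card ?S \<le> card (separators \<Gamma> x y)"
    by (rule card_inj_on_le[OF inj img finite_separators[OF \<Gamma>]])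
qed

text \<open>A generic ray that reaches the far side of the bisector of \<open>\<gamma>\<close> crosses it at
  a point of no other bisector. Points just before and just after the crossing are separated by
  this bisector alone.\<close>

lemma adjacent_points:
  fixes \<Gamma> :: "'e::euclidean_space set"
  assumes \<Gamma>: "discrete_subgroup \<Gamma>" and \<gamma>: "\<gamma> \<in> \<Gamma> - {0}"
  obtains x y where "regular \<Gamma> x" "regular \<Gamma> y" "separators \<Gamma> x y = {\<gamma>}"
proof -
  have "{v. beyond \<gamma> v} \<noteq> {}" using beyond_self[of \<gamma>] \<gamma> by blast
  then obtain y where "y \<in> {v. beyond \<gamma> v}" and y2: "\<forall>t. simple \<Gamma> (0 + t *\<^sub>R (y - 0))"
    using generic_segment[OF \<Gamma> zero_regular open_beyond[of \<gamma>]] by blast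
  then have y1: "beyond \<gamma> y" by simp
  define s where "s = \<gamma> \<bullet> \<gamma> / (2 * (y \<bullet> \<gamma>))"
  have pos: "y \<bullet> \<gamma> > 0"
    using y1 inner_ge_zero[of \<gamma>] unfolding beyond_def by linarith
  have on: "on_bisector \<gamma> (s *\<^sub>R y)" using pos by (simp add: on_bisector_def s_def)
  have off: "\<not> on_bisector \<delta> (s *\<^sub>R y)" if "\<delta> \<in> \<Gamma>-{0}" "\<delta> \<noteq> \<gamma>" for \<delta>
    using y2[rule_format, of s] that \<gamma> on by (auto simp: simple_def)
  obtain r where r: "r > 0" "\<And>w. w \<in> ball (s *\<^sub>R y) r \<Longrightarrow>
      \<forall>\<delta>\<in>\<Gamma>. \<not> on_bisector \<delta> (s *\<^sub>R y) \<longrightarrow> beyond \<delta> w = beyond \<delta> (s *\<^sub>R y) \<and> \<not> on_bisector \<delta> w"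
    using eventually_same_side[OF \<Gamma>, of "s *\<^sub>R y"] unfolding eventually_nhds_metric
    by (auto simp: dist_commute)
  have ny: "norm y > 0" using pos by auto
  define e where "e = r / (2 * norm y)"
  have e: "e > 0" "e * norm y < r" using r ny by (auto simp: e_def)
  define x1 x2 where "x1 = (s - e) *\<^sub>R y" and "x2 = (s + e) *\<^sub>R y"
  have "dist (s *\<^sub>R y) x1 = e * norm y" "dist (s *\<^sub>R y) x2 = e * norm y"
    using e by (auto simp: x1_def x2_def dist_norm simp flip: scaleR_left_diff_distrib)
  then have b: "x1 \<in> ball (s *\<^sub>R y) r" "x2 \<in> ball (s *\<^sub>R y) r" using e by auto
  have s2: "2 * (s * (y \<bullet> \<gamma>)) = \<gamma> \<bullet> \<gamma>" using on by (simp add: on_bisector_def)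
  have "e * (y \<bullet> \<gamma>) > 0" using e pos by simp
  then have 3: "\<not> beyond \<gamma> x1" "beyond \<gamma> x2" "\<not> on_bisector \<gamma> x1" "\<not> on_bisector \<gamma> x2"
    using s2 by (auto simp: beyond_def on_bisector_def x1_def x2_def algebra_simps)
  show ?thesis
  proof
    show "regular \<Gamma> x1" "regular \<Gamma> x2"
      using r(2)[OF b(1)] r(2)[OF b(2)] off 3 by (auto simp: regular_iff)
    have "beyond \<delta> x1 = beyond \<delta> x2" if "\<delta> \<in> \<Gamma>-{0}" "\<delta> \<noteq> \<gamma>" for \<delta>
      using off[OF that] that r(2)[OF b(1)] r(2)[OF b(2)] by auto
    then show "separators \<Gamma> x1 x2 = {\<gamma>}"
      using \<gamma> 3 by (auto simp: separators_def)
  qed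
qed

text \<open>The side of a hyperplane is determined by numbers of separating hyperplanes: the sets of
  separators from \<open>z\<close> to \<open>x\<close> and to \<open>y\<close> differ by
  \<open>\<gamma>\<close> only.\<close>

lemma beyond_iff_separators:
  assumes \<Gamma>: "discrete_subgroup \<Gamma>" and "separators \<Gamma> x y = {\<gamma>}"
  shows "beyond \<gamma> z \<noteq> beyond \<gamma> x \<longleftrightarrow> card (separators \<Gamma> z y) < card (separators \<Gamma> z x)"
proof -
  have \<gamma>: "\<gamma> \<in> \<Gamma> - {0}" "beyond \<gamma> x \<noteq> beyond \<gamma> y" using assms by (auto simp: separators_def)
  have other: "\<delta> \<in> separators \<Gamma> z x \<longleftrightarrow> \<delta> \<in> separators \<Gamma> z y" if "\<delta> \<noteq> \<gamma>" for \<delta>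
    using assms(2) that unfolding separators_def by blast
  show ?thesis
  proof (cases "beyond \<gamma> z = beyond \<gamma> x")
    case True
    then have "\<gamma> \<notin> separators \<Gamma> z x" "\<gamma> \<in> separators \<Gamma> z y" using \<gamma> by (auto simp: separators_def)
    then have "separators \<Gamma> z x \<subseteq> separators \<Gamma> z y" using other by (metis subsetI)
    then have "card (separators \<Gamma> z x) \<le> card (separators \<Gamma> z y)"
      using finite_separators[OF \<Gamma>] card_mono by blast
    then show ?thesis using True by simp
  next
    case False
    then have "\<gamma> \<in> separators \<Gamma> z x" "\<gamma> \<notin> separators \<Gamma> z y" using \<gamma> by (auto simp: separators_def)
    then have "separators \<Gamma> z y \<subset> separators \<Gamma> z x" using other by (metis psubsetI subsetI)
    then have "card (separators \<Gamma> z y) < card (separators \<Gamma> z x)"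
      using finite_separators[OF \<Gamma>] psubset_card_mono by blast
    then show ?thesis using False by simp
  qed
qed

text \<open>The trace of a focal equivalence on one fibre of the tangent bundle: it respects the strata of
  points on no bisector and of points on at most one.\<close>

locale arrangement_homeo =
  fixes \<Gamma> \<Gamma>' :: "'e::euclidean_space set" and h k :: "'e \<Rightarrow> 'e"
  assumes \<Gamma>: "discrete_subgroup \<Gamma>" and \<Gamma>': "discrete_subgroup \<Gamma>'"
    and homeo: "homeomorphism UNIV UNIV h k" and h0: "h 0 = 0"
    and regular: "\<And>v. regular \<Gamma>' (h v) \<longleftrightarrow> regular \<Gamma> v"
    and simple: "\<And>v. simple \<Gamma>' (h v) \<longleftrightarrow> simple \<Gamma> v"
begin

lemma kh [simp]: "k (h v) = v" and hk [simp]: "h (k v) = v"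
  using homeo by (auto simp: homeomorphism_def)

lemma cont_h: "continuous_on S h" and cont_k: "continuous_on S k"
  using homeo by (auto simp: homeomorphism_def intro: continuous_on_subset)

lemma tendsto_h: "(h \<longlongrightarrow> h y) (nhds y)"
  using cont_h[of UNIV] by (simp add: continuous_on_eq_continuous_at isCont_def tendsto_at_iff_tendsto_nhds)

lemma inverse: "arrangement_homeo \<Gamma>' \<Gamma> k h"
proof
  show "homeomorphism UNIV UNIV k h" using homeo by (rule homeomorphism_symD)
  show "k 0 = 0" using h0 kh by metis
  show "regular \<Gamma> (k v) \<longleftrightarrow> regular \<Gamma>' v" for v using regular[of "k v"] by simp
  show "simple \<Gamma> (k v) \<longleftrightarrow> simple \<Gamma>' v" for v using simple[of "k v"] by simp
qed (rule \<Gamma> \<Gamma>')+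

text \<open>The image of a generic segment under \<open>h\<close> is a path of simple points with equally
  many crossings. Making the segment generic moves its end \<open>y\<close> so little that
  neither \<open>y\<close> nor \<open>h y\<close> crosses a hyperplane.\<close>

lemma card_separators_le:
  assumes x: "regular \<Gamma> x" and y: "regular \<Gamma> y"
  shows "card (separators \<Gamma>' (h x) (h y)) \<le> card (separators \<Gamma> x y)"
proof -
  have "eventually (\<lambda>w. \<forall>x. separators \<Gamma> x w = separators \<Gamma> x y) (nhds y)"
    using eventually_separators_same[OF \<Gamma> y] .
  moreover have "eventually (\<lambda>w. \<forall>x. separators \<Gamma>' x w = separators \<Gamma>' x (h y)) (nhds (h y))"
    using eventually_separators_same[OF \<Gamma>'] regular y by blast
  then have "eventually (\<lambda>w. \<forall>x. separators \<Gamma>' x (h w) = separators \<Gamma>' x (h y)) (nhds y)"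
    by (rule eventually_compose_filterlim[OF _ tendsto_h])
  ultimately have "eventually (\<lambda>w. (\<forall>x. separators \<Gamma> x w = separators \<Gamma> x y) \<and>
      (\<forall>x. separators \<Gamma>' x (h w) = separators \<Gamma>' x (h y))) (nhds y)"
    by (rule eventually_conj)
  then obtain U where U: "open U" "y \<in> U" "\<forall>w\<in>U. (\<forall>x. separators \<Gamma> x w = separators \<Gamma> x y) \<and>
      (\<forall>x. separators \<Gamma>' x (h w) = separators \<Gamma>' x (h y))"
    unfolding eventually_nhds by metis
  have "U \<noteq> {}" using U(2) by blast
  then obtain w where w: "w \<in> U" "regular \<Gamma> w" "\<forall>t. simple \<Gamma> (x + t *\<^sub>R (w - x))"
    using generic_segment[OF \<Gamma> x U(1)] by blast
  let ?g = "\<lambda>t. h (x + t *\<^sub>R (w - x))"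
  have eq: "{t\<in>{0..1}. \<not> regular \<Gamma>' (?g t)} = {t\<in>{0..1}. \<not> regular \<Gamma> (x + t *\<^sub>R (w - x))}"
    using regular by simp
  have "continuous_on {0..1} ?g"
    by (intro continuous_on_compose2[OF cont_h[of UNIV]] continuous_intros) auto
  then have "card (separators \<Gamma>' (?g 0) (?g 1)) \<le> card {t\<in>{0..1}. \<not> regular \<Gamma>' (?g t)}"
    using crossings_le_separators[OF \<Gamma> x w(2)] w(3) simple
    by (intro separators_le_crossings) (auto simp: regular)
  also have "\<dots> \<le> card (separators \<Gamma> x w)"
    unfolding eq by (rule crossings_le_separators[OF \<Gamma> x w(2)])
  finally show ?thesis using U(3) w(1) by simp
qed

lemma card_separators:
  assumes x: "regular \<Gamma> x" and y: "regular \<Gamma> y"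
  shows "card (separators \<Gamma>' (h x) (h y)) = card (separators \<Gamma> x y)"
proof (rule antisym)
  show "card (separators \<Gamma> x y) \<le> card (separators \<Gamma>' (h x) (h y))"
    using arrangement_homeo.card_separators_le[OF inverse, of "h x" "h y"] assms regular by simp
qed (rule card_separators_le[OF assms])

text \<open>Adjacent points have adjacent images, and the sides of the two separating hyperplanes correspond
  because both are expressed by numbers of separators. The origin decides which side is which.\<close>

lemma beyond_regular:
  assumes \<gamma>: "\<gamma> \<in> \<Gamma> - {0}"
  shows "\<exists>\<gamma>'. \<gamma>' \<in> \<Gamma>' - {0} \<and> (\<forall>z. regular \<Gamma> z \<longrightarrow> beyond \<gamma>' (h z) = beyond \<gamma> z)"
proof -
  obtain x y where xy: "regular \<Gamma> x" "regular \<Gamma> y" "separators \<Gamma> x y = {\<gamma>}"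
    using adjacent_points[OF \<Gamma> \<gamma>] .
  have "card (separators \<Gamma>' (h x) (h y)) = 1" using card_separators[OF xy(1,2)] xy(3) by simp
  then obtain \<gamma>' where \<gamma>': "separators \<Gamma>' (h x) (h y) = {\<gamma>'}" by (auto simp: card_1_singleton_iff)
  have *: "beyond \<gamma>' (h z) \<noteq> beyond \<gamma>' (h x) \<longleftrightarrow> beyond \<gamma> z \<noteq> beyond \<gamma> x" if "regular \<Gamma> z" for z
    unfolding beyond_iff_separators[OF \<Gamma> xy(3)] beyond_iff_separators[OF \<Gamma>' \<gamma>']
      card_separators[OF that xy(1)] card_separators[OF that xy(2)] ..
  have "beyond \<gamma>' (h x) \<longleftrightarrow> beyond \<gamma> x"
    using *[OF zero_regular] zero_not_beyond[of \<gamma>] zero_not_beyond[of \<gamma>'] unfolding h0 by blast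
  then have same: "\<forall>z. regular \<Gamma> z \<longrightarrow> beyond \<gamma>' (h z) = beyond \<gamma> z" using * by metis
  have mem: "\<gamma>' \<in> \<Gamma>' - {0}"
    using \<gamma>' unfolding separators_def by blast
  show ?thesis by (intro exI[of _ \<gamma>'] conjI mem same)
qed

end

lemma closure_not_beyond:
  assumes "\<gamma> \<noteq> 0" "\<not> beyond \<gamma> v"  "open U" "v \<in> U"
  obtains w where "w \<in> U" "\<not> beyond \<gamma> w" "\<not> on_bisector \<gamma> w"
proof -
  obtain e where e: "e > 0" "ball v e \<subseteq> U" using assms openE by blast
  define w where "w = v - (e / (2 * norm \<gamma>)) *\<^sub>R \<gamma>"
  have "norm \<gamma> > 0" using assms by simp
  then have "w \<in> ball v e" using e by (auto simp: w_def dist_norm)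
  moreover have "w \<bullet> \<gamma> < v \<bullet> \<gamma>" using e \<open>norm \<gamma> > 0\<close> assms(1) by (simp add: w_def algebra_simps)
  ultimately show ?thesis using that[of w] e assms(2) by (auto simp: beyond_def on_bisector_def)
qed

context arrangement_homeo
begin

text \<open>Regular points are dense. If a point beyond \<open>\<gamma>\<close> were mapped to a point not
  beyond \<open>\<gamma>'\<close>, a whole open set of points beyond \<open>\<gamma>\<close>
  would have images strictly before the bisector of \<open>\<gamma>'\<close>.\<close>

lemma beyond_imp:
  assumes \<gamma>': "\<gamma>' \<noteq> 0" "\<And>z. regular \<Gamma> z \<Longrightarrow> beyond \<gamma>' (h z) \<longleftrightarrow> beyond \<gamma> z"
    and v: "beyond \<gamma> v"
  shows "beyond \<gamma>' (h v)"
proof (rule ccontr)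
  assume "\<not> beyond \<gamma>' (h v)"
  moreover have "open (k -` {v. beyond \<gamma> v})"
    using cont_k[of UNIV] open_beyond open_vimage by blast
  ultimately obtain w where w: "beyond \<gamma> (k w)" "\<not> beyond \<gamma>' w" "\<not> on_bisector \<gamma>' w"
    using closure_not_beyond[of \<gamma>' "h v" "k -` {v. beyond \<gamma> v}"] \<gamma>'(1) v by auto
  have "open {w. 2 * (w \<bullet> \<gamma>') < \<gamma>' \<bullet> \<gamma>'}"
    by (intro open_Collect_less continuous_intros)
  then have "open (h -` {w. 2 * (w \<bullet> \<gamma>') < \<gamma>' \<bullet> \<gamma>'})"
    using cont_h[of UNIV] open_vimage by blast
  then have "open ({v. beyond \<gamma> v} \<inter> h -` {w. 2 * (w \<bullet> \<gamma>') < \<gamma>' \<bullet> \<gamma>'})"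
    using open_beyond by blast
  moreover have "k w \<in> {v. beyond \<gamma> v} \<inter> h -` {w. 2 * (w \<bullet> \<gamma>') < \<gamma>' \<bullet> \<gamma>'}"
    using w by (auto simp: beyond_def on_bisector_def)
  ultimately obtain z where "z \<in> {v. beyond \<gamma> v} \<inter> h -` {w. 2 * (w \<bullet> \<gamma>') < \<gamma>' \<bullet> \<gamma>'}" "regular \<Gamma> z"
    using generic_segment[OF \<Gamma> zero_regular, of "{v. beyond \<gamma> v} \<inter> h -` {w. 2 * (w \<bullet> \<gamma>') < \<gamma>' \<bullet> \<gamma>'}"]
    by blast
  then show False using \<gamma>'(2)[of z] by (auto simp: beyond_def)
qed

text \<open>The correspondence of sides at regular points extends to all points, by density and in both directions.\<close>

theorem half_space_image:
  assumes \<gamma>: "\<gamma> \<in> \<Gamma> - {0}"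
  shows "\<exists>\<gamma>'\<in>\<Gamma>'-{0}. \<forall>z. beyond \<gamma>' (h z) \<longleftrightarrow> beyond \<gamma> z"
proof -
  obtain \<gamma>' where \<gamma>': "\<gamma>' \<in> \<Gamma>' - {0}" "\<And>z. regular \<Gamma> z \<Longrightarrow> beyond \<gamma>' (h z) \<longleftrightarrow> beyond \<gamma> z"
    using beyond_regular[OF \<gamma>] by metis
  have nz: "\<gamma>' \<noteq> 0" "\<gamma> \<noteq> 0" using \<gamma>'(1) \<gamma> by auto
  have 1: "beyond \<gamma>' (h z)" if "beyond \<gamma> z" for z
    by (rule beyond_imp[OF nz(1) \<gamma>'(2) that])
  have *: "beyond \<gamma> (k z) \<longleftrightarrow> beyond \<gamma>' z" if "regular \<Gamma>' z" for z
    using \<gamma>'(2)[of "k z"] regular[of "k z"] that unfolding hk by simp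
  have 2: "beyond \<gamma> (k z)" if "beyond \<gamma>' z" for z
    by (rule arrangement_homeo.beyond_imp[OF inverse nz(2) * that])
  have "beyond \<gamma>' (h z) \<longleftrightarrow> beyond \<gamma> z" for z
  proof
    show "beyond \<gamma>' (h z) \<Longrightarrow> beyond \<gamma> z" using 2[of "h z"] by simp
  qed (rule 1)
  then have all: "\<forall>z. beyond \<gamma>' (h z) \<longleftrightarrow> beyond \<gamma> z" ..
  show ?thesis by (rule bexI[of _ "\<gamma>'"]) (fact all, fact \<gamma>'(1))
qed

end

section \<open>Recovering the lattice from the arrangement\<close>

lemma orthogonal_decomposition:
  fixes \<gamma> \<delta> :: "'e::euclidean_space"
  assumes "\<gamma> \<noteq> 0"
  obtains s \<eta> where "\<delta> = s *\<^sub>R \<gamma> + \<eta>" "\<eta> \<bullet> \<gamma> = 0"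
proof
  show "\<delta> = ((\<delta> \<bullet> \<gamma>) / (\<gamma> \<bullet> \<gamma>)) *\<^sub>R \<gamma> + (\<delta> - ((\<delta> \<bullet> \<gamma>) / (\<gamma> \<bullet> \<gamma>)) *\<^sub>R \<gamma>)" by simp
  show "(\<delta> - ((\<delta> \<bullet> \<gamma>) / (\<gamma> \<bullet> \<gamma>)) *\<^sub>R \<gamma>) \<bullet> \<gamma> = 0" using assms by (simp add: inner_diff_left)
qed

text \<open>The bisectors of the multiples of \<open>\<gamma>\<close> are the level sets of one linear
  functional, and the multiple is the level.\<close>

lemma beyond_scaleR:
  fixes \<gamma> z :: "'e::euclidean_space"
  assumes "s > 0" "\<gamma> \<noteq> 0"
  shows "beyond (s *\<^sub>R \<gamma>) z \<longleftrightarrow> 2 * (z \<bullet> \<gamma>) / (\<gamma> \<bullet> \<gamma>) > s"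
proof -
  have "\<gamma> \<bullet> \<gamma> > 0" using assms by simp
  moreover have "beyond (s *\<^sub>R \<gamma>) z \<longleftrightarrow> s * (2 * (z \<bullet> \<gamma>)) > s * (s * (\<gamma> \<bullet> \<gamma>))"
    by (simp add: beyond_def algebra_simps)
  ultimately show ?thesis using assms by (simp add: pos_less_divide_eq)
qed

text \<open>Translations along the component \<open>\<eta>\<close> of \<open>\<delta>\<close> orthogonal to \<open>\<gamma>\<close> preserve the half-space of \<open>\<gamma>\<close>
  but leave that of \<open>\<delta>\<close>, so inclusion forces parallel normals; the factor then compares the boundaries.\<close>

lemma beyond_subset_iff:
  fixes \<gamma> \<delta> :: "'e::euclidean_space"
  assumes "\<gamma> \<noteq> 0"
  shows "(\<forall>z. beyond \<gamma> z \<longrightarrow> beyond \<delta> z) \<longleftrightarrow> (\<exists>s. 0 < s \<and> s \<le> 1 \<and> \<delta> = s *\<^sub>R \<gamma>)"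
proof
  assume *: "\<forall>z. beyond \<gamma> z \<longrightarrow> beyond \<delta> z"
  obtain s \<eta> where \<delta>: "\<delta> = s *\<^sub>R \<gamma> + \<eta>" and o: "\<eta> \<bullet> \<gamma> = 0"
    using orthogonal_decomposition[OF assms] .
  have o': "\<gamma> \<bullet> \<eta> = 0" using o by (simp add: inner_commute)
  define g e where "g = \<gamma> \<bullet> \<gamma>" and "e = \<eta> \<bullet> \<eta>"
  have g: "g > 0" using assms by (simp add: g_def)
  have step: "2 * a > 1 \<Longrightarrow> 2 * (a * s * g + b * e) > s * s * g + e" for a b
  proof -
    assume "2 * a > 1"
    then have "beyond \<gamma> (a *\<^sub>R \<gamma> + b *\<^sub>R \<eta>)"
      using g o by (simp add: beyond_def g_def inner_add_left)
    then have "beyond \<delta> (a *\<^sub>R \<gamma> + b *\<^sub>R \<eta>)" using * by blast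
    then show ?thesis
      by (simp add: beyond_def \<delta> inner_add_left inner_add_right o o' g_def e_def algebra_simps)
  qed
  have "e = 0"
  proof (rule ccontr)
    assume "e \<noteq> 0"
    then have "e > 0" using inner_ge_zero[of \<eta>] by (simp add: e_def less_le)
    then show False
      using step[of 1 "(s * s * g / 2 - s * g) / e"] by (simp add: field_simps)
  qed
  then have \<eta>: "\<eta> = 0" by (simp add: e_def)
  have step': "2 * a > 1 \<Longrightarrow> 2 * a * s > s * s" for a
  proof -
    assume "2 * a > 1"
    then have "g * (2 * a * s) > g * (s * s)" using step[of a 0] \<open>e = 0\<close> by (simp add: algebra_simps)
    then show ?thesis using g by simp
  qed
  have "s > 0"
    using step'[of 1] zero_le_square[of s] by linarith
  moreover have "s \<le> 1"
  proof (rule ccontr)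
    assume "\<not> s \<le> 1"
    then show False using step'[of "s / 2"] by simp
  qed
  ultimately show "\<exists>s. 0 < s \<and> s \<le> 1 \<and> \<delta> = s *\<^sub>R \<gamma>" using \<delta> \<eta> by auto
next
  assume "\<exists>s. 0 < s \<and> s \<le> 1 \<and> \<delta> = s *\<^sub>R \<gamma>"
  then obtain s where s: "0 < s" "s \<le> 1" "\<delta> = s *\<^sub>R \<gamma>" by blast
  show "\<forall>z. beyond \<gamma> z \<longrightarrow> beyond \<delta> z"
    using beyond_scaleR[OF s(1) assms] beyond_scaleR[of 1, OF _ assms] s by force
qed

lemma beyond_disjoint_imp:
  fixes \<gamma> \<delta> :: "'e::euclidean_space"
  assumes "\<gamma> \<noteq> 0" "\<delta> \<noteq> 0" and *: "\<And>z. \<not> (beyond \<gamma> z \<and> beyond \<delta> z)"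
  shows "\<exists>s<0. \<delta> = s *\<^sub>R \<gamma>"
proof -
  obtain s \<eta> where \<delta>: "\<delta> = s *\<^sub>R \<gamma> + \<eta>" and o: "\<eta> \<bullet> \<gamma> = 0"
    using orthogonal_decomposition[OF assms(1)] .
  have o': "\<gamma> \<bullet> \<eta> = 0" using o by (simp add: inner_commute)
  define g e where "g = \<gamma> \<bullet> \<gamma>" and "e = \<eta> \<bullet> \<eta>"
  have g: "g > 0" using assms by (simp add: g_def)
  have step: "2 * a > 1 \<Longrightarrow> 2 * (a * s * g + b * e) \<le> s * s * g + e" for a b
  proof -
    assume "2 * a > 1"
    then have "beyond \<gamma> (a *\<^sub>R \<gamma> + b *\<^sub>R \<eta>)"
      using g o by (simp add: beyond_def g_def inner_add_left)
    then have "\<not> beyond \<delta> (a *\<^sub>R \<gamma> + b *\<^sub>R \<eta>)" using * by blast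
    then show ?thesis
      by (simp add: beyond_def \<delta> inner_add_left inner_add_right o o' g_def e_def algebra_simps)
  qed
  have "e = 0"
  proof (rule ccontr)
    assume "e \<noteq> 0"
    then have "e > 0" using inner_ge_zero[of \<eta>] by (simp add: e_def less_le)
    define P where "P = s * s * g"
    have "P \<ge> 0" using g by (simp add: P_def)
    define b where "b = (P + e - s * g) / e"
    have "b * e = P + e - s * g" using \<open>e \<noteq> 0\<close> by (simp add: b_def)
    then have "2 * (P + e) \<le> P + e" using step[of 1 b] by (simp add: P_def)
    then have "P + e \<le> 0" by simp
    then show False using \<open>e > 0\<close> \<open>P \<ge> 0\<close> by simp
  qed
  then have \<eta>: "\<eta> = 0" by (simp add: e_def)
  have "s \<noteq> 0" using assms \<delta> \<eta> by auto
  moreover have "\<not> s > 0"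
  proof
    assume "s > 0"
    then show False using step[of "s + 1" 0] g \<open>e = 0\<close>
      by (simp add: algebra_simps) (smt (verit) mult_pos_pos)
  qed
  ultimately show ?thesis using \<delta> \<eta> by (intro exI[of _ s]) auto
qed

lemma beyond_inject:
  fixes \<gamma> \<delta> :: "'e::euclidean_space"
  assumes "\<gamma> \<noteq> 0" "\<delta> \<noteq> 0" "\<forall>z. beyond \<gamma> z = beyond \<delta> z"
  shows "\<gamma> = \<delta>"
proof -
  obtain s t where st: "0 < s" "s \<le> 1" "\<delta> = s *\<^sub>R \<gamma>" "0 < t" "t \<le> 1" "\<gamma> = t *\<^sub>R \<delta>"
    using beyond_subset_iff[OF assms(1), of \<delta>] beyond_subset_iff[OF assms(2), of \<gamma>] assms(3) by metis
  then have "(s * t) *\<^sub>R \<gamma> = 1 *\<^sub>R \<gamma>" by (metis mult.commute scaleR_one scaleR_scaleR)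
  then have "s * t = 1" using assms(1) by (simp only: scaleR_right_imp_eq)
  then have "s = 1" using st by (smt (verit) mult_left_le)
  then show ?thesis using st by simp
qed

text \<open>The lattice points on the segment from \<open>0\<close> to \<open>\<gamma>\<close>, described
  through half-spaces, so that any bijection preserving inclusion of half-spaces preserves it.\<close>

definition chain :: "'e::euclidean_space set \<Rightarrow> 'e \<Rightarrow> 'e set" where
  "chain \<Gamma> \<gamma> = {\<delta>\<in>\<Gamma>-{0}. \<forall>z. beyond \<gamma> z \<longrightarrow> beyond \<delta> z}"

lemma chain_eq:
  assumes "\<gamma> \<noteq> 0"
  shows "chain \<Gamma> \<gamma> = {\<delta>\<in>\<Gamma>. \<exists>s. 0 < s \<and> s \<le> 1 \<and> \<delta> = s *\<^sub>R \<gamma>}"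
  unfolding chain_def beyond_subset_iff[OF assms] using assms by auto

lemma finite_chain:
  assumes "discrete_subgroup \<Gamma>" "\<gamma> \<noteq> 0"
  shows "finite (chain \<Gamma> \<gamma>)"
proof (rule finite_subset[OF _ discrete_subgroup_finite[OF assms(1)]])
  show "chain \<Gamma> \<gamma> \<subseteq> {\<delta> \<in> \<Gamma>. norm \<delta> \<le> norm \<gamma>}"
    unfolding chain_eq[OF assms(2)]
  proof
    fix \<delta> assume "\<delta> \<in> {\<delta> \<in> \<Gamma>. \<exists>s>0. s \<le> 1 \<and> \<delta> = s *\<^sub>R \<gamma>}"
    then obtain s where s: "0 < s" "s \<le> 1" "\<delta> = s *\<^sub>R \<gamma>" "\<delta> \<in> \<Gamma>" by blast
    then have "norm \<delta> \<le> norm \<gamma>" using mult_left_le_one_le[of "norm \<gamma>" s] by simp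
    then show "\<delta> \<in> {\<delta> \<in> \<Gamma>. norm \<delta> \<le> norm \<gamma>}" using s(4) by blast
  qed
qed

lemma chain_scaleR:
  assumes "\<gamma> \<noteq> 0" "t > 0"
  shows "chain \<Gamma> (t *\<^sub>R \<gamma>) = {\<delta>\<in>\<Gamma>. \<exists>s. 0 < s \<and> s \<le> t \<and> \<delta> = s *\<^sub>R \<gamma>}" (is "?L = ?R")
proof -
  have "(\<exists>s. 0 < s \<and> s \<le> 1 \<and> \<delta> = s *\<^sub>R t *\<^sub>R \<gamma>) \<longleftrightarrow> (\<exists>s. 0 < s \<and> s \<le> t \<and> \<delta> = s *\<^sub>R \<gamma>)" for \<delta>
  proof
    assume "\<exists>s. 0 < s \<and> s \<le> 1 \<and> \<delta> = s *\<^sub>R t *\<^sub>R \<gamma>"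
    then obtain s where "0 < s" "s \<le> 1" "\<delta> = s *\<^sub>R t *\<^sub>R \<gamma>" by blast
    then show "\<exists>s. 0 < s \<and> s \<le> t \<and> \<delta> = s *\<^sub>R \<gamma>"
      using assms by (intro exI[of _ "s * t"]) (auto intro: mult_left_le_one_le)
  next
    assume "\<exists>s. 0 < s \<and> s \<le> t \<and> \<delta> = s *\<^sub>R \<gamma>"
    then obtain s where "0 < s" "s \<le> t" "\<delta> = s *\<^sub>R \<gamma>" by blast
    then show "\<exists>s. 0 < s \<and> s \<le> 1 \<and> \<delta> = s *\<^sub>R t *\<^sub>R \<gamma>"
      using assms by (intro exI[of _ "s / t"]) auto
  qed
  then show ?thesis using assms by (simp add: chain_eq)
qed

text \<open>Translation by multiples of \<open>\<gamma>\<close> cuts the lattice points on a long segment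
  into copies of those on the segment from \<open>0\<close> to \<open>\<gamma>\<close>.\<close>

lemma card_chain_nat:
  assumes \<Gamma>: "discrete_subgroup \<Gamma>" and \<gamma>: "\<gamma> \<in> \<Gamma> - {0}"
  shows "card (chain \<Gamma> (real (Suc k) *\<^sub>R \<gamma>)) = Suc k * card (chain \<Gamma> \<gamma>)"
proof (induction k)
  case 0
  then show ?case by simp
next
  case (Suc k)
  define K where "K = real (Suc k)"
  have nz: "\<gamma> \<noteq> 0" using \<gamma> by simp
  have K: "K > 0" "real (Suc (Suc k)) = K + 1" "K + 1 > 0" by (auto simp: K_def)
  have mem: "K *\<^sub>R \<gamma> \<in> \<Gamma>" using discrete_subgroup_scaleR_nat[OF \<Gamma>] \<gamma> unfolding K_def by blast
  have shift: "(\<lambda>\<delta>. \<delta> + K *\<^sub>R \<gamma>) ` chain \<Gamma> \<gamma> = {\<delta>\<in>\<Gamma>. \<exists>s. K < s \<and> s \<le> K + 1 \<and> \<delta> = s *\<^sub>R \<gamma>}"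
    (is "?L = ?R")
  proof (intro equalityI subsetI)
    fix \<delta> assume "\<delta> \<in> ?L"
    then obtain s where s: "0 < s" "s \<le> 1" "s *\<^sub>R \<gamma> \<in> \<Gamma>" "\<delta> = s *\<^sub>R \<gamma> + K *\<^sub>R \<gamma>"
      unfolding chain_eq[OF nz] by blast
    then have "\<delta> \<in> \<Gamma>" using mem discrete_subgroup_add[OF \<Gamma>] by blast
    moreover have "K < s + K \<and> s + K \<le> K + 1 \<and> \<delta> = (s + K) *\<^sub>R \<gamma>"
      using s by (simp add: scaleR_add_left)
    ultimately show "\<delta> \<in> ?R" by blast
  next
    fix \<delta> assume "\<delta> \<in> ?R"
    then obtain s where s: "K < s" "s \<le> K + 1" "\<delta> = s *\<^sub>R \<gamma>" "\<delta> \<in> \<Gamma>" by blast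
    then have "\<delta> - K *\<^sub>R \<gamma> \<in> \<Gamma>" using mem discrete_subgroup_diff[OF \<Gamma>] by blast
    moreover have "0 < s - K \<and> s - K \<le> 1 \<and> \<delta> - K *\<^sub>R \<gamma> = (s - K) *\<^sub>R \<gamma>"
      using s by (simp add: scaleR_diff_left)
    ultimately have "\<delta> - K *\<^sub>R \<gamma> \<in> chain \<Gamma> \<gamma>"
      unfolding chain_eq[OF nz] by blast
    then show "\<delta> \<in> ?L" by (metis diff_add_cancel image_eqI)
  qed
  have "chain \<Gamma> (real (Suc (Suc k)) *\<^sub>R \<gamma>) = chain \<Gamma> (K *\<^sub>R \<gamma>) \<union> ?R"
    unfolding K(2) chain_scaleR[OF nz K(1)] chain_scaleR[OF nz K(3)]
  proof (intro equalityI subsetI)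
    fix \<delta> assume "\<delta> \<in> {\<delta> \<in> \<Gamma>. \<exists>s>0. s \<le> K + 1 \<and> \<delta> = s *\<^sub>R \<gamma>}"
    then obtain s where "\<delta> \<in> \<Gamma>" "s > 0" "s \<le> K + 1" "\<delta> = s *\<^sub>R \<gamma>" by blast
    then show "\<delta> \<in> {\<delta> \<in> \<Gamma>. \<exists>s>0. s \<le> K \<and> \<delta> = s *\<^sub>R \<gamma>} \<union> ?R"
      using linorder_not_le[of s K] by blast
  next
    fix \<delta> assume "\<delta> \<in> {\<delta> \<in> \<Gamma>. \<exists>s>0. s \<le> K \<and> \<delta> = s *\<^sub>R \<gamma>} \<union> ?R"
    then obtain s where "\<delta> \<in> \<Gamma>" "s > 0" "s \<le> K + 1" "\<delta> = s *\<^sub>R \<gamma>"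
    proof (elim UnE CollectE conjE exE)
      fix s assume *: "\<And>s. \<lbrakk>\<delta> \<in> \<Gamma>; 0 < s; s \<le> K + 1; \<delta> = s *\<^sub>R \<gamma>\<rbrakk> \<Longrightarrow> thesis"
        and s: "\<delta> \<in> \<Gamma>" "0 < s" "s \<le> K" "\<delta> = s *\<^sub>R \<gamma>"
      show thesis by (rule *[of s]) (use s in auto)
    next
      fix s assume *: "\<And>s. \<lbrakk>\<delta> \<in> \<Gamma>; 0 < s; s \<le> K + 1; \<delta> = s *\<^sub>R \<gamma>\<rbrakk> \<Longrightarrow> thesis"
        and s: "\<delta> \<in> \<Gamma>" "K < s" "s \<le> K + 1" "\<delta> = s *\<^sub>R \<gamma>"
      show thesis by (rule *[of s]) (use s K(1) in auto)
    qed
    then show "\<delta> \<in> {\<delta> \<in> \<Gamma>. \<exists>s>0. s \<le> K + 1 \<and> \<delta> = s *\<^sub>R \<gamma>}" by blast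
  qed
  moreover have "chain \<Gamma> (K *\<^sub>R \<gamma>) \<inter> ?R = {}"
    unfolding chain_scaleR[OF nz K(1)] using nz by auto
  moreover have "finite (chain \<Gamma> (K *\<^sub>R \<gamma>))" using finite_chain[OF \<Gamma>] nz K(1) by simp
  moreover have "finite ?R" unfolding shift[symmetric] using finite_chain[OF \<Gamma> nz] by simp
  moreover have "card ?R = card (chain \<Gamma> \<gamma>)"
    unfolding shift[symmetric] by (intro card_image) (auto intro: inj_onI)
  ultimately have "card (chain \<Gamma> (real (Suc (Suc k)) *\<^sub>R \<gamma>)) = card (chain \<Gamma> (K *\<^sub>R \<gamma>)) + card (chain \<Gamma> \<gamma>)"
    by (simp add: card_Un_disjoint)
  then show ?case using Suc by (simp add: K_def)
qed

lemma card_chain_minus: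
  assumes \<Gamma>: "discrete_subgroup \<Gamma>" and "\<gamma> \<noteq> 0"
  shows "card (chain \<Gamma> (- \<gamma>)) = card (chain \<Gamma> \<gamma>)"
proof -
  have "chain \<Gamma> (- \<gamma>) = uminus ` chain \<Gamma> \<gamma>"
  proof (intro equalityI subsetI)
    fix \<delta> assume "\<delta> \<in> chain \<Gamma> (- \<gamma>)"
    then have "- \<delta> \<in> chain \<Gamma> \<gamma>"
      using assms discrete_subgroup_minus[OF \<Gamma>] by (auto simp: chain_eq)
    then show "\<delta> \<in> uminus ` chain \<Gamma> \<gamma>" by (metis image_eqI minus_minus)
  qed (use assms discrete_subgroup_minus[OF \<Gamma>] in \<open>auto simp: chain_eq\<close>)
  then show ?thesis by (simp add: card_image)
qed

text \<open>Along a ray the number of lattice points up to \<open>\<gamma>\<close> increases strictly, so it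
  determines \<open>\<gamma>\<close>.\<close>

lemma card_chain_inject:
  assumes \<Gamma>: "discrete_subgroup \<Gamma>" and \<gamma>: "\<gamma> \<in> \<Gamma> - {0}" and \<delta>: "\<delta> \<in> \<Gamma> - {0}"
    and t: "\<delta> = t *\<^sub>R \<gamma>" "t > 0" and card: "card (chain \<Gamma> \<gamma>) = card (chain \<Gamma> \<delta>)"
  shows "\<delta> = \<gamma>"
proof -
  have less: "card (chain \<Gamma> \<gamma>) < card (chain \<Gamma> \<delta>)"
    if "\<gamma> \<in> \<Gamma> - {0}" "\<delta> \<in> \<Gamma> - {0}" "\<delta> = t *\<^sub>R \<gamma>" "t > 1" for \<gamma> \<delta> t
  proof (rule psubset_card_mono)
    have nz: "\<gamma> \<noteq> 0" "t > 0" using that by auto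
    show "finite (chain \<Gamma> \<delta>)" using finite_chain[OF \<Gamma>] that by blast
    have "\<delta> \<in> chain \<Gamma> \<delta>" using that by (auto simp: chain_def)
    moreover have "\<delta> \<notin> chain \<Gamma> \<gamma>" unfolding chain_eq[OF nz(1)] using that nz by auto
    moreover have "chain \<Gamma> \<gamma> \<subseteq> chain \<Gamma> \<delta>"
      unfolding that(3) chain_eq[OF nz(1)] chain_scaleR[OF nz] using that(4) by force
    ultimately show "chain \<Gamma> \<gamma> \<subset> chain \<Gamma> \<delta>" by blast
  qed
  have "\<not> t > 1" using less[OF \<gamma> \<delta> t(1)] unfolding card by blast
  moreover have "\<not> t < 1"
  proof
    assume "t < 1"
    then have *: "1 < 1 / t" "\<gamma> = (1 / t) *\<^sub>R \<delta>" using t by simp_all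
    have "card (chain \<Gamma> \<delta>) < card (chain \<Gamma> \<gamma>)" by (rule less[OF \<delta> \<gamma> *(2,1)])
    then show False unfolding card by (rule less_irrefl[THEN notE])
  qed
  ultimately show ?thesis using t by simp
qed


subsection \<open>The induced bijection of lattices\<close>

locale arrangement_bijection = arrangement_homeo \<Gamma> \<Gamma>' h k
  for \<Gamma> \<Gamma>' :: "'e::euclidean_space set" and h k :: "'e \<Rightarrow> 'e" +
  fixes f :: "'e \<Rightarrow> 'e"
  assumes f0: "f 0 = 0" and f_in: "\<gamma> \<in> \<Gamma> - {0} \<Longrightarrow> f \<gamma> \<in> \<Gamma>' - {0}"
    and f_beyond: "\<gamma> \<in> \<Gamma> - {0} \<Longrightarrow> beyond (f \<gamma>) (h z) \<longleftrightarrow> beyond \<gamma> z"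
begin

lemma all_h: "(\<forall>w. P (h w)) \<longleftrightarrow> (\<forall>w. P w)"
  by (metis hk)

lemma f_eqI:
  assumes "\<gamma> \<in> \<Gamma> - {0}" "\<gamma>' \<in> \<Gamma>' - {0}" "\<And>z. beyond \<gamma>' (h z) = beyond \<gamma> z"
  shows "f \<gamma> = \<gamma>'"
proof -
  have nz: "f \<gamma> \<noteq> 0" "\<gamma>' \<noteq> 0" using f_in[OF assms(1)] assms(2) by simp_all
  have "beyond (f \<gamma>) (h (k z)) = beyond \<gamma>' (h (k z))" for z
    unfolding assms(3) f_beyond[OF assms(1)] ..
  then have "\<forall>z. beyond (f \<gamma>) z = beyond \<gamma>' z" unfolding hk by blast
  then show ?thesis by (rule beyond_inject[OF nz])
qed

lemma f_inj0: "inj_on f (\<Gamma> - {0})"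
proof (rule inj_onI)
  fix \<gamma> \<delta> assume *: "\<gamma> \<in> \<Gamma> - {0}" "\<delta> \<in> \<Gamma> - {0}" "f \<gamma> = f \<delta>"
  have nz: "\<gamma> \<noteq> 0" "\<delta> \<noteq> 0" using *(1,2) by simp_all
  have "beyond \<gamma> z = beyond \<delta> z" for z
    using f_beyond[OF *(1), of z] f_beyond[OF *(2), of z] unfolding *(3) by blast
  then have "\<forall>z. beyond \<gamma> z = beyond \<delta> z" by blast
  then show "\<gamma> = \<delta>" by (rule beyond_inject[OF nz])
qed

lemma f_bij0: "bij_betw f (\<Gamma> - {0}) (\<Gamma>' - {0})"
  unfolding bij_betw_def
proof (rule conjI[OF f_inj0], rule equalityI)
  show "f ` (\<Gamma> - {0}) \<subseteq> \<Gamma>' - {0}" by (intro image_subsetI f_in)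
  show "\<Gamma>' - {0} \<subseteq> f ` (\<Gamma> - {0})"
  proof
    fix \<gamma>' assume \<gamma>': "\<gamma>' \<in> \<Gamma>' - {0}"
    obtain \<gamma> where \<gamma>: "\<gamma> \<in> \<Gamma> - {0}" "\<forall>z. beyond \<gamma> (k z) = beyond \<gamma>' z"
      using arrangement_homeo.half_space_image[OF inverse \<gamma>'] by blast
    have "beyond \<gamma>' (h z) = beyond \<gamma> z" for z
      using \<gamma>(2)[rule_format, of "h z"] by simp
    then have "f \<gamma> = \<gamma>'" by (rule f_eqI[OF \<gamma>(1) \<gamma>'])
    then show "\<gamma>' \<in> f ` (\<Gamma> - {0})" using \<gamma>(1) by blast
  qed
qed

lemma f_bij: "bij_betw f \<Gamma> \<Gamma>'"
proof -
  have "bij_betw f {0} {0}" using f0 by simp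
  then have "bij_betw f ((\<Gamma> - {0}) \<union> {0}) ((\<Gamma>' - {0}) \<union> {0})"
    by (intro bij_betw_combine[OF f_bij0]) auto
  moreover have "(\<Gamma> - {0}) \<union> {0} = \<Gamma>" "(\<Gamma>' - {0}) \<union> {0} = \<Gamma>'"
    using discrete_subgroup_zero[OF \<Gamma>] discrete_subgroup_zero[OF \<Gamma>'] by blast+
  ultimately show ?thesis by simp
qed

text \<open>Inclusion of half-spaces is a relation between sets of points, hence transported by
  \<open>h\<close>.\<close>

lemma f_subset:
  assumes "\<gamma> \<in> \<Gamma> - {0}" "\<delta> \<in> \<Gamma> - {0}"
  shows "(\<forall>z. beyond (f \<gamma>) z \<longrightarrow> beyond (f \<delta>) z) \<longleftrightarrow> (\<forall>z. beyond \<gamma> z \<longrightarrow> beyond \<delta> z)"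
  using all_h[of "\<lambda>z. beyond (f \<gamma>) z \<longrightarrow> beyond (f \<delta>) z"]
  unfolding f_beyond[OF assms(1)] f_beyond[OF assms(2)] by (rule sym)

lemma card_chain_f:
  assumes \<gamma>: "\<gamma> \<in> \<Gamma> - {0}"
  shows "card (chain \<Gamma>' (f \<gamma>)) = card (chain \<Gamma> \<gamma>)"
proof -
  have "chain \<Gamma>' (f \<gamma>) = f ` chain \<Gamma> \<gamma>"
  proof (intro equalityI subsetI)
    fix \<delta>' assume *: "\<delta>' \<in> chain \<Gamma>' (f \<gamma>)"
    then have "\<delta>' \<in> f ` (\<Gamma> - {0})" using f_bij0 by (auto simp: bij_betw_def chain_def)
    then obtain \<delta> where \<delta>: "\<delta> \<in> \<Gamma> - {0}" "\<delta>' = f \<delta>" by blast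
    then have "\<delta> \<in> chain \<Gamma> \<gamma>" using * f_subset[OF \<gamma> \<delta>(1)] unfolding chain_def by blast
    then show "\<delta>' \<in> f ` chain \<Gamma> \<gamma>" using \<delta> by blast
  next
    fix \<delta>' assume "\<delta>' \<in> f ` chain \<Gamma> \<gamma>"
    then obtain \<delta> where \<delta>: "\<delta> \<in> chain \<Gamma> \<gamma>" "\<delta>' = f \<delta>" by blast
    then have "\<delta> \<in> \<Gamma> - {0}" by (simp add: chain_def)
    moreover have "\<forall>z. beyond \<gamma> z \<longrightarrow> beyond \<delta> z" using \<delta>(1) unfolding chain_def by blast
    ultimately show "\<delta>' \<in> chain \<Gamma>' (f \<gamma>)"
      unfolding chain_def \<delta>(2) using f_in[of \<delta>] f_subset[OF \<gamma>, of \<delta>] by simp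
  qed
  moreover have "inj_on f (chain \<Gamma> \<gamma>)"
    using f_bij0 by (auto simp: bij_betw_def chain_def intro: inj_on_subset)
  ultimately show ?thesis by (simp add: card_image)
qed

lemma scaleR_nat_in: "\<gamma> \<in> \<Gamma> - {0} \<Longrightarrow> real (Suc n) *\<^sub>R \<gamma> \<in> \<Gamma> - {0}"
  using discrete_subgroup_scaleR_nat[OF \<Gamma>, of \<gamma> "Suc n"] by auto

text \<open>The image of a multiple of \<open>\<gamma>\<close> lies on the ray of \<open>f \<gamma>\<close>
  by inclusion of half-spaces, and counting lattice points on that ray identifies it.\<close>

lemma f_scaleR_nat:
  assumes \<gamma>: "\<gamma> \<in> \<Gamma> - {0}"
  shows "f (real (Suc n) *\<^sub>R \<gamma>) = real (Suc n) *\<^sub>R f \<gamma>"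
proof -
  define N where "N = real (Suc n)"
  have N: "N > 0" "N \<ge> 1" by (simp_all add: N_def)
  have N\<gamma>: "N *\<^sub>R \<gamma> \<in> \<Gamma> - {0}" unfolding N_def by (rule scaleR_nat_in[OF \<gamma>])
  have f\<gamma>: "f \<gamma> \<in> \<Gamma>' - {0}" by (rule f_in[OF \<gamma>])
  have "\<gamma> = (1 / N) *\<^sub>R N *\<^sub>R \<gamma>" using N by simp
  then have "\<exists>s. 0 < s \<and> s \<le> 1 \<and> \<gamma> = s *\<^sub>R N *\<^sub>R \<gamma>" using N by (intro exI[of _ "1 / N"]) simp
  then have "\<forall>z. beyond (N *\<^sub>R \<gamma>) z \<longrightarrow> beyond \<gamma> z" using beyond_subset_iff[of "N *\<^sub>R \<gamma>" \<gamma>] N\<gamma> by simp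
  then have "\<forall>z. beyond (f (N *\<^sub>R \<gamma>)) z \<longrightarrow> beyond (f \<gamma>) z" using f_subset[OF N\<gamma> \<gamma>] by blast
  then obtain s where s: "0 < s" "s \<le> 1" "f \<gamma> = s *\<^sub>R f (N *\<^sub>R \<gamma>)"
    using beyond_subset_iff[of "f (N *\<^sub>R \<gamma>)" "f \<gamma>"] f_in[OF N\<gamma>] by blast
  have 1: "f (N *\<^sub>R \<gamma>) = (1 / (s * N)) *\<^sub>R (N *\<^sub>R f \<gamma>)" using s N by simp
  have 2: "1 / (s * N) > 0" using s N by simp
  have 3: "N *\<^sub>R f \<gamma> \<in> \<Gamma>' - {0}"
    using discrete_subgroup_scaleR_nat[OF \<Gamma>', of "f \<gamma>" "Suc n"] f\<gamma> N unfolding N_def by auto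
  have "card (chain \<Gamma>' (N *\<^sub>R f \<gamma>)) = card (chain \<Gamma>' (f (N *\<^sub>R \<gamma>)))"
    unfolding card_chain_f[OF N\<gamma>] unfolding N_def card_chain_nat[OF \<Gamma> \<gamma>] card_chain_nat[OF \<Gamma>' f\<gamma>]
      card_chain_f[OF \<gamma>] ..
  then show ?thesis
    using card_chain_inject[OF \<Gamma>' 3 f_in[OF N\<gamma>] 1 2] by (simp only: N_def)
qed

text \<open>Disjoint half-spaces that avoid \<open>0\<close> have opposite normals; counting lattice points again
  fixes the length.\<close>

lemma f_minus:
  assumes "\<gamma> \<in> \<Gamma>"
  shows "f (- \<gamma>) = - f \<gamma>"
proof (cases "\<gamma> = 0")
  case False
  then have \<gamma>: "\<gamma> \<in> \<Gamma> - {0}" using assms by simp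
  have m: "- \<gamma> \<in> \<Gamma> - {0}" using \<gamma> discrete_subgroup_minus[OF \<Gamma>] by auto
  have f\<gamma>: "f \<gamma> \<in> \<Gamma>' - {0}" "- f \<gamma> \<in> \<Gamma>' - {0}"
    using f_in[OF \<gamma>] discrete_subgroup_minus[OF \<Gamma>'] by auto
  have "\<not> (beyond \<gamma> z \<and> beyond (- \<gamma>) z)" for z
    using inner_ge_zero[of \<gamma>] unfolding beyond_def inner_minus_left inner_minus_right minus_minus by linarith
  then have "\<forall>z. \<not> (beyond (f \<gamma>) (h z) \<and> beyond (f (- \<gamma>)) (h z))"
    unfolding f_beyond[OF \<gamma>] f_beyond[OF m] by blast
  then have "\<And>z. \<not> (beyond (f \<gamma>) z \<and> beyond (f (- \<gamma>)) z)"
    using all_h[of "\<lambda>z. \<not> (beyond (f \<gamma>) z \<and> beyond (f (- \<gamma>)) z)"] by blast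
  then obtain s where s: "s < 0" "f (- \<gamma>) = s *\<^sub>R f \<gamma>"
    using beyond_disjoint_imp[of "f \<gamma>" "f (- \<gamma>)"] f\<gamma> f_in[OF m] by blast
  have "card (chain \<Gamma>' (- f \<gamma>)) = card (chain \<Gamma>' (f (- \<gamma>)))"
    using card_chain_minus[OF \<Gamma>', of "f \<gamma>"] card_chain_minus[OF \<Gamma>, of \<gamma>]
      card_chain_f[OF \<gamma>] card_chain_f[OF m] f\<gamma> \<gamma> by simp
  moreover have "f (- \<gamma>) = (- s) *\<^sub>R (- f \<gamma>)" "- s > 0" using s by simp_all
  ultimately show ?thesis
    using card_chain_inject[OF \<Gamma>' f\<gamma>(2) f_in[OF m]] by metis
qed (use f0 in simp)

text \<open>The two quotients lie beyond the same integers of absolute value at least \<open>1\<close>,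
  because \<open>f\<close> commutes with integer multiples. So they have the same integer part,
  up to the ambiguity between \<open>-1\<close> and \<open>1\<close>.\<close>

lemma close_multiples:
  assumes \<gamma>: "\<gamma> \<in> \<Gamma> - {0}"
  shows "\<bar>2 * (v \<bullet> \<gamma>) / (\<gamma> \<bullet> \<gamma>) - 2 * (h v \<bullet> f \<gamma>) / (f \<gamma> \<bullet> f \<gamma>)\<bar> \<le> 2" (is "\<bar>?X - ?Y\<bar> \<le> 2")
proof -
  have m: "- \<gamma> \<in> \<Gamma> - {0}" using \<gamma> discrete_subgroup_minus[OF \<Gamma>] by auto
  have gt: "2 * (v \<bullet> \<gamma>) / (\<gamma> \<bullet> \<gamma>) > real (Suc n) \<longleftrightarrow> 2 * (h v \<bullet> f \<gamma>) / (f \<gamma> \<bullet> f \<gamma>) > real (Suc n)"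
    if \<gamma>: "\<gamma> \<in> \<Gamma> - {0}" for n \<gamma>
  proof -
    have pos: "real (Suc n) > 0" and nz: "\<gamma> \<noteq> 0" "f \<gamma> \<noteq> 0" using \<gamma> f_in[OF \<gamma>] by simp_all
    show ?thesis
      using f_beyond[OF scaleR_nat_in[OF \<gamma>], of n v]
      unfolding f_scaleR_nat[OF \<gamma>] beyond_scaleR[OF pos nz(1)] beyond_scaleR[OF pos nz(2)] by (rule sym)
  qed
  have gt1: "?X > real (Suc n) \<longleftrightarrow> ?Y > real (Suc n)" for n
    by (rule gt[OF \<gamma>])
  have gt2: "- ?X > real (Suc n) \<longleftrightarrow> - ?Y > real (Suc n)" for n
    using gt[OF m, of n] \<gamma> by (simp add: f_minus)
  have near: "\<bar>x - y\<bar> \<le> 1" if "x > 1" "\<And>n. x > real (Suc n) \<longleftrightarrow> y > real (Suc n)" for x y :: real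
  proof -
    \<comment> \<open>This makes \<open>Suc n\<close> the largest integer below \<open>x\<close>.\<close>
    define n where "n = nat (\<lceil>x\<rceil> - 2)"
    have "\<lceil>x\<rceil> \<ge> 2" using that(1) by linarith
    then have "real (Suc n) = of_int \<lceil>x\<rceil> - 1" by (simp add: n_def)
    then have "real (Suc n) < x" "x \<le> real (Suc (Suc n))" by linarith+
    moreover from this have "real (Suc n) < y" "y \<le> real (Suc (Suc n))"
      using that(2)[of n] that(2)[of "Suc n"] by auto
    ultimately show ?thesis by simp
  qed
  consider "?X > 1" | "- ?X > 1" | "?X \<le> 1" "- ?X \<le> 1" by linarith
  then show ?thesis
  proof cases
    case 1
    then show ?thesis using near[OF 1 gt1] by linarith
  next
    case 2
    then show ?thesis using near[OF 2 gt2] by linarith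
  next
    case 3
    moreover have "?Y \<le> 1" "- ?Y \<le> 1" using 3 gt1[of 0] gt2[of 0] by simp_all
    ultimately show ?thesis by linarith
  qed
qed

text \<open>The rescaled image of \<open>\<gamma>\<close> for which the bisector of \<open>f
  \<gamma>\<close> has the equation \<open>2 * (w \<bullet> G \<gamma>) = \<gamma> \<bullet>
  \<gamma>\<close>, with the same right-hand side as the bisector of \<open>\<gamma>\<close>.\<close>

definition G :: "'e \<Rightarrow> 'e" where "G \<gamma> = ((\<gamma> \<bullet> \<gamma>) / (f \<gamma> \<bullet> f \<gamma>)) *\<^sub>R f \<gamma>"

text \<open>The functionals \<open>\<gamma>\<close> and \<open>G \<gamma>\<close> agree along
  \<open>h\<close> up to a bounded error. This is how a mere homeomorphism yields linear
  information.\<close>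

lemma G_close:
  assumes "\<gamma> \<in> \<Gamma>"
  shows "\<bar>v \<bullet> \<gamma> - h v \<bullet> G \<gamma>\<bar> \<le> \<gamma> \<bullet> \<gamma>"
proof (cases "\<gamma> = 0")
  case False
  then have \<gamma>: "\<gamma> \<in> \<Gamma> - {0}" using assms by simp
  define g where "g = \<gamma> \<bullet> \<gamma>"
  have g: "g > 0" using \<gamma> by (simp add: g_def)
  define X Y where "X = 2 * (v \<bullet> \<gamma>) / g" and "Y = 2 * (h v \<bullet> f \<gamma>) / (f \<gamma> \<bullet> f \<gamma>)"
  have XY: "\<bar>X - Y\<bar> \<le> 2" unfolding X_def Y_def g_def by (rule close_multiples[OF \<gamma>])
  have "v \<bullet> \<gamma> - h v \<bullet> G \<gamma> = g / 2 * (X - Y)"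
    using g by (simp add: X_def Y_def G_def g_def[symmetric] right_diff_distrib)
  then have "\<bar>v \<bullet> \<gamma> - h v \<bullet> G \<gamma>\<bar> = g / 2 * \<bar>X - Y\<bar>" using g by (simp only: abs_mult abs_of_pos half_gt_zero_iff)
  also have "\<dots> \<le> g / 2 * 2" using g XY by (intro mult_left_mono) auto
  finally show ?thesis by (simp add: g_def[symmetric])
qed (simp add: G_def)

end

lemma bounded_functional_zero:
  fixes u :: "'e::real_inner"
  assumes "\<And>w. \<bar>w \<bullet> u\<bar> \<le> B"
  shows "u = 0"
proof (rule ccontr)
  assume "u \<noteq> 0"
  then have "u \<bullet> u > 0" by simp
  then show False using assms[of "((B + 1) / (u \<bullet> u)) *\<^sub>R u"] by simp
qed

context arrangement_bijection
begin

text \<open>A linear relation among lattice vectors makes the same combination of the functionals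
  \<open>G\<close> bounded on the whole space, hence zero, and conversely.\<close>

lemma G_relation:
  assumes "\<alpha> \<in> \<Gamma>" "\<beta> \<in> \<Gamma>" "\<gamma> \<in> \<Gamma>"
  shows "a *\<^sub>R G \<alpha> + b *\<^sub>R G \<beta> + c *\<^sub>R G \<gamma> = 0 \<longleftrightarrow> a *\<^sub>R \<alpha> + b *\<^sub>R \<beta> + c *\<^sub>R \<gamma> = 0"
proof -
  define u u' where "u = a *\<^sub>R \<alpha> + b *\<^sub>R \<beta> + c *\<^sub>R \<gamma>" and "u' = a *\<^sub>R G \<alpha> + b *\<^sub>R G \<beta> + c *\<^sub>R G \<gamma>"
  define B where "B = \<bar>a\<bar> * (\<alpha> \<bullet> \<alpha>) + \<bar>b\<bar> * (\<beta> \<bullet> \<beta>) + \<bar>c\<bar> * (\<gamma> \<bullet> \<gamma>)"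
  have close: "\<bar>v \<bullet> u - h v \<bullet> u'\<bar> \<le> B" for v
  proof -
    have "v \<bullet> u - h v \<bullet> u' = a * (v \<bullet> \<alpha> - h v \<bullet> G \<alpha>) + b * (v \<bullet> \<beta> - h v \<bullet> G \<beta>) + c * (v \<bullet> \<gamma> - h v \<bullet> G \<gamma>)"
      by (simp add: u_def u'_def inner_add_right algebra_simps)
    also have "\<bar>\<dots>\<bar> \<le> \<bar>a * (v \<bullet> \<alpha> - h v \<bullet> G \<alpha>)\<bar> + \<bar>b * (v \<bullet> \<beta> - h v \<bullet> G \<beta>)\<bar> + \<bar>c * (v \<bullet> \<gamma> - h v \<bullet> G \<gamma>)\<bar>"
      by linarith
    also have "\<dots> \<le> B"
      unfolding B_def abs_mult using assms by (intro add_mono mult_left_mono G_close) auto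
    finally show ?thesis .
  qed
  show ?thesis
  proof
    assume "a *\<^sub>R G \<alpha> + b *\<^sub>R G \<beta> + c *\<^sub>R G \<gamma> = 0"
    then have "u' = 0" by (simp add: u'_def)
    then have "\<bar>v \<bullet> u\<bar> \<le> B" for v using close[of v] by simp
    then show "a *\<^sub>R \<alpha> + b *\<^sub>R \<beta> + c *\<^sub>R \<gamma> = 0"
      unfolding u_def[symmetric] by (rule bounded_functional_zero)
  next
    assume "a *\<^sub>R \<alpha> + b *\<^sub>R \<beta> + c *\<^sub>R \<gamma> = 0"
    then have "u = 0" by (simp add: u_def)
    then have "\<bar>w \<bullet> u'\<bar> \<le> B" for w using close[of "k w"] by simp
    then show "a *\<^sub>R G \<alpha> + b *\<^sub>R G \<beta> + c *\<^sub>R G \<gamma> = 0"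
      unfolding u'_def[symmetric] by (rule bounded_functional_zero)
  qed
qed

lemma G_add:
  assumes "\<alpha> \<in> \<Gamma>" "\<beta> \<in> \<Gamma>"
  shows "G (\<alpha> + \<beta>) = G \<alpha> + G \<beta>"
proof -
  have "1 *\<^sub>R G \<alpha> + 1 *\<^sub>R G \<beta> + (-1) *\<^sub>R G (\<alpha> + \<beta>) = 0"
    using G_relation[OF assms discrete_subgroup_add[OF \<Gamma> assms], of 1 1 "-1"] by simp
  then show ?thesis by (simp add: algebra_simps)
qed

lemma G_scaleR_nat:
  assumes "\<alpha> \<in> \<Gamma>"
  shows "G (real m *\<^sub>R \<alpha>) = real m *\<^sub>R G \<alpha>"
proof -
  have "real m *\<^sub>R G \<alpha> + (-1) *\<^sub>R G (real m *\<^sub>R \<alpha>) + 0 *\<^sub>R G \<alpha> = 0"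
    using G_relation[OF assms discrete_subgroup_scaleR_nat[OF \<Gamma> assms, of m] assms, of "real m" "-1" 0] by simp
  then show ?thesis by simp
qed

text \<open>The factor with \<open>f \<gamma> = q \<gamma> *\<^sub>R G \<gamma>\<close> for nonzero lattice vectors \<open>\<gamma>\<close>.\<close>

definition q :: "'e \<Rightarrow> real" where "q \<gamma> = (\<gamma> \<bullet> \<gamma>) / (G \<gamma> \<bullet> G \<gamma>)"

lemma
  assumes "\<gamma> \<in> \<Gamma> - {0}"
  shows G_nonzero: "G \<gamma> \<noteq> 0" and q_pos: "q \<gamma> > 0" and f_eq: "f \<gamma> = q \<gamma> *\<^sub>R G \<gamma>"
proof -
  have g: "\<gamma> \<bullet> \<gamma> > 0" "f \<gamma> \<bullet> f \<gamma> > 0" using assms f_in[OF assms] by auto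
  then show nz: "G \<gamma> \<noteq> 0" by (auto simp: G_def)
  then show "q \<gamma> > 0" using g by (simp add: q_def)
  show "f \<gamma> = q \<gamma> *\<^sub>R G \<gamma>" using g by (simp add: q_def G_def)
qed


text \<open>For independent \<open>\<gamma>\<close> and \<open>\<delta>\<close>, the lattice points \<open>f
  (\<gamma> + m \<delta>) - m f \<delta>\<close> stay bounded as \<open>m\<close> grows, because
  \<open>q (\<gamma> + m \<delta>)\<close> tends to \<open>q \<delta>\<close> at the rate
  \<open>1 / m\<close>. By discreteness two of them are equal, for indices \<open>i\<close> and
  \<open>j\<close> say. Comparing coefficients gives \<open>q (\<gamma> + i \<delta>) = q
  (\<gamma> + j \<delta>) = q \<delta>\<close>, two instances of an equation that is linear in
  the index and whose constant term says \<open>q \<gamma> = q \<delta>\<close>.\<close>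

lemma q_constant:
  assumes \<gamma>: "\<gamma> \<in> \<Gamma> - {0}" and \<delta>: "\<delta> \<in> \<Gamma> - {0}"
  shows "q \<gamma> = q \<delta>"
proof (cases "\<exists>r. \<gamma> = r *\<^sub>R \<delta>")
  case True
  then obtain r where r: "\<gamma> = r *\<^sub>R \<delta>" by blast
  have "1 *\<^sub>R G \<gamma> + (- r) *\<^sub>R G \<delta> + 0 *\<^sub>R G \<delta> = 0"
    using G_relation[of \<gamma> \<delta> \<delta> 1 "- r" 0] \<gamma> \<delta> r by simp
  then have "G \<gamma> = r *\<^sub>R G \<delta>" by simp
  moreover have "r \<noteq> 0" using r \<gamma> by auto
  ultimately show ?thesis unfolding q_def r by simp
next
  case False
  have indep: "G \<gamma> \<noteq> r *\<^sub>R G \<delta>" for r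
  proof
    assume "G \<gamma> = r *\<^sub>R G \<delta>"
    then have "1 *\<^sub>R \<gamma> + (- r) *\<^sub>R \<delta> + 0 *\<^sub>R \<delta> = 0"
      using G_relation[of \<gamma> \<delta> \<delta> 1 "- r" 0] \<gamma> \<delta> by simp
    then have "\<gamma> = r *\<^sub>R \<delta>" by simp
    then show False using False by blast
  qed
  define a where "a m = \<gamma> + real m *\<^sub>R \<delta>" for m :: nat
  have a: "a m \<in> \<Gamma> - {0}" for m
  proof -
    have "a m \<noteq> 0"
    proof
      assume "a m = 0"
      then have "\<gamma> = (- real m) *\<^sub>R \<delta>" by (simp add: a_def eq_neg_iff_add_eq_0)
      then show False using False by blast
    qed
    then show ?thesis
      using \<gamma> \<delta> discrete_subgroup_add[OF \<Gamma>] discrete_subgroup_scaleR_nat[OF \<Gamma>] by (simp add: a_def)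
  qed
  have Ga: "G (a m) = G \<gamma> + real m *\<^sub>R G \<delta>" for m
    unfolding a_def using \<gamma> \<delta> G_add[OF _ discrete_subgroup_scaleR_nat[OF \<Gamma>]] G_scaleR_nat by simp
  define n0 n1 n2 d0 d1 d2 where
    n: "n0 = \<gamma> \<bullet> \<gamma>" "n1 = \<gamma> \<bullet> \<delta>" "n2 = \<delta> \<bullet> \<delta>" and
    d: "d0 = G \<gamma> \<bullet> G \<gamma>" "d1 = G \<gamma> \<bullet> G \<delta>" "d2 = G \<delta> \<bullet> G \<delta>"
  have d_pos: "d0 > 0" "d2 > 0" using G_nonzero[OF \<gamma>] G_nonzero[OF \<delta>] by (simp_all add: d)
  have q\<delta>: "q \<delta> = n2 / d2" by (simp add: q_def n d)
  define D where "D m = d0 + 2 * real m * d1 + real m * real m * d2" for m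
  have aa: "a m \<bullet> a m = n0 + 2 * real m * n1 + real m * real m * n2" for m
    by (simp add: a_def n inner_add_left inner_add_right inner_commute[of \<delta> \<gamma>] algebra_simps)
  have GG: "G (a m) \<bullet> G (a m) = D m" for m
    by (simp add: D_def Ga d inner_add_left inner_add_right inner_commute[of "G \<delta>" "G \<gamma>"] algebra_simps)
  have D_pos: "D m > 0" for m using G_nonzero[OF a] GG[of m] by (metis inner_gt_zero_iff)
  have qa: "q (a m) = (n0 + 2 * real m * n1 + real m * real m * n2) / D m" for m
    unfolding q_def aa GG ..
  define c where "c m = real m * (q (a m) - q \<delta>)" for m
  define x where "x m = f (a m) - real m *\<^sub>R f \<delta>" for m
  have x_eq: "x m = q (a m) *\<^sub>R G \<gamma> + c m *\<^sub>R G \<delta>" for m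
    unfolding x_def f_eq[OF a] f_eq[OF \<delta>] Ga by (simp add: c_def algebra_simps)
  have x_in: "x m \<in> \<Gamma>'" for m
    unfolding x_def
    using f_in[OF a] f_in[OF \<delta>] by (intro discrete_subgroup_diff[OF \<Gamma>'] discrete_subgroup_scaleR_nat[OF \<Gamma>']) auto
  have "(\<lambda>m. q (a m)) \<longlonglongrightarrow> n2 * inverse d2"
    unfolding qa D_def using d_pos by real_asymp
  then obtain K1 where K1: "\<And>m. norm (q (a m)) \<le> K1"
    by (meson BseqE convergentI convergent_imp_Bseq)
  define A B where "A = n0 - q \<delta> * d0" and "B = n1 - q \<delta> * d1"
  have n2: "n2 = q \<delta> * d2" using d_pos q\<delta> by simp
  have "q (a m) - q \<delta> = (A + 2 * real m * B) / D m" for m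
  proof -
    have "q (a m) - q \<delta> = (n0 + 2 * real m * n1 + real m * real m * n2 - q \<delta> * D m) / D m"
      using D_pos[of m] by (simp add: qa diff_divide_distrib)
    also have "n0 + 2 * real m * n1 + real m * real m * n2 - q \<delta> * D m = A + 2 * real m * B"
      by (simp add: D_def A_def B_def n2 algebra_simps)
    finally show ?thesis .
  qed
  then have c_eq: "c m = A * (real m / D m) + B * (2 * real m * real m / D m)" for m
    by (simp add: c_def add_divide_distrib algebra_simps)
  have "(\<lambda>m. real m / D m) \<longlonglongrightarrow> 0" "(\<lambda>m. 2 * real m * real m / D m) \<longlonglongrightarrow> 2 * inverse d2"
    unfolding D_def using d_pos by real_asymp+
  then have "c \<longlonglongrightarrow> A * 0 + B * (2 * inverse d2)"
    unfolding c_eq by (intro tendsto_intros)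
  then obtain K2 where K2: "\<And>m. norm (c m) \<le> K2"
    by (meson BseqE convergentI convergent_imp_Bseq)
  have "norm (x m) \<le> K1 * norm (G \<gamma>) + K2 * norm (G \<delta>)" for m
    unfolding x_eq using K1[of m] K2[of m]
    by (intro norm_triangle_le add_mono) (auto intro: mult_right_mono)
  then have "range x \<subseteq> {v\<in>\<Gamma>'. norm v \<le> K1 * norm (G \<gamma>) + K2 * norm (G \<delta>)}"
    using x_in by blast
  then have "finite (range x)" using discrete_subgroup_finite[OF \<Gamma>'] finite_subset by blast
  then have "\<not> inj x" using finite_imageD[of x UNIV] by auto
  then obtain i j where ij: "x i = x j" "i \<noteq> j" by (auto simp: inj_def)
  have qq: "q (a i) = q (a j)"
  proof (rule ccontr)
    assume ne: "q (a i) \<noteq> q (a j)"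
    have "(q (a i) - q (a j)) *\<^sub>R G \<gamma> = (c j - c i) *\<^sub>R G \<delta>"
      using ij(1) unfolding x_eq by (simp add: algebra_simps)
    then have "(1 / (q (a i) - q (a j))) *\<^sub>R ((q (a i) - q (a j)) *\<^sub>R G \<gamma>)
        = (1 / (q (a i) - q (a j))) *\<^sub>R ((c j - c i) *\<^sub>R G \<delta>)" by (simp only:)
    then have "G \<gamma> = ((c j - c i) / (q (a i) - q (a j))) *\<^sub>R G \<delta>" using ne by simp
    then show False using indep by blast
  qed
  then have "c i = c j" using ij(1) G_nonzero[OF \<delta>] unfolding x_eq by simp
  then have "(real i - real j) * (q (a i) - q \<delta>) = 0" by (simp add: c_def qq algebra_simps)
  then have qi: "q (a i) = q \<delta>" "q (a j) = q \<delta>" using ij(2) qq by simp_all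
  have lin: "A + real m * (2 * B) = 0" if "q (a m) = q \<delta>" for m
  proof -
    have "n0 + 2 * real m * n1 + real m * real m * n2 = q \<delta> * D m"
      using that D_pos[of m] unfolding qa by (simp add: field_simps)
    then show ?thesis by (simp add: D_def n2 A_def B_def algebra_simps)
  qed
  have "(real i - real j) * (2 * B) = (A + real i * (2 * B)) - (A + real j * (2 * B))"
    by (simp add: left_diff_distrib)
  then have "B = 0" using ij(2) unfolding lin[OF qi(1)] lin[OF qi(2)] by simp
  then have "n0 = q \<delta> * d0" using lin[OF qi(1)] by (simp add: A_def)
  then show ?thesis using d_pos by (simp add: q_def[of \<gamma>] n(1)[symmetric] d(1)[symmetric])
qed

text \<open>With \<open>q\<close> constant, \<open>f\<close> is a multiple of the additive map
  \<open>G\<close>.\<close>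

theorem similarity:
  "\<exists>Q>0. \<forall>x\<in>\<Gamma>. f x \<bullet> f x = Q * (x \<bullet> x) \<and> (\<forall>y\<in>\<Gamma>. f (x + y) = f x + f y)"
proof (cases "\<Gamma> = {0}")
  case True
  then show ?thesis by (intro exI[of _ 1]) (simp add: f0)
next
  case False
  then obtain \<delta> where \<delta>: "\<delta> \<in> \<Gamma> - {0}" using discrete_subgroup_zero[OF \<Gamma>] by blast
  have f: "f x = q \<delta> *\<^sub>R G x" if "x \<in> \<Gamma>" for x
    using that f_eq[of x] q_constant[OF _ \<delta>, of x] by (cases "x = 0") (auto simp: G_def f0)
  show ?thesis
  proof (intro exI[of _ "q \<delta>"] conjI ballI)
    fix x assume x: "x \<in> \<Gamma>"
    show "f x \<bullet> f x = q \<delta> * (x \<bullet> x)"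
    proof (cases "x = 0")
      case False
      then have "x \<in> \<Gamma> - {0}" using x by simp
      then have "x \<bullet> x = q \<delta> * (G x \<bullet> G x)"
        using q_constant[OF _ \<delta>, of x] G_nonzero[of x] by (simp add: q_def[of x] field_simps)
      then show ?thesis using f[OF x] by simp
    qed (simp add: f0)
    fix y assume y: "y \<in> \<Gamma>"
    show "f (x + y) = f x + f y"
      using f x y discrete_subgroup_add[OF \<Gamma> x y] G_add[OF x y] by (simp add: scaleR_add_right)
  qed (rule q_pos[OF \<delta>])
qed

end

theorem (in arrangement_homeo) lattices_similar:
  "\<exists>f Q. Q > 0 \<and> bij_betw f \<Gamma> \<Gamma>' \<and>
     (\<forall>x\<in>\<Gamma>. f x \<bullet> f x = Q * (x \<bullet> x) \<and> (\<forall>y\<in>\<Gamma>. f (x + y) = f x + f y))"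
proof -
  have "\<forall>\<gamma>\<in>\<Gamma>-{0}. \<exists>\<gamma>'\<in>\<Gamma>'-{0}. \<forall>z. beyond \<gamma>' (h z) \<longleftrightarrow> beyond \<gamma> z"
    using half_space_image by (rule ballI)
  then obtain f where f: "\<forall>\<gamma>\<in>\<Gamma>-{0}. f \<gamma> \<in> \<Gamma>' - {0} \<and> (\<forall>z. beyond (f \<gamma>) (h z) \<longleftrightarrow> beyond \<gamma> z)"
    unfolding bchoice_iff[of "\<Gamma> - {0}"] Bex_def by (elim exE) metis
  interpret arrangement_bijection \<Gamma> \<Gamma>' h k "f(0 := 0)"
  proof
    fix \<gamma> z assume \<gamma>: "\<gamma> \<in> \<Gamma> - {0}"
    show "(f(0 := 0)) \<gamma> \<in> \<Gamma>' - {0}" using f[rule_format, OF \<gamma>] \<gamma> by simp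
    show "beyond ((f(0 := 0)) \<gamma>) (h z) \<longleftrightarrow> beyond \<gamma> z" using f[rule_format, OF \<gamma>] \<gamma> by simp
  qed simp
  show ?thesis using similarity f_bij by blast
qed

section \<open>Calculus of differentiability classes\<close>

text \<open>On an open set the derivatives depend only on the values in that set. This lets the derivative
  be replaced by its formula in the inductions below.\<close>

lemma Ck_on_cong:
  assumes "open S" "\<And>x. x \<in> S \<Longrightarrow> f x = g x"
  shows "Ck_on k f S \<longleftrightarrow> Ck_on k g S"
  using assms(2)
proof (induction k arbitrary: f g)
  case 0
  then show ?case by (simp cong: continuous_on_cong)
next
  case (Suc k)
  have ev: "eventually (\<lambda>y. f y = g y) (nhds x)" if "x \<in> S" for x
    using that assms(1) Suc.prems eventually_nhds by blast
  have 1: "(f has_derivative D) (at x) \<longleftrightarrow> (g has_derivative D) (at x)" if "x \<in> S" for x D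
    using has_derivative_transform_within_open[OF _ assms(1) that, of f D UNIV g]
      has_derivative_transform_within_open[OF _ assms(1) that, of g D UNIV f] Suc.prems by auto
  have 2: "frechet_derivative f (at x) = frechet_derivative g (at x)" if "x \<in> S" for x
    unfolding frechet_derivative_def 1[OF that] ..
  have 3: "f differentiable at x \<longleftrightarrow> g differentiable at x" if "x \<in> S" for x
    unfolding differentiable_def 1[OF that] ..
  have "Ck_on k (\<lambda>x. frechet_derivative f (at x) v) S \<longleftrightarrow> Ck_on k (\<lambda>x. frechet_derivative g (at x) v) S" for v
    by (rule Suc.IH) (simp add: 2)
  then show ?case using 3 by simp
qed

lemma Ck_on_subset: "Ck_on k f S \<Longrightarrow> T \<subseteq> S \<Longrightarrow> Ck_on k f T"
  by (induction k arbitrary: f) (auto intro: continuous_on_subset)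

lemma Ck_on_local:
  assumes "\<And>x. x \<in> S \<Longrightarrow> \<exists>T. open T \<and> x \<in> T \<and> Ck_on k f T"
  shows "Ck_on k f S"
  using assms
proof (induction k arbitrary: f)
  case 0
  have "isCont f x" if "x \<in> S" for x
    using 0[OF that] by (auto simp: continuous_on_eq_continuous_at)
  then show ?case by (auto intro: continuous_at_imp_continuous_on)
next
  case (Suc k)
  have "f differentiable at x" if "x \<in> S" for x using Suc.prems[OF that] by auto
  moreover have "Ck_on k (\<lambda>x. frechet_derivative f (at x) v) S" for v
  proof (rule Suc.IH)
    fix x assume "x \<in> S"
    then show "\<exists>T. open T \<and> x \<in> T \<and> Ck_on k (\<lambda>x. frechet_derivative f (at x) v) T"
      using Suc.prems[of x] by auto
  qed
  ultimately show ?case by simp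
qed

lemma Ck_on_SucD: "Ck_on (Suc k) f S \<Longrightarrow> Ck_on k f S"
proof (induction k arbitrary: f)
  case 0
  then show ?case
    by (auto intro!: continuous_at_imp_continuous_on differentiable_imp_continuous_within)
qed auto

lemma Ck_on_const: "Ck_on k (\<lambda>x. c) S"
proof (induction k arbitrary: c)
  case (Suc k)
  have "frechet_derivative (\<lambda>x. c) (at x) = (\<lambda>_. 0)" for x
    by (rule frechet_derivative_at[symmetric]) simp
  then show ?case using Suc by simp
qed simp

lemma Ck_on_bounded_linear:
  assumes L: "bounded_linear L" and "open S"
  shows "Ck_on k f S \<Longrightarrow> Ck_on k (\<lambda>x. L (f x)) S"
proof (induction k arbitrary: f)
  case 0
  then show ?case using bounded_linear.continuous_on[OF L] by simp
next
  case (Suc k)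
  have d: "((\<lambda>x. L (f x)) has_derivative (\<lambda>v. L (frechet_derivative f (at x) v))) (at x)" if "x \<in> S" for x
    using Suc.prems that by (intro bounded_linear.has_derivative[OF L]) (auto simp: frechet_derivative_works)
  have "Ck_on k (\<lambda>x. frechet_derivative (\<lambda>x. L (f x)) (at x) v) S" for v
  proof (subst Ck_on_cong[OF \<open>open S\<close>])
    show "Ck_on k (\<lambda>x. L (frechet_derivative f (at x) v)) S" using Suc by simp
    show "frechet_derivative (\<lambda>x. L (f x)) (at x) v = L (frechet_derivative f (at x) v)" if "x \<in> S" for x
      using frechet_derivative_at[OF d[OF that]] by metis
  qed
  then show ?case using d by (auto simp: differentiable_def)
qed

lemma Ck_on_add:
  assumes "open S"
  shows "Ck_on k f S \<Longrightarrow> Ck_on k g S \<Longrightarrow> Ck_on k (\<lambda>x. f x + g x) S"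
proof (induction k arbitrary: f g)
  case 0
  then show ?case by (simp add: continuous_on_add)
next
  case (Suc k)
  have d: "((\<lambda>x. f x + g x) has_derivative (\<lambda>v. frechet_derivative f (at x) v + frechet_derivative g (at x) v)) (at x)"
    if "x \<in> S" for x
    using Suc.prems that by (intro has_derivative_add) (auto simp: frechet_derivative_works)
  have "Ck_on k (\<lambda>x. frechet_derivative (\<lambda>x. f x + g x) (at x) v) S" for v
  proof (subst Ck_on_cong[OF \<open>open S\<close>])
    show "Ck_on k (\<lambda>x. frechet_derivative f (at x) v + frechet_derivative g (at x) v) S" using Suc by simp
    show "frechet_derivative (\<lambda>x. f x + g x) (at x) v = frechet_derivative f (at x) v + frechet_derivative g (at x) v"
      if "x \<in> S" for x using frechet_derivative_at[OF d[OF that]] by metis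
  qed
  then show ?case using d by (auto simp: differentiable_def)
qed

lemma Ck_on_sum:
  assumes "open S" "\<And>i. i \<in> I \<Longrightarrow> Ck_on k (f i) S"
  shows "Ck_on k (\<lambda>x. \<Sum>i\<in>I. f i x) S"
  using assms(2)
  by (induction I rule: infinite_finite_induct) (auto simp: Ck_on_const intro!: Ck_on_add[OF assms(1)])

lemma Ck_on_scaleR:
  fixes f :: "'a::real_normed_vector \<Rightarrow> real"
  assumes "open S"
  shows "Ck_on k f S \<Longrightarrow> Ck_on k g S \<Longrightarrow> Ck_on k (\<lambda>x. f x *\<^sub>R g x) S"
proof (induction k arbitrary: f g)
  case 0
  then show ?case by (simp add: continuous_on_scaleR)
next
  case (Suc k)
  have d: "((\<lambda>x. f x *\<^sub>R g x) has_derivative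
      (\<lambda>v. f x *\<^sub>R frechet_derivative g (at x) v + frechet_derivative f (at x) v *\<^sub>R g x)) (at x)"
    if "x \<in> S" for x
    using Suc.prems that by (intro has_derivative_scaleR) (auto simp: frechet_derivative_works)
  have "Ck_on k (\<lambda>x. frechet_derivative (\<lambda>x. f x *\<^sub>R g x) (at x) v) S" for v
  proof (subst Ck_on_cong[OF \<open>open S\<close>])
    show "Ck_on k (\<lambda>x. f x *\<^sub>R frechet_derivative g (at x) v + frechet_derivative f (at x) v *\<^sub>R g x) S"
      using Suc Ck_on_SucD[OF Suc.prems(1)] Ck_on_SucD[OF Suc.prems(2)] by (intro Ck_on_add[OF assms]) auto
    show "frechet_derivative (\<lambda>x. f x *\<^sub>R g x) (at x) v
        = f x *\<^sub>R frechet_derivative g (at x) v + frechet_derivative f (at x) v *\<^sub>R g x"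
      if "x \<in> S" for x using frechet_derivative_at[OF d[OF that]] by metis
  qed
  then show ?case using d by (auto simp: differentiable_def)
qed

text \<open>By the chain rule a directional derivative of the composite is a sum, over a basis, of products
  of functions that are one class less smooth.\<close>

lemma Ck_on_compose:
  fixes f :: "'a::real_normed_vector \<Rightarrow> 'b::euclidean_space"
  assumes S: "open S" and T: "open T" and fS: "f ` S \<subseteq> T"
  shows "Ck_on k f S \<Longrightarrow> Ck_on k g T \<Longrightarrow> Ck_on k (\<lambda>x. g (f x)) S"
proof (induction k arbitrary: g)
  case 0
  then show ?case using fS by (auto intro: continuous_on_compose2)
next
  case (Suc k)
  have dg: "(g has_derivative frechet_derivative g (at (f x))) (at (f x))" if "x \<in> S" for x
    using Suc.prems that fS by (auto simp: frechet_derivative_works[symmetric])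
  have df: "(f has_derivative frechet_derivative f (at x)) (at x)" if "x \<in> S" for x
    using Suc.prems that by (auto simp: frechet_derivative_works[symmetric])
  have d: "((\<lambda>x. g (f x)) has_derivative (\<lambda>v. frechet_derivative g (at (f x)) (frechet_derivative f (at x) v))) (at x)"
    if "x \<in> S" for x
    using has_derivative_compose[OF df[OF that] dg[OF that]] .
  have f: "Ck_on k f S" using Ck_on_SucD Suc.prems by blast
  have "Ck_on k (\<lambda>x. frechet_derivative (\<lambda>x. g (f x)) (at x) v) S" for v
  proof (subst Ck_on_cong[OF S])
    show "Ck_on k (\<lambda>x. \<Sum>b\<in>Basis. (frechet_derivative f (at x) v \<bullet> b) *\<^sub>R frechet_derivative g (at (f x)) b) S"
    proof (intro Ck_on_sum[OF S] Ck_on_scaleR[OF S])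
      fix b :: 'b assume "b \<in> Basis"
      show "Ck_on k (\<lambda>x. frechet_derivative f (at x) v \<bullet> b) S"
        using Suc.prems by (intro Ck_on_bounded_linear[OF bounded_linear_inner_left S]) auto
      show "Ck_on k (\<lambda>x. frechet_derivative g (at (f x)) b) S"
        using Suc.prems by (intro Suc.IH[OF f]) auto
    qed
    show "frechet_derivative (\<lambda>x. g (f x)) (at x) v
        = (\<Sum>b\<in>Basis. (frechet_derivative f (at x) v \<bullet> b) *\<^sub>R frechet_derivative g (at (f x)) b)"
      if "x \<in> S" for x
    proof -
      interpret Dg: bounded_linear "frechet_derivative g (at (f x))"
        using dg[OF that] by (rule has_derivative_bounded_linear)
      let ?w = "frechet_derivative f (at x) v"
      have "frechet_derivative g (at (f x)) ?w
          = frechet_derivative g (at (f x)) (\<Sum>b\<in>Basis. (?w \<bullet> b) *\<^sub>R b)"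
        by (simp only: euclidean_representation)
      also have "\<dots> = (\<Sum>b\<in>Basis. (?w \<bullet> b) *\<^sub>R frechet_derivative g (at (f x)) b)"
        by (simp only: Dg.sum Dg.scaleR)
      finally show ?thesis
        using frechet_derivative_at[OF d[OF that]] by metis
    qed
  qed
  then show ?case using d by (auto simp: differentiable_def)
qed

lemma smooth_on_cong: "open S \<Longrightarrow> (\<And>x. x \<in> S \<Longrightarrow> f x = g x) \<Longrightarrow> smooth_on f S \<longleftrightarrow> smooth_on g S"
  unfolding smooth_on_def using Ck_on_cong by metis

lemma smooth_on_subset: "smooth_on f S \<Longrightarrow> T \<subseteq> S \<Longrightarrow> smooth_on f T"
  unfolding smooth_on_def using Ck_on_subset by blast

lemma smooth_on_local:
  assumes "\<And>x. x \<in> S \<Longrightarrow> \<exists>T. open T \<and> x \<in> T \<and> smooth_on f T"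
  shows "smooth_on f S"
  unfolding smooth_on_def
proof
  fix k
  show "Ck_on k f S"
  proof (rule Ck_on_local)
    fix x assume "x \<in> S"
    then obtain T where "open T" "x \<in> T" "smooth_on f T" using assms by blast
    then show "\<exists>T. open T \<and> x \<in> T \<and> Ck_on k f T" unfolding smooth_on_def by blast
  qed
qed

lemma smooth_on_compose:
  fixes f :: "'a::real_normed_vector \<Rightarrow> 'b::euclidean_space"
  assumes "open S" "open T" "f ` S \<subseteq> T" "smooth_on f S" "smooth_on g T"
  shows "smooth_on (\<lambda>x. g (f x)) S"
  using assms Ck_on_compose[OF assms(1-3)] unfolding smooth_on_def by blast

lemma smooth_on_differentiable: "smooth_on f S \<Longrightarrow> x \<in> S \<Longrightarrow> f differentiable at x"
  unfolding smooth_on_def using Ck_on.simps(2)[of 0 f S] by blast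

lemma smooth_on_has_derivative:
  "smooth_on f S \<Longrightarrow> x \<in> S \<Longrightarrow> (f has_derivative frechet_derivative f (at x)) (at x)"
  using smooth_on_differentiable frechet_derivative_works by blast

lemma smooth_on_derivative: "smooth_on f S \<Longrightarrow> smooth_on (\<lambda>x. frechet_derivative f (at x) v) S"
  unfolding smooth_on_def using Ck_on.simps(2) by blast

lemma smooth_on_continuous: "smooth_on f S \<Longrightarrow> continuous_on S f"
  unfolding smooth_on_def using Ck_on.simps(1) by blast

lemma smooth_on_affine:
  assumes "bounded_linear A"
  shows "smooth_on (\<lambda>x. A x + a) S"
proof -
  have "Ck_on k (\<lambda>x. A x + a) UNIV" for k
  proof (cases k)
    case 0
    then show ?thesis
      using continuous_on_add[OF bounded_linear.continuous_on[OF assms continuous_on_id] continuous_on_const]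
      by simp
  next
    case (Suc j)
    have d: "((\<lambda>x. A x + a) has_derivative A) (at x)" for x
      using has_derivative_add[OF bounded_linear_imp_has_derivative[OF assms] has_derivative_const] by simp
    then have "frechet_derivative (\<lambda>x. A x + a) (at x) = A" for x using frechet_derivative_at by metis
    then show ?thesis using d Suc by (auto simp: Ck_on_const differentiable_def)
  qed
  then show ?thesis using Ck_on_subset unfolding smooth_on_def by blast
qed

lemma smooth_on_vec:
  fixes f :: "'a::real_normed_vector \<Rightarrow> real^'n"
  assumes "open S" "\<And>i. smooth_on (\<lambda>x. f x $ i) S"
  shows "smooth_on f S"
proof -
  have f: "(\<lambda>x. \<Sum>i\<in>UNIV. (f x $ i) *\<^sub>R axis i 1) = f"
    by (simp add: fun_eq_iff vec_eq_iff axis_def if_distrib[of "\<lambda>c. _ * c"] cong: if_cong)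
  have "Ck_on k (\<lambda>x. \<Sum>i\<in>UNIV. (f x $ i) *\<^sub>R axis i (1::real)) S" for k
    using assms(2) unfolding smooth_on_def
    by (intro Ck_on_sum[OF assms(1)] Ck_on_scaleR[OF assms(1)] Ck_on_const) auto
  then show ?thesis unfolding smooth_on_def f by blast
qed

section \<open>Smooth maps and isometries\<close>

text \<open>The part of the manifold axioms that coordinate calculations need; it also holds for the
  quotient tori with their explicit atlas.\<close>

definition chart_regular :: "('a, 'n::finite) riemannian \<Rightarrow> bool" where
  "chart_regular M \<longleftrightarrow> (\<forall>\<kappa>\<in>charts M. inj_on (coord \<kappa>) (cdom \<kappa>) \<and> open (coord \<kappa> ` cdom \<kappa>))"

lemma chart_regular_inj: "chart_regular M \<Longrightarrow> \<kappa> \<in> charts M \<Longrightarrow> inj_on (coord \<kappa>) (cdom \<kappa>)"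
  by (simp add: chart_regular_def)

lemma in_points: "\<kappa> \<in> charts M \<Longrightarrow> p \<in> cdom \<kappa> \<Longrightarrow> p \<in> points M"
  unfolding points_def by blast

lemma points_chart: "p \<in> points M \<Longrightarrow> \<exists>\<kappa>\<in>charts M. p \<in> cdom \<kappa>"
  unfolding points_def by blast

lemma points_charts_at: "p \<in> points M \<Longrightarrow> \<exists>\<kappa>. \<kappa> \<in> charts_at M p"
  unfolding points_def charts_at_def by blast

lemma charts_atD: "\<kappa> \<in> charts_at M p \<Longrightarrow> \<kappa> \<in> charts M \<and> p \<in> cdom \<kappa>"
  unfolding charts_at_def by simp

lemma rep_coord:
  "chart_regular M \<Longrightarrow> \<kappa> \<in> charts M \<Longrightarrow> p \<in> cdom \<kappa> \<Longrightarrow> rep \<kappa> f \<kappa>' (coord \<kappa> p) = coord \<kappa>' (f p)"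
  unfolding rep_def using chart_regular_inj by (metis inv_into_f_f)

lemma in_rep_dom_iff:
  assumes "chart_regular M" "\<kappa> \<in> charts M" "p \<in> cdom \<kappa>"
  shows "coord \<kappa> p \<in> rep_dom \<kappa> f \<kappa>' \<longleftrightarrow> f p \<in> cdom \<kappa>'"
  using chart_regular_inj[OF assms(1,2)] assms(3) unfolding rep_dom_def by (auto dest: inj_onD)

lemma rep_dom_cong:
  assumes "\<kappa> \<in> charts M" "\<And>p. p \<in> points M \<Longrightarrow> f p = g p"
  shows "rep_dom \<kappa> f \<kappa>' = rep_dom \<kappa> g \<kappa>'"
  unfolding rep_dom_def using assms(2)[OF in_points[OF assms(1)]] by auto

lemma rep_cong:
  assumes "chart_regular M" "\<kappa> \<in> charts M" "\<And>p. p \<in> points M \<Longrightarrow> f p = g p" "x \<in> coord \<kappa> ` cdom \<kappa>"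
  shows "rep \<kappa> f \<kappa>' x = rep \<kappa> g \<kappa>' x"
proof -
  obtain p where p: "p \<in> cdom \<kappa>" "x = coord \<kappa> p" using assms(4) by blast
  show ?thesis
    unfolding p(2) rep_coord[OF assms(1,2) p(1)] assms(3)[OF in_points[OF assms(2) p(1)]] ..
qed

lemma smooth_map_cong:
  assumes M: "chart_regular M" and "\<And>p. p \<in> points M \<Longrightarrow> f p = g p" and f: "smooth_map M N f"
  shows "smooth_map M N g"
  unfolding smooth_map_def
proof (intro conjI ballI)
  show "g ` points M \<subseteq> points N" using f assms(2) unfolding smooth_map_def by auto
  fix \<kappa> \<kappa>' assume \<kappa>: "\<kappa> \<in> charts M" "\<kappa>' \<in> charts N"
  have eq: "rep_dom \<kappa> g \<kappa>' = rep_dom \<kappa> f \<kappa>'" using rep_dom_cong[OF \<kappa>(1)] assms(2) by metis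
  show o: "open (rep_dom \<kappa> g \<kappa>')" using f \<kappa> unfolding eq smooth_map_def by blast
  have "rep \<kappa> f \<kappa>' x = rep \<kappa> g \<kappa>' x" if "x \<in> rep_dom \<kappa> g \<kappa>'" for x
    using that by (intro rep_cong[OF M \<kappa>(1) assms(2)]) (auto simp: rep_dom_def)
  moreover have "smooth_on (rep \<kappa> f \<kappa>') (rep_dom \<kappa> g \<kappa>')" using f \<kappa> unfolding eq smooth_map_def by blast
  ultimately show "smooth_on (rep \<kappa> g \<kappa>') (rep_dom \<kappa> g \<kappa>')"
    using smooth_on_cong[OF o] by metis
qed

lemma frechet_derivative_cong_open:
  assumes "open S" "x \<in> S" "\<And>y. y \<in> S \<Longrightarrow> f y = g y"
  shows "frechet_derivative f (at x) = frechet_derivative g (at x)"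
proof -
  have "(f has_derivative D) (at x) \<longleftrightarrow> (g has_derivative D) (at x)" for D
    using has_derivative_transform_within_open[OF _ assms(1,2), of f D UNIV g]
      has_derivative_transform_within_open[OF _ assms(1,2), of g D UNIV f] assms(3) by auto
  then show ?thesis unfolding frechet_derivative_def by simp
qed

lemma drep_cong:
  assumes M: "chart_regular M" and "\<kappa> \<in> charts M" "p \<in> cdom \<kappa>" and "\<And>p. p \<in> points M \<Longrightarrow> f p = g p"
  shows "drep \<kappa> f \<kappa>' p = drep \<kappa> g \<kappa>' p"
  unfolding drep_def
proof (rule frechet_derivative_cong_open)
  show "open (coord \<kappa> ` cdom \<kappa>)" using M assms(2) by (simp add: chart_regular_def)
  show "coord \<kappa> p \<in> coord \<kappa> ` cdom \<kappa>" using assms(3) by blast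
  show "rep \<kappa> f \<kappa>' y = rep \<kappa> g \<kappa>' y" if "y \<in> coord \<kappa> ` cdom \<kappa>" for y
    by (rule rep_cong[OF M assms(2) assms(4) that])
qed

lemma drep_id:
  assumes M: "chart_regular M" and "\<kappa> \<in> charts M" "p \<in> cdom \<kappa>"
  shows "drep \<kappa> id \<kappa> p = id"
proof -
  have "drep \<kappa> id \<kappa> p = frechet_derivative id (at (coord \<kappa> p))"
    unfolding drep_def
  proof (rule frechet_derivative_cong_open)
    show "open (coord \<kappa> ` cdom \<kappa>)" using M assms(2) by (simp add: chart_regular_def)
    show "coord \<kappa> p \<in> coord \<kappa> ` cdom \<kappa>" using assms(3) by blast
    show "rep \<kappa> id \<kappa> y = id y" if y: "y \<in> coord \<kappa> ` cdom \<kappa>" for y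
    proof -
      obtain q where q: "q \<in> cdom \<kappa>" "y = coord \<kappa> q" using y by blast
      show ?thesis unfolding q(2) rep_coord[OF M assms(2) q(1)] by simp
    qed
  qed
  then show ?thesis by (simp add: frechet_derivative_id id_def)
qed

lemma drep_has_derivative:
  assumes "chart_regular M" "smooth_map M N f" "\<kappa> \<in> charts M" "p \<in> cdom \<kappa>" "\<kappa>' \<in> charts N" "f p \<in> cdom \<kappa>'"
  shows "(rep \<kappa> f \<kappa>' has_derivative drep \<kappa> f \<kappa>' p) (at (coord \<kappa> p))"
  unfolding drep_def
  using assms in_rep_dom_iff[OF assms(1,3,4)]
  by (intro smooth_on_has_derivative[of _ "rep_dom \<kappa> f \<kappa>'"]) (auto simp: smooth_map_def)

lemma
  assumes "smooth_map M N f" "\<kappa> \<in> charts M" "\<kappa>' \<in> charts N"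
  shows smooth_map_open: "open (rep_dom \<kappa> f \<kappa>')"
    and smooth_map_smooth: "smooth_on (rep \<kappa> f \<kappa>') (rep_dom \<kappa> f \<kappa>')"
    and smooth_map_continuous: "continuous_on (rep_dom \<kappa> f \<kappa>') (rep \<kappa> f \<kappa>')"
  using assms smooth_on_continuous[of "rep \<kappa> f \<kappa>'" "rep_dom \<kappa> f \<kappa>'"] by (simp_all add: smooth_map_def)

text \<open>Near a point the coordinate expression of a composite factors through any chart around the image
  point.\<close>

lemma rep_compose:
  assumes M: "chart_regular M" and N: "chart_regular N"
    and f: "smooth_map M N f" and g: "smooth_map N P g"
    and \<kappa>: "\<kappa> \<in> charts M" "p \<in> cdom \<kappa>" and \<kappa>': "\<kappa>' \<in> charts N" "f p \<in> cdom \<kappa>'"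
    and \<kappa>'': "\<kappa>'' \<in> charts P" "g (f p) \<in> cdom \<kappa>''"
  shows "\<exists>U. open U \<and> coord \<kappa> p \<in> U \<and> U \<subseteq> rep_dom \<kappa> (g \<circ> f) \<kappa>'' \<and> U \<subseteq> rep_dom \<kappa> f \<kappa>' \<and>
    rep \<kappa> f \<kappa>' ` U \<subseteq> rep_dom \<kappa>' g \<kappa>'' \<and>
    (\<forall>x\<in>U. rep \<kappa> (g \<circ> f) \<kappa>'' x = rep \<kappa>' g \<kappa>'' (rep \<kappa> f \<kappa>' x))"
proof -
  define U where "U = rep_dom \<kappa> f \<kappa>' \<inter> rep \<kappa> f \<kappa>' -` rep_dom \<kappa>' g \<kappa>''"
  have 1: "open U"
    unfolding U_def by (intro continuous_open_preimage smooth_map_continuous[OF f \<kappa>(1) \<kappa>'(1)]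
      smooth_map_open[OF f \<kappa>(1) \<kappa>'(1)] smooth_map_open[OF g \<kappa>'(1) \<kappa>''(1)])
  have 2: "coord \<kappa> p \<in> U"
    unfolding U_def
    by (simp add: in_rep_dom_iff[OF M \<kappa>] in_rep_dom_iff[OF N \<kappa>'] rep_coord[OF M \<kappa>] \<kappa>'(2) \<kappa>''(2))
  have 3: "\<exists>p\<in>cdom \<kappa>. x = coord \<kappa> p \<and> f p \<in> cdom \<kappa>' \<and> g (f p) \<in> cdom \<kappa>''" if x: "x \<in> U" for x
  proof -
    obtain p where p: "p \<in> cdom \<kappa>" "x = coord \<kappa> p" "f p \<in> cdom \<kappa>'"
      using x unfolding U_def rep_dom_def by blast
    then have "g (f p) \<in> cdom \<kappa>''"
      using x by (simp add: U_def p(2) rep_coord[OF M \<kappa>(1) p(1)] in_rep_dom_iff[OF N \<kappa>'(1) p(3)])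
    then show ?thesis using p by blast
  qed
  show ?thesis
  proof (intro exI[of _ U] conjI ballI 1 2)
    show "U \<subseteq> rep_dom \<kappa> (g \<circ> f) \<kappa>''" using 3 unfolding rep_dom_def by fastforce
    show "U \<subseteq> rep_dom \<kappa> f \<kappa>'" "rep \<kappa> f \<kappa>' ` U \<subseteq> rep_dom \<kappa>' g \<kappa>''" unfolding U_def by auto
    fix x assume "x \<in> U"
    then obtain p where p: "p \<in> cdom \<kappa>" "x = coord \<kappa> p" "f p \<in> cdom \<kappa>'" using 3 by blast
    show "rep \<kappa> (g \<circ> f) \<kappa>'' x = rep \<kappa>' g \<kappa>'' (rep \<kappa> f \<kappa>' x)"
      unfolding p(2) rep_coord[OF M \<kappa>(1) p(1)] rep_coord[OF N \<kappa>'(1) p(3)] by simp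
  qed
qed

lemma smooth_map_compose:
  assumes M: "chart_regular M" and N: "chart_regular N"
    and f: "smooth_map M N f" and g: "smooth_map N P g"
  shows "smooth_map M P (g \<circ> f)"
  unfolding smooth_map_def
proof (intro conjI ballI)
  have fM: "f ` points M \<subseteq> points N" and "g ` points N \<subseteq> points P"
    using f g unfolding smooth_map_def by blast+
  then show "(g \<circ> f) ` points M \<subseteq> points P" by auto
  fix \<kappa> \<kappa>'' assume \<kappa>: "\<kappa> \<in> charts M" "\<kappa>'' \<in> charts P"
  have loc: "\<exists>U. open U \<and> x \<in> U \<and> U \<subseteq> rep_dom \<kappa> (g \<circ> f) \<kappa>'' \<and> smooth_on (rep \<kappa> (g \<circ> f) \<kappa>'') U"
    if x: "x \<in> rep_dom \<kappa> (g \<circ> f) \<kappa>''" for x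
  proof -
    obtain p where p: "p \<in> cdom \<kappa>" "g (f p) \<in> cdom \<kappa>''" "x = coord \<kappa> p"
      using x unfolding rep_dom_def comp_def by blast
    have fp: "f p \<in> points N" using fM in_points[OF \<kappa>(1) p(1)] by blast
    obtain \<kappa>' where \<kappa>': "\<kappa>' \<in> charts N" "f p \<in> cdom \<kappa>'" using points_chart[OF fp] by (elim bexE)
    obtain U where U: "open U" "coord \<kappa> p \<in> U" "U \<subseteq> rep_dom \<kappa> (g \<circ> f) \<kappa>''" "U \<subseteq> rep_dom \<kappa> f \<kappa>'"
      "rep \<kappa> f \<kappa>' ` U \<subseteq> rep_dom \<kappa>' g \<kappa>''"
      "\<forall>x\<in>U. rep \<kappa> (g \<circ> f) \<kappa>'' x = rep \<kappa>' g \<kappa>'' (rep \<kappa> f \<kappa>' x)"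
      using rep_compose[OF M N f g \<kappa>(1) p(1) \<kappa>' \<kappa>(2) p(2)] by (elim exE conjE)
    have "smooth_on (rep \<kappa> f \<kappa>') U"
      using smooth_on_subset[OF smooth_map_smooth[OF f \<kappa>(1) \<kappa>'(1)] U(4)] .
    then have "smooth_on (\<lambda>x. rep \<kappa>' g \<kappa>'' (rep \<kappa> f \<kappa>' x)) U"
      by (rule smooth_on_compose[OF U(1) smooth_map_open[OF g \<kappa>'(1) \<kappa>(2)] U(5) _ smooth_map_smooth[OF g \<kappa>'(1) \<kappa>(2)]])
    moreover have "smooth_on (rep \<kappa> (g \<circ> f) \<kappa>'') U \<longleftrightarrow> smooth_on (\<lambda>x. rep \<kappa>' g \<kappa>'' (rep \<kappa> f \<kappa>' x)) U"
      by (rule smooth_on_cong[OF U(1)]) (rule U(6)[rule_format])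
    ultimately have "smooth_on (rep \<kappa> (g \<circ> f) \<kappa>'') U" by simp
    then show ?thesis using U p(3) by blast
  qed
  show "open (rep_dom \<kappa> (g \<circ> f) \<kappa>'')"
    by (subst open_subopen) (use loc in blast)
  show "smooth_on (rep \<kappa> (g \<circ> f) \<kappa>'') (rep_dom \<kappa> (g \<circ> f) \<kappa>'')"
    by (rule smooth_on_local) (use loc in blast)
qed

lemma drep_compose:
  assumes M: "chart_regular M" and N: "chart_regular N"
    and f: "smooth_map M N f" and g: "smooth_map N P g"
    and \<kappa>: "\<kappa> \<in> charts M" "p \<in> cdom \<kappa>" and \<kappa>': "\<kappa>' \<in> charts N" "f p \<in> cdom \<kappa>'"
    and \<kappa>'': "\<kappa>'' \<in> charts P" "g (f p) \<in> cdom \<kappa>''"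
  shows "drep \<kappa> (g \<circ> f) \<kappa>'' p u = drep \<kappa>' g \<kappa>'' (f p) (drep \<kappa> f \<kappa>' p u)"
proof -
  obtain U where U: "open U" "coord \<kappa> p \<in> U" 
      "\<forall>x\<in>U. rep \<kappa> (g \<circ> f) \<kappa>'' x = rep \<kappa>' g \<kappa>'' (rep \<kappa> f \<kappa>' x)"
    using rep_compose[OF assms] by (elim exE conjE)
  have 1: "(rep \<kappa> f \<kappa>' has_derivative drep \<kappa> f \<kappa>' p) (at (coord \<kappa> p))"
    by (rule drep_has_derivative[OF M f \<kappa> \<kappa>'])
  have 2: "(rep \<kappa>' g \<kappa>'' has_derivative drep \<kappa>' g \<kappa>'' (f p)) (at (rep \<kappa> f \<kappa>' (coord \<kappa> p)))"
    unfolding rep_coord[OF M \<kappa>] by (rule drep_has_derivative[OF N g \<kappa>' \<kappa>''])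
  have "((\<lambda>x. rep \<kappa>' g \<kappa>'' (rep \<kappa> f \<kappa>' x)) has_derivative
      (\<lambda>u. drep \<kappa>' g \<kappa>'' (f p) (drep \<kappa> f \<kappa>' p u))) (at (coord \<kappa> p))"
    by (rule has_derivative_compose[OF 1 2])
  then have "(\<lambda>u. drep \<kappa>' g \<kappa>'' (f p) (drep \<kappa> f \<kappa>' p u)) = frechet_derivative (\<lambda>x. rep \<kappa>' g \<kappa>'' (rep \<kappa> f \<kappa>' x)) (at (coord \<kappa> p))"
    by (rule frechet_derivative_at)
  also have "\<dots> = drep \<kappa> (g \<circ> f) \<kappa>'' p"
    unfolding drep_def by (rule frechet_derivative_cong_open[OF U(1,2)]) (rule U(3)[rule_format, symmetric])
  finally have "(\<lambda>u. drep \<kappa>' g \<kappa>'' (f p) (drep \<kappa> f \<kappa>' p u)) = drep \<kappa> (g \<circ> f) \<kappa>'' p" .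
  from fun_cong[OF this, of u] show ?thesis by (rule sym)
qed

text \<open>The identity is smooth because its coordinate expressions are the coordinate changes. Statements
  about coordinate changes thereby become instances of statements about smooth maps.\<close>

lemma smooth_map_id:
  assumes "analytic_manifold M"
  shows "smooth_map M M id"
  unfolding smooth_map_def
proof (intro conjI ballI)
  fix \<kappa> \<kappa>' assume \<kappa>: "\<kappa> \<in> charts M" "\<kappa>' \<in> charts M"
  then show o: "open (rep_dom \<kappa> id \<kappa>')" using assms unfolding analytic_manifold_def by blast
  show "smooth_on (rep \<kappa> id \<kappa>') (rep_dom \<kappa> id \<kappa>')"
    using assms \<kappa> unfolding analytic_manifold_def real_analytic_on_def by (intro smooth_on_vec[OF o]) blast
qed simp

lemma analytic_chart_regular: "analytic_manifold M \<Longrightarrow> chart_regular M"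
  unfolding analytic_manifold_def chart_regular_def by blast

lemma isometry_ginner:
  "isometry M N f \<Longrightarrow> p \<in> points M \<Longrightarrow> \<kappa> \<in> charts_at M p \<Longrightarrow> \<kappa>' \<in> charts_at N (f p) \<Longrightarrow>
    ginner N \<kappa>' (f p) (drep \<kappa> f \<kappa>' p u) (drep \<kappa> f \<kappa>' p w) = ginner M \<kappa> p u w"
  unfolding isometry_def by blast

text \<open>The differentials of \<open>f\<close> and of its inverse are inverse to each other by the chain
  rule.\<close>

lemma isometry_inverse:
  assumes M: "chart_regular M" and N: "chart_regular N" and f: "isometry M N f"
  shows "isometry N M (inv_into (points M) f)"
proof -
  define g where "g = inv_into (points M) f"
  have bij: "bij_betw f (points M) (points N)" and sf: "smooth_map M N f" and sg: "smooth_map N M g"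
    using f unfolding isometry_def g_def by blast+
  have gf: "g (f p) = p" if "p \<in> points M" for p
    using bij that by (simp add: g_def bij_betw_def)
  have fg: "f (g q) = q" if "q \<in> points N" for q
    unfolding g_def by (rule bij_betw_inv_into_right[OF bij that])
  have bij': "bij_betw g (points N) (points M)" unfolding g_def by (rule bij_betw_inv_into[OF bij])
  have "smooth_map M N (inv_into (points N) g)"
  proof (rule smooth_map_cong[OF M _ sf])
    fix p assume p: "p \<in> points M"
    then have "f p \<in> points N" by (rule bij_betw_apply[OF bij])
    then show "f p = inv_into (points N) g p"
      using inv_into_f_f[OF bij_betw_imp_inj_on[OF bij'], of "f p"] gf[OF p] by simp
  qed
  moreover have "ginner M \<kappa> (g q) (drep \<kappa>' g \<kappa> q u) (drep \<kappa>' g \<kappa> q w) = ginner N \<kappa>' q u w"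
    if q: "q \<in> points N" and \<kappa>': "\<kappa>' \<in> charts_at N q" and \<kappa>: "\<kappa> \<in> charts_at M (g q)" for q \<kappa> \<kappa>' u w
  proof -
    have \<kappa>'q: "\<kappa>' \<in> charts N" "q \<in> cdom \<kappa>'" and \<kappa>q: "\<kappa> \<in> charts M" "g q \<in> cdom \<kappa>"
      using \<kappa> \<kappa>' unfolding charts_at_def by blast+
    have fq: "f (g q) \<in> cdom \<kappa>'" using fg[OF q] \<kappa>'q by simp
    have inv: "drep \<kappa> f \<kappa>' (g q) (drep \<kappa>' g \<kappa> q u) = u" for u
    proof -
      have "drep \<kappa> f \<kappa>' (g q) (drep \<kappa>' g \<kappa> q u) = drep \<kappa>' (f \<circ> g) \<kappa>' q u"
        using drep_compose[OF N M sg sf \<kappa>'q \<kappa>q \<kappa>'q(1) fq] by simp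
      also have "drep \<kappa>' (f \<circ> g) \<kappa>' q = drep \<kappa>' id \<kappa>' q"
        by (rule drep_cong[OF N \<kappa>'q]) (simp add: fg)
      finally show ?thesis by (simp add: drep_id[OF N \<kappa>'q])
    qed
    have "ginner N \<kappa>' (f (g q)) (drep \<kappa> f \<kappa>' (g q) u) (drep \<kappa> f \<kappa>' (g q) w) = ginner M \<kappa> (g q) u w" for u w
    proof -
      have "\<kappa>' \<in> charts_at N (f (g q))" using \<kappa>' unfolding fg[OF q] .
      then show ?thesis by (rule isometry_ginner[OF f in_points[OF \<kappa>q] \<kappa>])
    qed
    from this[of "drep \<kappa>' g \<kappa> q u" "drep \<kappa>' g \<kappa> q w"] show ?thesis
      unfolding inv fg[OF q] by (rule sym)
  qed
  ultimately show ?thesis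
    using bij' sg unfolding isometry_def g_def[symmetric] by simp
qed

lemma isometry_compose:
  assumes M: "chart_regular M" and N: "chart_regular N" and P: "chart_regular P"
    and f: "isometry M N f" and g: "isometry N P g"
  shows "isometry M P (g \<circ> f)"
  unfolding isometry_def
proof (intro conjI ballI allI)
  have bf: "bij_betw f (points M) (points N)" and sf: "smooth_map M N f"
    and sf': "smooth_map N M (inv_into (points M) f)" using f unfolding isometry_def by blast+
  have bg: "bij_betw g (points N) (points P)" and sg: "smooth_map N P g"
    and sg': "smooth_map P N (inv_into (points N) g)" using g unfolding isometry_def by blast+
  show bgf: "bij_betw (g \<circ> f) (points M) (points P)" by (rule bij_betw_trans[OF bf bg])
  show "smooth_map M P (g \<circ> f)" by (rule smooth_map_compose[OF M N sf sg])
  show "smooth_map P M (inv_into (points M) (g \<circ> f))"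
  proof (rule smooth_map_cong[OF P _ smooth_map_compose[OF P N sg' sf']])
    fix q assume q: "q \<in> points P"
    define p where "p = inv_into (points M) f (inv_into (points N) g q)"
    have 1: "inv_into (points N) g q \<in> points N" "g (inv_into (points N) g q) = q"
      using bg q by (auto simp: bij_betw_def inv_into_into f_inv_into_f)
    then have 2: "p \<in> points M" "f p = inv_into (points N) g q"
      using bf unfolding p_def by (auto simp: bij_betw_def inv_into_into f_inv_into_f)
    then have "inv_into (points M) (g \<circ> f) q = p"
      using 1 inv_into_f_f[OF bij_betw_imp_inj_on[OF bgf] 2(1)] by simp
    then show "(inv_into (points M) f \<circ> inv_into (points N) g) q = inv_into (points M) (g \<circ> f) q"
      by (simp add: p_def)
  qed
  fix p \<kappa> \<kappa>'' u w
  assume p: "p \<in> points M" and \<kappa>: "\<kappa> \<in> charts_at M p" and \<kappa>'': "\<kappa>'' \<in> charts_at P ((g \<circ> f) p)"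
  have fp: "f p \<in> points N" by (rule bij_betw_apply[OF bf p])
  obtain \<kappa>' where \<kappa>': "\<kappa>' \<in> charts_at N (f p)" using points_charts_at[OF fp] by (elim exE)
  have a: "\<kappa> \<in> charts M" "p \<in> cdom \<kappa>" and b: "\<kappa>' \<in> charts N" "f p \<in> cdom \<kappa>'"
    and c: "\<kappa>'' \<in> charts P" "g (f p) \<in> cdom \<kappa>''"
    using charts_atD[OF \<kappa>] charts_atD[OF \<kappa>'] charts_atD[OF \<kappa>''] by simp_all
  have "ginner P \<kappa>'' (g (f p)) (drep \<kappa>' g \<kappa>'' (f p) u) (drep \<kappa>' g \<kappa>'' (f p) w) = ginner N \<kappa>' (f p) u w" for u w
    by (rule isometry_ginner[OF g fp \<kappa>']) (use \<kappa>'' in simp)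
  moreover have "ginner N \<kappa>' (f p) (drep \<kappa> f \<kappa>' p u) (drep \<kappa> f \<kappa>' p w) = ginner M \<kappa> p u w"
    by (rule isometry_ginner[OF f p \<kappa> \<kappa>'])
  ultimately show "ginner P \<kappa>'' ((g \<circ> f) p) (drep \<kappa> (g \<circ> f) \<kappa>'' p u) (drep \<kappa> (g \<circ> f) \<kappa>'' p w) = ginner M \<kappa> p u w"
    unfolding drep_compose[OF M N sf sg a b c] comp_apply by (simp only:)
qed

lemma charts_rescale [simp]: "charts (rescale c M) = charts M"
  by (simp add: rescale_def)

lemma points_rescale [simp]: "points (rescale c M) = points M"
  by (simp add: points_def)

lemma ginner_rescale: "ginner (rescale c M) \<kappa> p u w = c * ginner M \<kappa> p u w"
  by (simp add: ginner_def rescale_def scaleR_matrix_vector_assoc[symmetric])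

lemma isometry_rescale:
  assumes "isometry M N f"
  shows "isometry (rescale c M) (rescale c N) f"
  using assms unfolding isometry_def smooth_map_def charts_at_def by (simp add: ginner_rescale)

lemma chart_regular_rescale: "chart_regular M \<Longrightarrow> chart_regular (rescale c M)"
  by (simp add: chart_regular_def)

section \<open>Full lattices\<close>

text \<open>Independence of the basis, as injectivity of the linear map that sends the standard basis to it.\<close>

lemma lattice_coordinates:
  fixes b :: "'n::finite \<Rightarrow> real^'n"
  assumes "inj b" "independent (range b)"
  shows "linear (\<lambda>x::real^'n. \<Sum>i\<in>UNIV. (x $ i) *\<^sub>R b i)" "inj (\<lambda>x::real^'n. \<Sum>i\<in>UNIV. (x $ i) *\<^sub>R b i)"
proof -
  let ?L = "\<lambda>x::real^'n. \<Sum>i\<in>UNIV. (x $ i) *\<^sub>R b i"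
  show lin: "linear ?L"
    by (rule linearI) (simp_all add: scaleR_add_left sum.distrib scaleR_sum_right)
  show "inj ?L"
  proof (subst linear_injective_0[OF lin], intro allI impI)
    fix x :: "real^'n" assume x: "?L x = 0"
    define u where "u v = x $ (inv_into UNIV b v)" for v
    have "(\<Sum>v\<in>range b. u v *\<^sub>R v) = ?L x"
      by (subst sum.reindex[OF assms(1)]) (simp add: u_def inv_f_f[OF assms(1)])
    then have 0: "(\<Sum>v\<in>range b. u v *\<^sub>R v) = 0" using x by simp
    have "u (b i) = 0" for i
      by (rule independentD[OF assms(2) _ _ 0]) auto
    then have "x $ i = 0" for i by (simp add: u_def inv_f_f[OF assms(1)])
    then show "x = 0" by (simp add: vec_eq_iff)
  qed
qed

text \<open>The coordinate map is injective and linear, hence bounded below, so a bounded set of lattice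
  points has bounded integer coordinates.\<close>

lemma lattice_discrete_subgroup:
  fixes \<Gamma> :: "(real^'n::finite) set"
  assumes "lattice_of_full_rank \<Gamma>"
  shows "discrete_subgroup \<Gamma>"
proof -
  obtain b :: "'n \<Rightarrow> real^'n" where b: "inj b" "independent (range b)"
    "\<Gamma> = {\<Sum>i\<in>UNIV. of_int (k i) *\<^sub>R b i | k :: 'n \<Rightarrow> int. True}"
    using assms unfolding lattice_of_full_rank_def by (elim exE conjE)
  define L where "L x = (\<Sum>i\<in>UNIV. (x $ i) *\<^sub>R b i)" for x :: "real^'n"
  define comb where "comb k = (\<Sum>i\<in>UNIV. real_of_int (k i) *\<^sub>R b i)" for k :: "'n \<Rightarrow> int"
  have \<Gamma>: "\<Gamma> = range comb" unfolding b(3) comb_def by auto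
  have comb_L: "comb k = L (\<chi> i. of_int (k i))" for k by (simp add: comb_def L_def)
  have "linear L" "inj L" using lattice_coordinates[OF b(1,2)] unfolding L_def .
  then obtain B where B: "B > 0" "\<And>x. B * norm x \<le> norm (L x)"
    using linear_inj_bounded_below_pos by blast
  show ?thesis
    unfolding discrete_subgroup_def
  proof (intro conjI ballI allI)
    have "comb (\<lambda>_. 0) = 0" by (simp add: comb_def)
    then show "0 \<in> \<Gamma>" unfolding \<Gamma> by (metis rangeI)
  next
    fix x y assume "x \<in> \<Gamma>" "y \<in> \<Gamma>"
    then obtain k l where "x = comb k" "y = comb l" unfolding \<Gamma> by blast
    then have "x - y = comb (\<lambda>i. k i - l i)"
      by (simp add: comb_def scaleR_diff_left sum_subtractf)
    then show "x - y \<in> \<Gamma>" unfolding \<Gamma> by (metis rangeI)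
  next
    fix R :: real
    define m where "m = \<lceil>R / B\<rceil>"
    have "{\<gamma> \<in> \<Gamma>. norm \<gamma> \<le> R} \<subseteq> comb ` (PiE UNIV (\<lambda>_. {-m..m}))"
    proof
      fix \<gamma> assume "\<gamma> \<in> {\<gamma> \<in> \<Gamma>. norm \<gamma> \<le> R}"
      then obtain k where k: "\<gamma> = comb k" "norm (comb k) \<le> R" unfolding \<Gamma> by blast
      have "\<bar>k i\<bar> \<le> m" for i
      proof -
        have "B * norm (\<chi> i. real_of_int (k i)) \<le> R" using B(2) k(2) unfolding comb_L by (rule order_trans)
        then have "norm (\<chi> i. real_of_int (k i)) \<le> R / B" using B(1) by (simp add: field_simps)
        moreover have "\<bar>(\<chi> i. real_of_int (k i)) $ i\<bar> \<le> norm (\<chi> i. real_of_int (k i))"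
          by (rule component_le_norm_cart)
        ultimately have "\<bar>real_of_int (k i)\<bar> \<le> R / B" by simp
        then show ?thesis unfolding m_def by linarith
      qed
      then have "k i \<in> {-m..m}" for i using abs_le_iff[of "k i" m] by simp
      then have "k \<in> PiE UNIV (\<lambda>_. {-m..m})" by (simp add: PiE_UNIV_domain)
      then show "\<gamma> \<in> comb ` (PiE UNIV (\<lambda>_. {-m..m}))" using k(1) by blast
    qed
    moreover have "finite (comb ` (PiE UNIV (\<lambda>_::'n. {-m..m})))"
      by (intro finite_imageI finite_PiE) auto
    ultimately show "finite {\<gamma> \<in> \<Gamma>. norm \<gamma> \<le> R}" by (rule finite_subset)
  qed
qed

lemma additive_int_combination:
  fixes f :: "'e::euclidean_space \<Rightarrow> 'e"
  assumes \<Gamma>: "discrete_subgroup \<Gamma>" and add: "\<And>x y. x \<in> \<Gamma> \<Longrightarrow> y \<in> \<Gamma> \<Longrightarrow> f (x + y) = f x + f y"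
  shows "f 0 = 0" "x \<in> \<Gamma> \<Longrightarrow> of_int k *\<^sub>R x \<in> \<Gamma> \<and> f (of_int k *\<^sub>R x) = of_int k *\<^sub>R f x"
    "finite I \<Longrightarrow> (\<And>i. i \<in> I \<Longrightarrow> g i \<in> \<Gamma>) \<Longrightarrow> (\<Sum>i\<in>I. g i) \<in> \<Gamma> \<and> f (\<Sum>i\<in>I. g i) = (\<Sum>i\<in>I. f (g i))"
proof -
  have z: "0 \<in> \<Gamma>" by (rule discrete_subgroup_zero[OF \<Gamma>])
  show f0: "f 0 = 0" using add[OF z z] by simp
  have minus: "f (- x) = - f x" if "x \<in> \<Gamma>" for x
    using add[OF that discrete_subgroup_minus[OF \<Gamma> that]] f0 by (simp add: eq_neg_iff_add_eq_0 add.commute)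
  have nat: "real n *\<^sub>R x \<in> \<Gamma> \<and> f (real n *\<^sub>R x) = real n *\<^sub>R f x" if x: "x \<in> \<Gamma>" for n x
  proof (induction n)
    case (Suc n)
    then have "x + real n *\<^sub>R x \<in> \<Gamma>" "f (x + real n *\<^sub>R x) = f x + real n *\<^sub>R f x"
      using add[OF x, of "real n *\<^sub>R x"] discrete_subgroup_add[OF \<Gamma> x, of "real n *\<^sub>R x"] by simp_all
    then show ?case by (simp add: scaleR_add_left)
  qed (simp add: z f0)
  show "of_int k *\<^sub>R x \<in> \<Gamma> \<and> f (of_int k *\<^sub>R x) = of_int k *\<^sub>R f x" if x: "x \<in> \<Gamma>"
  proof (cases k)
    case (nonneg n)
    then show ?thesis using nat[OF x, of n] by simp
  next
    case (neg n)
    have "of_int k *\<^sub>R x = - (real (Suc n) *\<^sub>R x)"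
      unfolding neg of_int_minus of_int_of_nat_eq scaleR_minus_left ..
    moreover have "of_int k *\<^sub>R f x = - (real (Suc n) *\<^sub>R f x)"
      unfolding neg of_int_minus of_int_of_nat_eq scaleR_minus_left ..
    ultimately show ?thesis
      using nat[OF x, of "Suc n"] minus[of "real (Suc n) *\<^sub>R x"] discrete_subgroup_minus[OF \<Gamma>, of "real (Suc n) *\<^sub>R x"]
      by metis
  qed
  show "finite I \<Longrightarrow> (\<And>i. i \<in> I \<Longrightarrow> g i \<in> \<Gamma>) \<Longrightarrow> (\<Sum>i\<in>I. g i) \<in> \<Gamma> \<and> f (\<Sum>i\<in>I. g i) = (\<Sum>i\<in>I. f (g i))"
    by (induction I rule: finite_induct) (auto simp: z f0 add discrete_subgroup_add[OF \<Gamma>])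
qed

text \<open>Additivity determines \<open>f\<close> on a lattice basis, and polarization turns the scaling of
  norms into the scaling of inner products.\<close>

lemma lattice_similarity_extends:
  fixes \<Gamma> :: "(real^'n::finite) set" and f :: "real^'n \<Rightarrow> real^'n"
  assumes lat: "lattice_of_full_rank \<Gamma>" and add: "\<And>x y. x \<in> \<Gamma> \<Longrightarrow> y \<in> \<Gamma> \<Longrightarrow> f (x + y) = f x + f y"
    and Q: "\<And>x. x \<in> \<Gamma> \<Longrightarrow> f x \<bullet> f x = Q * (x \<bullet> x)"
  obtains A where "linear A" "\<And>x y. A x \<bullet> A y = Q * (x \<bullet> y)" "\<And>\<gamma>. \<gamma> \<in> \<Gamma> \<Longrightarrow> A \<gamma> = f \<gamma>"
proof -
  obtain b :: "'n \<Rightarrow> real^'n" where b: "inj b" "independent (range b)"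
    "\<Gamma> = {\<Sum>i\<in>UNIV. of_int (k i) *\<^sub>R b i | k :: 'n \<Rightarrow> int. True}"
    using lat unfolding lattice_of_full_rank_def by (elim exE conjE)
  have \<Gamma>: "discrete_subgroup \<Gamma>" by (rule lattice_discrete_subgroup[OF lat])
  have b\<Gamma>: "b i \<in> \<Gamma>" for i
  proof -
    have "b i = (\<Sum>j\<in>UNIV. of_int (if j = i then 1 else 0) *\<^sub>R b j)"
      by (simp add: if_distrib[of "\<lambda>c. of_int c *\<^sub>R _"] cong: if_cong)
    then show ?thesis unfolding b(3) mem_Collect_eq by (intro exI[of _ "\<lambda>j. if j = i then 1 else 0"] conjI TrueI)
  qed
  have ff: "f x \<bullet> f y = Q * (x \<bullet> y)" if "x \<in> \<Gamma>" "y \<in> \<Gamma>" for x y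
  proof -
    have "f (x + y) \<bullet> f (x + y) = Q * ((x + y) \<bullet> (x + y))"
      by (rule Q[OF discrete_subgroup_add[OF \<Gamma> that]])
    then show ?thesis
      unfolding add[OF that] using Q[OF that(1)] Q[OF that(2)]
      by (simp add: inner_add_left inner_add_right inner_commute[of y x] inner_commute[of "f y" "f x"] algebra_simps)
  qed
  define L where "L x = (\<Sum>i\<in>UNIV. (x $ i) *\<^sub>R b i)" for x :: "real^'n"
  define L' where "L' x = (\<Sum>i\<in>UNIV. (x $ i) *\<^sub>R f (b i))" for x :: "real^'n"
  have L: "linear L" "inj L" using lattice_coordinates[OF b(1,2)] unfolding L_def .
  have L': "linear L'" unfolding L'_def
    by (rule linearI) (simp_all add: scaleR_add_left sum.distrib scaleR_sum_right)
  obtain K where K: "linear K" "\<And>x. K (L x) = x" "\<And>x. L (K x) = x"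
    using linear_injective_isomorphism[OF L] by blast
  have LL: "L' x \<bullet> L' y = Q * (L x \<bullet> L y)" for x y
    unfolding L_def L'_def inner_sum_left inner_sum_right
    by (simp add: ff[OF b\<Gamma> b\<Gamma>] sum_distrib_left algebra_simps)
  show ?thesis
  proof (rule that[of "L' \<circ> K"])
    show "linear (L' \<circ> K)" by (rule linear_compose[OF K(1) L'])
    show "(L' \<circ> K) x \<bullet> (L' \<circ> K) y = Q * (x \<bullet> y)" for x y by (simp add: LL K)
    fix \<gamma> assume "\<gamma> \<in> \<Gamma>"
    then obtain k :: "'n \<Rightarrow> int" where k: "\<gamma> = (\<Sum>i\<in>UNIV. of_int (k i) *\<^sub>R b i)" unfolding b(3) by blast
    have "\<gamma> = L (\<chi> i. of_int (k i))" unfolding k by (simp add: L_def)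
    then have "(L' \<circ> K) \<gamma> = L' (\<chi> i. of_int (k i))" by (simp add: K)
    also have "\<dots> = (\<Sum>i\<in>UNIV. f (of_int (k i) *\<^sub>R b i))"
      using additive_int_combination(2)[OF \<Gamma> add b\<Gamma>] by (simp add: L'_def)
    also have "\<dots> = f \<gamma>"
      unfolding k using additive_int_combination(2)[OF \<Gamma> add b\<Gamma>]
        additive_int_combination(3)[OF \<Gamma> add, of UNIV "\<lambda>i. of_int (k i) *\<^sub>R b i"] by simp
    finally show "(L' \<circ> K) \<gamma> = f \<gamma>" .
  qed
qed

section \<open>Quotient tori\<close>

lemma orbit_eq_iff:
  assumes "discrete_subgroup \<Gamma>"
  shows "orbit \<Gamma> x = orbit \<Gamma> y \<longleftrightarrow> y - x \<in> \<Gamma>"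
proof
  assume "orbit \<Gamma> x = orbit \<Gamma> y"
  moreover have "y \<in> orbit \<Gamma> y"
    unfolding orbit_def using discrete_subgroup_zero[OF assms] by force
  ultimately have "y \<in> orbit \<Gamma> x" by simp
  then show "y - x \<in> \<Gamma>" unfolding orbit_def by auto
next
  assume *: "y - x \<in> \<Gamma>"
  have sub: "orbit \<Gamma> y \<subseteq> orbit \<Gamma> x" if *: "y - x \<in> \<Gamma>" for x y
  proof
    fix z assume "z \<in> orbit \<Gamma> y"
    then obtain \<gamma> where \<gamma>: "\<gamma> \<in> \<Gamma>" "z = y + \<gamma>" unfolding orbit_def by blast
    then have "z = x + ((y - x) + \<gamma>)" "(y - x) + \<gamma> \<in> \<Gamma>" using discrete_subgroup_add[OF assms *] by simp_all
    then show "z \<in> orbit \<Gamma> x" unfolding orbit_def by (rule image_eqI)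
  qed
  have yx: "x - y \<in> \<Gamma>" using discrete_subgroup_minus[OF assms *] by simp
  show "orbit \<Gamma> x = orbit \<Gamma> y" by (rule equalityI[OF sub[OF yx] sub[OF *]])
qed

lemma orbit_add: "discrete_subgroup \<Gamma> \<Longrightarrow> \<gamma> \<in> \<Gamma> \<Longrightarrow> orbit \<Gamma> (x + \<gamma>) = orbit \<Gamma> x"
  using orbit_eq_iff[of \<Gamma> x "x + \<gamma>"] by simp

lemma discrete_subgroup_separated:
  assumes "discrete_subgroup \<Gamma>"
  shows "\<exists>r>0. \<forall>\<gamma>\<in>\<Gamma>. norm \<gamma> < r \<longrightarrow> \<gamma> = 0"
proof -
  define S where "S = {\<gamma>\<in>\<Gamma>. norm \<gamma> \<le> 1} - {0}"
  have S: "finite S" unfolding S_def using discrete_subgroup_finite[OF assms, of 1] by blast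
  define r where "r = Min (insert 1 (norm ` S))"
  have fin: "finite (insert 1 (norm ` S))" using S by blast
  have "\<forall>x\<in>insert 1 (norm ` S). x > 0" by (auto simp: S_def)
  then have pos: "r > 0" unfolding r_def using Min_gr_iff[OF fin] by blast
  have "\<gamma> = 0" if "\<gamma> \<in> \<Gamma>" "norm \<gamma> < r" for \<gamma>
  proof (rule ccontr)
    assume "\<gamma> \<noteq> 0"
    have "r \<le> 1" unfolding r_def using fin by simp
    then have "\<gamma> \<in> S" using that \<open>\<gamma> \<noteq> 0\<close> by (simp add: S_def)
    then have "r \<le> norm \<gamma>" unfolding r_def by (intro Min_le[OF fin]) blast
    then show False using that by simp
  qed
  then show ?thesis using pos by blast
qed

text \<open>The projection to the torus is injective on all balls of one fixed radius; they give an atlas.\<close>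

lemma orbit_inj_on_ball:
  assumes \<Gamma>: "discrete_subgroup \<Gamma>"
  shows "\<exists>r>0. \<forall>x. inj_on (orbit \<Gamma>) (ball x r)"
proof -
  obtain r where r: "r > 0" "\<forall>\<gamma>\<in>\<Gamma>. norm \<gamma> < r \<longrightarrow> \<gamma> = 0"
    using discrete_subgroup_separated[OF \<Gamma>] by (elim exE conjE)
  have "inj_on (orbit \<Gamma>) (ball x (r / 2))" for x
  proof (rule inj_onI)
    fix y z assume *: "y \<in> ball x (r / 2)" "z \<in> ball x (r / 2)" "orbit \<Gamma> y = orbit \<Gamma> z"
    have "dist z y \<le> dist x z + dist x y" by (metis dist_commute dist_triangle)
    then have "norm (z - y) < r" using *(1,2) by (simp add: dist_norm[symmetric])
    moreover have "z - y \<in> \<Gamma>" using *(3) unfolding orbit_eq_iff[OF \<Gamma>] .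
    ultimately have "z - y = 0" using r(2)[rule_format, of "z - y"] by blast
    then show "y = z" by simp
  qed
  then show ?thesis using r(1) by (intro exI[of _ "r / 2"]) simp
qed

definition torus_chart :: "(real^'n) set \<Rightarrow> (real^'n) set \<Rightarrow> ((real^'n) set, 'n::finite) chart" where
  "torus_chart \<Gamma> W = Chart (orbit \<Gamma> ` W) (inv_into W (orbit \<Gamma>))"

lemma cdom_torus_chart [simp]: "cdom (torus_chart \<Gamma> W) = orbit \<Gamma> ` W"
  by (simp add: torus_chart_def)

lemma charts_torus: "charts (quotient_torus \<Gamma>) = {torus_chart \<Gamma> W | W. open W \<and> inj_on (orbit \<Gamma>) W}"
  by (simp add: quotient_torus_def torus_chart_def)

lemma coord_torus_chart: "inj_on (orbit \<Gamma>) W \<Longrightarrow> x \<in> W \<Longrightarrow> coord (torus_chart \<Gamma> W) (orbit \<Gamma> x) = x"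
  by (simp add: torus_chart_def)

lemma coord_torus_chart_translate:
  assumes "discrete_subgroup \<Gamma>" "\<gamma> \<in> \<Gamma>" "inj_on (orbit \<Gamma>) W" "x + \<gamma> \<in> W"
  shows "coord (torus_chart \<Gamma> W) (orbit \<Gamma> x) = x + \<gamma>" "orbit \<Gamma> x \<in> orbit \<Gamma> ` W"
proof -
  have eq: "orbit \<Gamma> x = orbit \<Gamma> (x + \<gamma>)" by (rule orbit_add[OF assms(1,2), symmetric])
  show "coord (torus_chart \<Gamma> W) (orbit \<Gamma> x) = x + \<gamma>" unfolding eq by (rule coord_torus_chart[OF assms(3,4)])
  show "orbit \<Gamma> x \<in> orbit \<Gamma> ` W" unfolding eq using assms(4) by (rule imageI)
qed

lemma ginner_torus: "ginner (quotient_torus \<Gamma>) \<kappa> p u w = u \<bullet> w"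
  by (simp add: ginner_def quotient_torus_def)

lemma points_torus:
  assumes "discrete_subgroup \<Gamma>"
  shows "points (quotient_torus \<Gamma>) = range (orbit \<Gamma>)"
proof (intro equalityI subsetI)
  fix p assume "p \<in> points (quotient_torus \<Gamma>)"
  then show "p \<in> range (orbit \<Gamma>)" unfolding points_def charts_torus by auto
next
  fix p assume "p \<in> range (orbit \<Gamma>)"
  then obtain x where x: "p = orbit \<Gamma> x" by blast
  obtain r where r: "r > 0" "\<forall>x. inj_on (orbit \<Gamma>) (ball x r)"
    using orbit_inj_on_ball[OF assms] by (elim exE conjE)
  have "torus_chart \<Gamma> (ball x r) \<in> charts (quotient_torus \<Gamma>)" unfolding charts_torus using r(2) by blast
  moreover have "p \<in> cdom (torus_chart \<Gamma> (ball x r))" using r(1) x by simp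
  ultimately show "p \<in> points (quotient_torus \<Gamma>)" by (rule in_points)
qed

lemma chart_regular_torus: "chart_regular (quotient_torus \<Gamma>)"
  unfolding chart_regular_def
proof
  fix \<kappa> assume "\<kappa> \<in> charts (quotient_torus \<Gamma>)"
  then obtain W where W: "\<kappa> = torus_chart \<Gamma> W" "open W" "inj_on (orbit \<Gamma>) W" unfolding charts_torus by blast
  have "inv_into W (orbit \<Gamma>) ` (orbit \<Gamma> ` W) = W" using W(3) by (rule inv_into_image_cancel) simp
  then show "inj_on (coord \<kappa>) (cdom \<kappa>) \<and> open (coord \<kappa> ` cdom \<kappa>)"
    using W(2,3) unfolding W(1) torus_chart_def by (simp add: inj_on_inv_into)
qed

text \<open>In the charts of the tori, a map covered by a linear map is this linear map followed by a
  translation by a lattice vector, which is locally constant.\<close>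

lemma torus_map_rep:
  fixes A :: "real^'n::finite \<Rightarrow> real^'n"
  assumes \<Gamma>: "discrete_subgroup \<Gamma>" and \<Gamma>': "discrete_subgroup \<Gamma>'"
    and A: "linear A" and F: "\<And>x. F (orbit \<Gamma> x) = orbit \<Gamma>' (A x)"
    and \<kappa>: "\<kappa> \<in> charts (quotient_torus \<Gamma>)" and \<kappa>': "\<kappa>' \<in> charts (quotient_torus \<Gamma>')"
    and x: "x \<in> rep_dom \<kappa> F \<kappa>'"
  shows "\<exists>U a. open U \<and> x \<in> U \<and> U \<subseteq> rep_dom \<kappa> F \<kappa>' \<and> (\<forall>y\<in>U. rep \<kappa> F \<kappa>' y = A y + a)"
proof -
  obtain W where W: "\<kappa> = torus_chart \<Gamma> W" "open W" "inj_on (orbit \<Gamma>) W" using \<kappa> unfolding charts_torus by blast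
  obtain W' where W': "\<kappa>' = torus_chart \<Gamma>' W'" "open W'" "inj_on (orbit \<Gamma>') W'" using \<kappa>' unfolding charts_torus by blast
  obtain x' where x': "x' \<in> W" "F (orbit \<Gamma> x') \<in> orbit \<Gamma>' ` W'" "x = coord \<kappa> (orbit \<Gamma> x')"
    using x unfolding rep_dom_def W(1) W'(1) cdom_torus_chart by blast
  have xx: "x = x'" using x'(3) coord_torus_chart[OF W(3) x'(1)] W(1) by simp
  obtain w where w: "w \<in> W'" "orbit \<Gamma>' (A x) = orbit \<Gamma>' w" using x'(2) unfolding F xx by blast
  define a where "a = w - A x"
  have a: "a \<in> \<Gamma>'" using w(2) unfolding orbit_eq_iff[OF \<Gamma>'] a_def .
  define U where "U = W \<inter> (\<lambda>y. A y + a) -` W'"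
  have "open U"
    unfolding U_def
    by (intro open_Int W(2) open_vimage W'(2) continuous_intros linear_continuous_on linear_conv_bounded_linear[THEN iffD1] A)
  moreover have "x \<in> U" using x'(1) w(1) by (simp add: U_def xx[symmetric] a_def)
  moreover have "y \<in> rep_dom \<kappa> F \<kappa>' \<and> rep \<kappa> F \<kappa>' y = A y + a" if "y \<in> U" for y
  proof -
    have y: "y \<in> W" "A y + a \<in> W'" using that by (simp_all add: U_def)
    have yc: "y = coord \<kappa> (orbit \<Gamma> y)" using coord_torus_chart[OF W(3) y(1)] W(1) by simp
    have yd: "orbit \<Gamma> y \<in> cdom \<kappa>" using y(1) W(1) by simp
    have Fy: "coord \<kappa>' (F (orbit \<Gamma> y)) = A y + a" "F (orbit \<Gamma> y) \<in> cdom \<kappa>'"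
      unfolding F W'(1) cdom_torus_chart by (rule coord_torus_chart_translate[OF \<Gamma>' a W'(3) y(2)])+
    have "y \<in> rep_dom \<kappa> F \<kappa>'"
      using in_rep_dom_iff[OF chart_regular_torus \<kappa> yd, of F \<kappa>'] Fy(2) yc by simp
    moreover have "rep \<kappa> F \<kappa>' y = A y + a"
      using rep_coord[OF chart_regular_torus \<kappa> yd, of F \<kappa>'] Fy(1) yc by simp
    ultimately show ?thesis ..
  qed
  ultimately show ?thesis by (intro exI[of _ U] exI[of _ a]) blast
qed

lemma torus_map_smooth:
  fixes A :: "real^'n::finite \<Rightarrow> real^'n"
  assumes \<Gamma>: "discrete_subgroup \<Gamma>" and \<Gamma>': "discrete_subgroup \<Gamma>'"
    and A: "linear A" and F: "\<And>x. F (orbit \<Gamma> x) = orbit \<Gamma>' (A x)"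
  shows "smooth_map (quotient_torus \<Gamma>) (quotient_torus \<Gamma>') F"
  unfolding smooth_map_def
proof (intro conjI ballI)
  show "F ` points (quotient_torus \<Gamma>) \<subseteq> points (quotient_torus \<Gamma>')"
    unfolding points_torus[OF \<Gamma>] points_torus[OF \<Gamma>'] using F by auto
  fix \<kappa> \<kappa>' assume \<kappa>: "\<kappa> \<in> charts (quotient_torus \<Gamma>)" "\<kappa>' \<in> charts (quotient_torus \<Gamma>')"
  note loc = torus_map_rep[OF \<Gamma> \<Gamma>' A F \<kappa>]
  have A': "bounded_linear A" using A by (simp add: linear_conv_bounded_linear)
  have loc': "\<exists>U. open U \<and> x \<in> U \<and> U \<subseteq> rep_dom \<kappa> F \<kappa>' \<and> smooth_on (rep \<kappa> F \<kappa>') U"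
    if x: "x \<in> rep_dom \<kappa> F \<kappa>'" for x
  proof -
    obtain U a where U: "open U" "x \<in> U" "U \<subseteq> rep_dom \<kappa> F \<kappa>'" "\<forall>y\<in>U. rep \<kappa> F \<kappa>' y = A y + a"
      using loc[OF x] by (elim exE conjE)
    have "smooth_on (rep \<kappa> F \<kappa>') U \<longleftrightarrow> smooth_on (\<lambda>y. A y + a) U"
      by (rule smooth_on_cong[OF U(1)]) (rule U(4)[rule_format])
    then have "smooth_on (rep \<kappa> F \<kappa>') U" using smooth_on_affine[OF A', of a U] by simp
    then show ?thesis using U(1-3) by (intro exI[of _ U] conjI)
  qed
  show "open (rep_dom \<kappa> F \<kappa>')"
    by (subst open_subopen) (use loc' in blast)
  show "smooth_on (rep \<kappa> F \<kappa>') (rep_dom \<kappa> F \<kappa>')"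
    by (rule smooth_on_local) (use loc' in blast)
qed

lemma torus_map_drep:
  fixes A :: "real^'n::finite \<Rightarrow> real^'n"
  assumes \<Gamma>: "discrete_subgroup \<Gamma>" and \<Gamma>': "discrete_subgroup \<Gamma>'"
    and A: "linear A" and F: "\<And>x. F (orbit \<Gamma> x) = orbit \<Gamma>' (A x)"
    and \<kappa>: "\<kappa> \<in> charts (quotient_torus \<Gamma>)" "p \<in> cdom \<kappa>"
    and \<kappa>': "\<kappa>' \<in> charts (quotient_torus \<Gamma>')" "F p \<in> cdom \<kappa>'"
  shows "drep \<kappa> F \<kappa>' p = A"
proof -
  have cp: "coord \<kappa> p \<in> rep_dom \<kappa> F \<kappa>'"
    using in_rep_dom_iff[OF chart_regular_torus \<kappa>, of F \<kappa>'] \<kappa>'(2) by simp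
  obtain U a where U: "open U" "coord \<kappa> p \<in> U" "\<forall>y\<in>U. rep \<kappa> F \<kappa>' y = A y + a"
    using torus_map_rep[OF \<Gamma> \<Gamma>' A F \<kappa>(1) \<kappa>'(1) cp] by (elim exE conjE)
  have "drep \<kappa> F \<kappa>' p = frechet_derivative (\<lambda>y. A y + a) (at (coord \<kappa> p))"
    unfolding drep_def by (rule frechet_derivative_cong_open[OF U(1,2)]) (rule U(3)[rule_format])
  moreover have "((\<lambda>y. A y + a) has_derivative A) (at (coord \<kappa> p))"
    using has_derivative_add[OF linear_imp_has_derivative[OF A] has_derivative_const] by simp
  ultimately show ?thesis using frechet_derivative_at[of "\<lambda>y. A y + a" A] by simp
qed

text \<open>The similarity descends to the quotients, and rescaling the metric of the target makes it an
  isometry.\<close>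

theorem similar_tori_isometric:
  fixes A :: "real^'n::finite \<Rightarrow> real^'n"
  assumes \<Gamma>: "discrete_subgroup \<Gamma>" and \<Gamma>': "discrete_subgroup \<Gamma>'"
    and A: "linear A" and inner: "\<And>x y. A x \<bullet> A y = Q * (x \<bullet> y)" and Q: "Q > 0" and A\<Gamma>: "A ` \<Gamma> = \<Gamma>'"
  shows "isometric (quotient_torus \<Gamma>) (rescale (1 / Q) (quotient_torus \<Gamma>'))"
proof -
  have "inj A"
  proof (subst linear_injective_0[OF A], intro allI impI)
    fix x assume "A x = 0"
    then have "Q * (x \<bullet> x) = 0" using inner[of x x] by simp
    then show "x = 0" using Q by simp
  qed
  then obtain B where B: "linear B" "\<And>x. B (A x) = x" "\<And>x. A (B x) = x"
    using linear_injective_isomorphism[OF A] by blast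
  have B\<Gamma>: "B ` \<Gamma>' = \<Gamma>" unfolding A\<Gamma>[symmetric] image_image B(2) by simp
  define F G where "F = image A" and "G = image B"
  have F: "F (orbit \<Gamma> x) = orbit \<Gamma>' (A x)" for x
    unfolding F_def orbit_def A\<Gamma>[symmetric] image_image linear_add[OF A] ..
  have G: "G (orbit \<Gamma>' x) = orbit \<Gamma> (B x)" for x
    unfolding G_def orbit_def B\<Gamma>[symmetric] image_image linear_add[OF B(1)] ..
  have GF: "G (F p) = p" for p unfolding F_def G_def image_image B(2) by simp
  have FG: "F (G p) = p" for p unfolding F_def G_def image_image B(3) by simp
  let ?T = "quotient_torus \<Gamma>" and ?T' = "quotient_torus \<Gamma>'"
  have sF: "smooth_map ?T ?T' F" by (rule torus_map_smooth[OF \<Gamma> \<Gamma>' A F])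
  have sG: "smooth_map ?T' ?T G" by (rule torus_map_smooth[OF \<Gamma>' \<Gamma> B(1) G])
  have bij: "bij_betw F (points ?T) (points ?T')"
    using sF sG by (intro bij_betw_byWitness[where f' = G]) (simp_all add: GF FG smooth_map_def)
  have sG': "smooth_map ?T' ?T (inv_into (points ?T) F)"
  proof (rule smooth_map_cong[OF chart_regular_torus _ sG])
    fix q assume "q \<in> points ?T'"
    then have "G q \<in> points ?T" using sG by (auto simp: smooth_map_def)
    then show "G q = inv_into (points ?T) F q"
      using inv_into_f_f[OF bij_betw_imp_inj_on[OF bij], of "G q"] FG by simp
  qed
  have "isometry ?T (rescale (1 / Q) ?T') F"
    unfolding isometry_def
  proof (intro conjI ballI allI)
    show "bij_betw F (points ?T) (points (rescale (1 / Q) ?T'))" using bij by simp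
    show "smooth_map ?T (rescale (1 / Q) ?T') F" using sF by (simp add: smooth_map_def)
    show "smooth_map (rescale (1 / Q) ?T') ?T (inv_into (points ?T) F)" using sG' by (simp add: smooth_map_def)
    fix p \<kappa> \<kappa>' u w assume p: "p \<in> points ?T" "\<kappa> \<in> charts_at ?T p" "\<kappa>' \<in> charts_at (rescale (1 / Q) ?T') (F p)"
    have "drep \<kappa> F \<kappa>' p = A"
      by (rule torus_map_drep[OF \<Gamma> \<Gamma>' A F]) (use p in \<open>simp_all add: charts_at_def\<close>)
    then show "ginner (rescale (1 / Q) ?T') \<kappa>' (F p) (drep \<kappa> F \<kappa>' p u) (drep \<kappa> F \<kappa>' p w) = ginner ?T \<kappa> p u w"
      using Q by (simp add: ginner_rescale ginner_torus inner)
  qed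
  then show ?thesis unfolding isometric_def by (rule exI[of _ F])
qed

section \<open>Geodesics of a manifold that is locally isometric to Euclidean space\<close>

lemma has_vector_derivative_along_curve:
  assumes "(f has_derivative D) (at (y t))" "(y has_vector_derivative v) (at t)"
  shows "((\<lambda>s. f (y s)) has_vector_derivative D v) (at t)"
proof -
  have "((\<lambda>s. f (y s)) has_derivative (\<lambda>s. D (s *\<^sub>R v))) (at t)"
    using assms(2,1) unfolding has_vector_derivative_def by (rule has_derivative_compose)
  moreover have "D (s *\<^sub>R v) = s *\<^sub>R D v" for s
    using linear_scale[OF has_derivative_linear[OF assms(1)]] .
  ultimately show ?thesis by (simp add: has_vector_derivative_def)
qed

lemma has_derivative_line:
  assumes "(f has_derivative D) (at (x + s *\<^sub>R a))"
  shows "((\<lambda>s. f (x + s *\<^sub>R a)) has_vector_derivative D a) (at s)"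
proof (rule has_vector_derivative_along_curve[where y = "\<lambda>s. x + s *\<^sub>R a" and t = s])
  show "(f has_derivative D) (at (x + s *\<^sub>R a))" by (rule assms)
  have "((\<lambda>s. x + s *\<^sub>R a) has_derivative (\<lambda>s. s *\<^sub>R a)) (at s)"
    by (auto intro!: derivative_eq_intros)
  then show "((\<lambda>s. x + s *\<^sub>R a) has_vector_derivative a) (at s)" by (simp add: has_vector_derivative_def)
qed

text \<open>The mean value theorem, first in direction \<open>a\<close> and then in direction
  \<open>b\<close>.\<close>

lemma second_difference:
  fixes f :: "'a::real_normed_vector \<Rightarrow> real"
  assumes f: "smooth_on f S" and h: "h > 0"
    and S: "\<And>s t. 0 \<le> s \<Longrightarrow> s \<le> h \<Longrightarrow> 0 \<le> t \<Longrightarrow> t \<le> h \<Longrightarrow> x + s *\<^sub>R a + t *\<^sub>R b \<in> S"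
  shows "\<exists>s t. 0 < s \<and> s < h \<and> 0 < t \<and> t < h \<and>
    f (x + h *\<^sub>R a + h *\<^sub>R b) - f (x + h *\<^sub>R a) - (f (x + h *\<^sub>R b) - f x)
      = h * (h * frechet_derivative (\<lambda>y. frechet_derivative f (at y) a) (at (x + s *\<^sub>R a + t *\<^sub>R b)) b)"
proof -
  define fa where "fa y = frechet_derivative f (at y) a" for y
  have fa: "smooth_on fa S" unfolding fa_def by (rule smooth_on_derivative[OF f])
  have d1: "((\<lambda>s. f (c + s *\<^sub>R a)) has_vector_derivative fa (c + s *\<^sub>R a)) (at s)" if "c + s *\<^sub>R a \<in> S" for c s
    unfolding fa_def by (rule has_derivative_line[OF smooth_on_has_derivative[OF f that]])
  have d2: "((\<lambda>t. fa (c + t *\<^sub>R b)) has_vector_derivative frechet_derivative fa (at (c + t *\<^sub>R b)) b) (at t)"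
    if "c + t *\<^sub>R b \<in> S" for c t
    by (rule has_derivative_line[OF smooth_on_has_derivative[OF fa that]])
  define \<phi> where "\<phi> s = f ((x + h *\<^sub>R b) + s *\<^sub>R a) - f (x + s *\<^sub>R a)" for s
  have D1: "DERIV \<phi> s :> fa ((x + h *\<^sub>R b) + s *\<^sub>R a) - fa (x + s *\<^sub>R a)" if "0 \<le> s" "s \<le> h" for s
  proof -
    have "(x + h *\<^sub>R b) + s *\<^sub>R a \<in> S" "x + s *\<^sub>R a \<in> S"
      using S[of s h] S[of s 0] that h by (simp_all add: algebra_simps)
    then show ?thesis
      unfolding \<phi>_def has_real_derivative_iff_has_vector_derivative
      by (intro has_vector_derivative_diff d1)
  qed
  have "\<exists>s>0. s < h \<and> \<phi> h - \<phi> 0 = (h - 0) * (fa ((x + h *\<^sub>R b) + s *\<^sub>R a) - fa (x + s *\<^sub>R a))"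
    by (rule MVT2[OF h]) (rule D1)
  then obtain s where s: "0 < s" "s < h"
    "\<phi> h - \<phi> 0 = (h - 0) * (fa ((x + h *\<^sub>R b) + s *\<^sub>R a) - fa (x + s *\<^sub>R a))"
    by (elim exE conjE)
  have D2: "DERIV (\<lambda>t. fa ((x + s *\<^sub>R a) + t *\<^sub>R b)) t :> frechet_derivative fa (at ((x + s *\<^sub>R a) + t *\<^sub>R b)) b"
    if "0 \<le> t" "t \<le> h" for t
    unfolding has_real_derivative_iff_has_vector_derivative
    using S[of s t] that s by (intro d2) simp
  have "\<exists>t>0. t < h \<and> fa ((x + s *\<^sub>R a) + h *\<^sub>R b) - fa ((x + s *\<^sub>R a) + 0 *\<^sub>R b)
      = (h - 0) * frechet_derivative fa (at ((x + s *\<^sub>R a) + t *\<^sub>R b)) b"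
    by (rule MVT2[OF h]) (rule D2)
  then obtain t where t: "0 < t" "t < h"
    "fa ((x + s *\<^sub>R a) + h *\<^sub>R b) - fa ((x + s *\<^sub>R a) + 0 *\<^sub>R b)
      = (h - 0) * frechet_derivative fa (at ((x + s *\<^sub>R a) + t *\<^sub>R b)) b"
    by (elim exE conjE)
  have swap: "(x + h *\<^sub>R b) + s *\<^sub>R a = (x + s *\<^sub>R a) + h *\<^sub>R b" by simp
  have "\<phi> h - \<phi> 0 = h * (h * frechet_derivative fa (at (x + s *\<^sub>R a + t *\<^sub>R b)) b)"
    using s(3) t(3) unfolding swap by simp
  moreover have "\<phi> h - \<phi> 0 = f (x + h *\<^sub>R a + h *\<^sub>R b) - f (x + h *\<^sub>R a) - (f (x + h *\<^sub>R b) - f x)"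
    by (simp add: \<phi>_def algebra_simps)
  ultimately show ?thesis
    using s(1,2) t(1,2) unfolding fa_def by (intro exI[of _ s] exI[of _ t]) simp
qed

text \<open>The second difference is symmetric in the two directions. Divided by \<open>h * h\<close>, it is a value of each
  of the two mixed derivatives at points that tend to \<open>x\<close> with \<open>h\<close>.\<close>

lemma second_derivative_symmetric_real:
  fixes f :: "'a::real_normed_vector \<Rightarrow> real"
  assumes f: "smooth_on f S" and S: "open S" "x \<in> S"
  shows "frechet_derivative (\<lambda>y. frechet_derivative f (at y) a) (at x) b
    = frechet_derivative (\<lambda>y. frechet_derivative f (at y) b) (at x) a"
proof -
  define fab where "fab y = frechet_derivative (\<lambda>y. frechet_derivative f (at y) a) (at y) b" for y
  define fba where "fba y = frechet_derivative (\<lambda>y. frechet_derivative f (at y) b) (at y) a" for y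
  have cont: "isCont fab x" "isCont fba x"
    using smooth_on_continuous[OF smooth_on_derivative[OF smooth_on_derivative[OF f, of a], of b]]
      smooth_on_continuous[OF smooth_on_derivative[OF smooth_on_derivative[OF f, of b], of a]] S
    unfolding fab_def fba_def by (simp_all add: continuous_on_eq_continuous_at)
  have le: "\<bar>fab x - fba x\<bar> \<le> 2 * e" if e: "e > 0" for e
  proof -
    obtain d1 where d1: "d1 > 0" "\<And>y. dist y x < d1 \<Longrightarrow> dist (fab y) (fab x) < e"
      using cont(1) e unfolding continuous_at_eps_delta by metis
    obtain d2 where d2: "d2 > 0" "\<And>y. dist y x < d2 \<Longrightarrow> dist (fba y) (fba x) < e"
      using cont(2) e unfolding continuous_at_eps_delta by metis
    obtain d3 where d3: "d3 > 0" "ball x d3 \<subseteq> S" using S openE by metis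
    define d where "d = min d1 (min d2 d3)"
    have d: "d > 0" "d \<le> d1" "d \<le> d2" "d \<le> d3" using d1(1) d2(1) d3(1) by (simp_all add: d_def)
    define K where "K = norm a + norm b + 1"
    have K: "K > 0" unfolding K_def using norm_ge_zero[of a] norm_ge_zero[of b] by linarith
    define h where "h = d / K"
    have h: "h > 0" "h * K = d" using d(1) K by (simp_all add: h_def)
    have near: "dist (x + s *\<^sub>R a + t *\<^sub>R b) x < d" if "0 \<le> s" "s \<le> h" "0 \<le> t" "t \<le> h" for s t
    proof -
      have "dist (x + s *\<^sub>R a + t *\<^sub>R b) x = norm (s *\<^sub>R a + t *\<^sub>R b)" by (simp add: dist_norm)
      also have "\<dots> \<le> s * norm a + t * norm b"
        using norm_triangle_ineq[of "s *\<^sub>R a" "t *\<^sub>R b"] that by simp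
      also have "\<dots> \<le> h * norm a + h * norm b" using that by (intro add_mono mult_right_mono) auto
      also have "\<dots> < h * K" using h(1) by (simp add: K_def algebra_simps)
      finally show ?thesis using h(2) by simp
    qed
    have inS: "x + s *\<^sub>R a + t *\<^sub>R b \<in> S" if "0 \<le> s" "s \<le> h" "0 \<le> t" "t \<le> h" for s t
      using near[OF that] d(4) d3(2) by (auto simp: dist_commute subset_iff)
    have inS': "x + s *\<^sub>R b + t *\<^sub>R a \<in> S" if "0 \<le> s" "s \<le> h" "0 \<le> t" "t \<le> h" for s t
      using inS[OF that(3,4,1,2)] by (simp add: algebra_simps)
    have exfab: "\<exists>s t. 0 < s \<and> s < h \<and> 0 < t \<and> t < h \<and> f (x + h *\<^sub>R a + h *\<^sub>R b) - f (x + h *\<^sub>R a) - (f (x + h *\<^sub>R b) - f x)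
        = h * (h * fab (x + s *\<^sub>R a + t *\<^sub>R b))"
      unfolding fab_def by (rule second_difference[OF f h(1)]) (rule inS)
    obtain s t where st: "0 < s" "s < h" "0 < t" "t < h"
      "f (x + h *\<^sub>R a + h *\<^sub>R b) - f (x + h *\<^sub>R a) - (f (x + h *\<^sub>R b) - f x)
        = h * (h * fab (x + s *\<^sub>R a + t *\<^sub>R b))"
      using exfab by (elim exE conjE)
    have exfba: "\<exists>s' t'. 0 < s' \<and> s' < h \<and> 0 < t' \<and> t' < h \<and> f (x + h *\<^sub>R b + h *\<^sub>R a) - f (x + h *\<^sub>R b) - (f (x + h *\<^sub>R a) - f x)
        = h * (h * fba (x + s' *\<^sub>R b + t' *\<^sub>R a))"
      unfolding fba_def by (rule second_difference[OF f h(1)]) (rule inS')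
    obtain s' t' where st': "0 < s'" "s' < h" "0 < t'" "t' < h"
      "f (x + h *\<^sub>R b + h *\<^sub>R a) - f (x + h *\<^sub>R b) - (f (x + h *\<^sub>R a) - f x)
        = h * (h * fba (x + s' *\<^sub>R b + t' *\<^sub>R a))"
      using exfba by (elim exE conjE)
    have "h * (h * fab (x + s *\<^sub>R a + t *\<^sub>R b)) = h * (h * fba (x + s' *\<^sub>R b + t' *\<^sub>R a))"
      unfolding st(5)[symmetric] st'(5)[symmetric] by (simp add: algebra_simps)
    then have eq: "fab (x + s *\<^sub>R a + t *\<^sub>R b) = fba (x + t' *\<^sub>R a + s' *\<^sub>R b)"
      using h(1) by (simp add: algebra_simps)
    have "dist (fab (x + s *\<^sub>R a + t *\<^sub>R b)) (fab x) < e"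
      using near[of s t] st d by (intro d1(2)) simp
    moreover have "dist (fba (x + t' *\<^sub>R a + s' *\<^sub>R b)) (fba x) < e"
      using near[of t' s'] st' d by (intro d2(2)) simp
    ultimately show ?thesis unfolding eq dist_real_def by linarith
  qed
  have "\<bar>fab x - fba x\<bar> \<le> 0 + e" if "e > 0" for e using that le[of "e / 2"] by simp
  then have "\<bar>fab x - fba x\<bar> \<le> 0" by (rule field_le_epsilon)
  then show ?thesis by (simp add: fab_def fba_def)
qed

lemma second_derivative_symmetric:
  fixes f :: "'a::real_normed_vector \<Rightarrow> 'b::euclidean_space"
  assumes f: "smooth_on f S" and S: "open S" "x \<in> S"
  shows "frechet_derivative (\<lambda>y. frechet_derivative f (at y) a) (at x) b
    = frechet_derivative (\<lambda>y. frechet_derivative f (at y) b) (at x) a"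
proof (rule euclidean_eqI)
  fix e :: 'b assume "e \<in> Basis"
  define g where "g = (\<lambda>y. f y \<bullet> e)"
  have inner: "frechet_derivative (\<lambda>z. F z \<bullet> e) (at y) v = frechet_derivative F (at y) v \<bullet> e"
    if F: "smooth_on F S" and y: "y \<in> S" for F :: "'a \<Rightarrow> 'b" and y v
  proof -
    have "((\<lambda>z. F z \<bullet> e) has_derivative (\<lambda>v. frechet_derivative F (at y) v \<bullet> e)) (at y)"
      by (rule bounded_linear.has_derivative[OF bounded_linear_inner_left smooth_on_has_derivative[OF F y]])
    from fun_cong[OF frechet_derivative_at[OF this], of v] show ?thesis by (rule sym)
  qed
  have g: "smooth_on g S"
    using f Ck_on_bounded_linear[OF bounded_linear_inner_left S(1)] unfolding smooth_on_def g_def by blast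
  have "frechet_derivative (\<lambda>y. frechet_derivative g (at y) a) (at x) b
      = frechet_derivative (\<lambda>y. frechet_derivative f (at y) a) (at x) b \<bullet> e" for a b
  proof -
    have "frechet_derivative (\<lambda>y. frechet_derivative g (at y) a) (at x)
        = frechet_derivative (\<lambda>y. frechet_derivative f (at y) a \<bullet> e) (at x)"
      by (rule frechet_derivative_cong_open[OF S]) (unfold g_def, rule inner[OF f])
    then show ?thesis by (simp add: inner[OF smooth_on_derivative[OF f] S(2)])
  qed
  then show "frechet_derivative (\<lambda>y. frechet_derivative f (at y) a) (at x) b \<bullet> e
    = frechet_derivative (\<lambda>y. frechet_derivative f (at y) b) (at x) a \<bullet> e"
    using second_derivative_symmetric_real[OF g S, of a b] by simp
qed

lemma vec_sum_axis: "(\<Sum>i\<in>UNIV. (v $ i) *\<^sub>R axis i (1::real)) = v"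
  by (simp add: vec_eq_iff axis_def if_distrib[of "\<lambda>c. _ * c"] cong: if_cong)

lemma linear_axis:
  fixes L :: "real^'n \<Rightarrow> 'b::real_vector"
  assumes "linear L"
  shows "L v = (\<Sum>i\<in>UNIV. (v $ i) *\<^sub>R L (axis i 1))"
proof -
  have "L v = L (\<Sum>i\<in>UNIV. (v $ i) *\<^sub>R axis i 1)" unfolding vec_sum_axis ..
  also have "\<dots> = (\<Sum>i\<in>UNIV. (v $ i) *\<^sub>R L (axis i 1))"
    unfolding linear_sum[OF assms] linear_scale[OF assms] ..
  finally show ?thesis .
qed

lemma derivative_along_linear:
  fixes f :: "real^'n::finite \<Rightarrow> 'b::euclidean_space"
  assumes f: "smooth_on f S" and S: "open S" "x \<in> S"
  shows "frechet_derivative (\<lambda>y. frechet_derivative f (at y) v) (at x) w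
    = (\<Sum>i\<in>UNIV. (v $ i) *\<^sub>R frechet_derivative (\<lambda>y. frechet_derivative f (at y) (axis i 1)) (at x) w)"
proof -
  have lin: "linear (frechet_derivative f (at y))" if "y \<in> S" for y
    by (rule has_derivative_linear[OF smooth_on_has_derivative[OF f that]])
  have "frechet_derivative (\<lambda>y. frechet_derivative f (at y) v) (at x)
      = frechet_derivative (\<lambda>y. \<Sum>i\<in>UNIV. (v $ i) *\<^sub>R frechet_derivative f (at y) (axis i 1)) (at x)"
    by (rule frechet_derivative_cong_open[OF S]) (rule linear_axis[OF lin])
  moreover have "((\<lambda>y. \<Sum>i\<in>UNIV. (v $ i) *\<^sub>R frechet_derivative f (at y) (axis i 1)) has_derivative
      (\<lambda>w. \<Sum>i\<in>UNIV. (v $ i) *\<^sub>R frechet_derivative (\<lambda>y. frechet_derivative f (at y) (axis i 1)) (at x) w)) (at x)"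
    by (intro has_derivative_sum has_derivative_scaleR_right smooth_on_has_derivative[OF smooth_on_derivative[OF f] S(2)])
  from fun_cong[OF frechet_derivative_at[OF this], of w]
  have "frechet_derivative (\<lambda>y. \<Sum>i\<in>UNIV. (v $ i) *\<^sub>R frechet_derivative f (at y) (axis i 1)) (at x) w
    = (\<Sum>i\<in>UNIV. (v $ i) *\<^sub>R frechet_derivative (\<lambda>y. frechet_derivative f (at y) (axis i 1)) (at x) w)"
    by (rule sym)
  ultimately show ?thesis by simp
qed

text \<open>If the metric is pulled back from Euclidean space by \<open>f\<close>, then
  \<open>\<partial>\<^sub>l g\<^sub>i\<^sub>j = (\<partial>\<^sub>l \<partial>\<^sub>i f)
  \<bullet> \<partial>\<^sub>j f + \<partial>\<^sub>i f \<bullet> (\<partial>\<^sub>l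
  \<partial>\<^sub>j f)\<close>. In the combination that defines the Christoffel symbols
  everything cancels by the symmetry of second derivatives, except \<open>2 (\<partial>\<^sub>i
  \<partial>\<^sub>j f) \<bullet> \<partial>\<^sub>l f\<close>; the inverse metric then turns
  this into the preimage of \<open>\<partial>\<^sub>i \<partial>\<^sub>j f\<close> under the
  differential of \<open>f\<close>.\<close>

lemma christoffel_pullback:
  fixes f :: "real^'n::finite \<Rightarrow> real^'n" and M :: "('a, 'n) riemannian"
  assumes f: "smooth_on f S" and S: "open S" "x \<in> S"
    and g: "\<And>y u w. y \<in> S \<Longrightarrow> u \<bullet> (gmat M \<kappa> y *v w) = frechet_derivative f (at y) u \<bullet> frechet_derivative f (at y) w"
    and inj: "\<And>u. frechet_derivative f (at x) u = 0 \<Longrightarrow> u = 0"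
  shows "frechet_derivative f (at x)
      (\<chi> k. \<Sum>i\<in>UNIV. \<Sum>j\<in>UNIV. christoffel M \<kappa> x k i j * c $ i * c $ j)
    = frechet_derivative (\<lambda>y. frechet_derivative f (at y) c) (at x) c"
proof -
  define P where "P v = frechet_derivative f (at x) v" for v
  define B where "B v w = frechet_derivative (\<lambda>y. frechet_derivative f (at y) v) (at x) w" for v w
  define e :: "'n \<Rightarrow> real^'n" where "e i = axis i 1" for i
  define G where "G = gmat M \<kappa> x"
  have linP: "linear P" unfolding P_def
    by (rule has_derivative_linear[OF smooth_on_has_derivative[OF f S(2)]])
  have Bsym: "B v w = B w v" for v w
    unfolding B_def by (rule second_derivative_symmetric[OF f S])
  have BR: "B v w = (\<Sum>i\<in>UNIV. (v $ i) *\<^sub>R B (e i) w)" for v w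
    unfolding B_def e_def by (rule derivative_along_linear[OF f S])
  have Gax: "gmat M \<kappa> y $ i $ j = e i \<bullet> (gmat M \<kappa> y *v e j)" for y i j
    by (simp add: e_def matrix_vector_mult_basis column_def inner_axis')
  define dg where "dg l i j = frechet_derivative (\<lambda>y. gmat M \<kappa> y $ i $ j) (at x) (axis l 1)" for l i j
  have dg: "dg l i j = B (e i) (e l) \<bullet> P (e j) + P (e i) \<bullet> B (e j) (e l)" for l i j
  proof -
    have 1: "frechet_derivative (\<lambda>y. gmat M \<kappa> y $ i $ j) (at x)
        = frechet_derivative (\<lambda>y. frechet_derivative f (at y) (e i) \<bullet> frechet_derivative f (at y) (e j)) (at x)"
      by (rule frechet_derivative_cong_open[OF S]) (simp add: Gax g)
    have "((\<lambda>y. frechet_derivative f (at y) (e i) \<bullet> frechet_derivative f (at y) (e j)) has_derivative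
        (\<lambda>v. P (e i) \<bullet> B (e j) v + B (e i) v \<bullet> P (e j))) (at x)"
      unfolding P_def B_def
      by (intro has_derivative_inner smooth_on_has_derivative[OF smooth_on_derivative[OF f] S(2)])
    from fun_cong[OF frechet_derivative_at[OF this], of "e l"] show ?thesis
      unfolding dg_def 1 e_def by (simp add: add.commute)
  qed
  have ch: "christoffel M \<kappa> x k i j = (\<Sum>l\<in>UNIV. matrix_inv G $ k $ l * (B (e i) (e j) \<bullet> P (e l)))" for k i j
  proof -
    have s: "dg i j l + dg j i l - dg l i j = 2 * (B (e i) (e j) \<bullet> P (e l))" for l
      unfolding dg Bsym[of "e l"] Bsym[of "e j" "e i"]
      by (simp add: inner_commute[of "P (e j)"] inner_commute[of "P (e i)"])
    have "christoffel M \<kappa> x k i j = 1 / 2 * (\<Sum>l\<in>UNIV. matrix_inv G $ k $ l * (dg i j l + dg j i l - dg l i j))"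
      unfolding christoffel_def Let_def dg_def G_def ..
    then show ?thesis unfolding s by (simp add: sum_distrib_left)
  qed
  define t :: "real^'n" where "t = (\<chi> l. B c c \<bullet> P (e l))"
  define w :: "real^'n" where "w = (\<chi> k. \<Sum>i\<in>UNIV. \<Sum>j\<in>UNIV. christoffel M \<kappa> x k i j * c $ i * c $ j)"
  have Bcc: "B c c = (\<Sum>i\<in>UNIV. \<Sum>j\<in>UNIV. (c $ i * c $ j) *\<^sub>R B (e i) (e j))"
  proof -
    have "B (e i) c = (\<Sum>j\<in>UNIV. (c $ j) *\<^sub>R B (e i) (e j))" for i
      unfolding Bsym[of "e i"] by (rule BR)
    then show ?thesis unfolding BR[of c c] by (simp add: scaleR_sum_right)
  qed
  have "w = matrix_inv G *v t"
  proof (subst vec_eq_iff, rule allI)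
    fix k
    have "w $ k = (\<Sum>i\<in>UNIV. \<Sum>j\<in>UNIV. \<Sum>l\<in>UNIV. matrix_inv G $ k $ l * ((c $ i * c $ j) * (B (e i) (e j) \<bullet> P (e l))))"
      unfolding w_def ch by (simp add: sum_distrib_left sum_distrib_right algebra_simps)
    also have "\<dots> = (\<Sum>i\<in>UNIV. \<Sum>l\<in>UNIV. \<Sum>j\<in>UNIV. matrix_inv G $ k $ l * ((c $ i * c $ j) * (B (e i) (e j) \<bullet> P (e l))))"
      by (intro sum.cong refl sum.swap)
    also have "\<dots> = (\<Sum>l\<in>UNIV. \<Sum>i\<in>UNIV. \<Sum>j\<in>UNIV. matrix_inv G $ k $ l * ((c $ i * c $ j) * (B (e i) (e j) \<bullet> P (e l))))"
      by (rule sum.swap)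
    also have "\<dots> = (matrix_inv G *v t) $ k"
      unfolding matrix_vector_mult_def t_def Bcc by (simp add: inner_sum_left sum_distrib_left)
    finally show "w $ k = (matrix_inv G *v t) $ k" .
  qed
  moreover have "invertible G"
    unfolding invertible_left_inverse matrix_left_invertible_ker
  proof (intro allI impI)
    fix u assume "G *v u = 0"
    then have "P u \<bullet> P u = 0" using g[OF S(2), of u u] by (simp add: P_def G_def)
    then show "u = 0" using inj by (simp add: P_def)
  qed
  then have "\<exists>A. G ** A = mat 1 \<and> A ** G = mat 1" unfolding invertible_def .
  then have "G ** matrix_inv G = mat 1 \<and> matrix_inv G ** G = mat 1" unfolding matrix_inv_def by (rule someI_ex)
  then have "G ** matrix_inv G = mat 1" ..
  ultimately have Gw: "G *v w = t" by (simp add: matrix_vector_mul_assoc)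
  have "P (e l) \<bullet> (P w - B c c) = 0" for l
  proof -
    have "P (e l) \<bullet> P w = e l \<bullet> (G *v w)" using g[OF S(2), of "e l" w] by (simp add: P_def G_def)
    also have "\<dots> = B c c \<bullet> P (e l)" unfolding Gw by (simp add: t_def e_def inner_axis')
    finally show ?thesis by (simp add: inner_diff_right inner_commute)
  qed
  then have orth: "P v \<bullet> (P w - B c c) = 0" for v
    unfolding linear_axis[OF linP, of v] by (simp add: inner_sum_left e_def)
  have "inj P" unfolding linear_injective_0[OF linP] using inj by (simp add: P_def)
  then have "surj P" by (rule linear_injective_imp_surjective[OF linP _ refl])
  then obtain v where "P v = P w - B c c" by (metis surjD)
  then have "P w - B c c = 0" using orth[of v] by simp
  then show ?thesis by (simp add: P_def B_def w_def)
qed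


text \<open>The image of a geodesic under \<open>f\<close> has second derivative \<open>D\<^sup>2 f (c, c) +
  Df c'\<close>, and the two terms cancel by the geodesic equation.\<close>

lemma geodesic_image_acceleration_free:
  fixes f :: "real^'n::finite \<Rightarrow> real^'n" and M :: "('a, 'n) riemannian"
  assumes f: "smooth_on f S" and S: "open S"
    and g: "\<And>y u w. y \<in> S \<Longrightarrow> u \<bullet> (gmat M \<kappa> y *v w) = frechet_derivative f (at y) u \<bullet> frechet_derivative f (at y) w"
    and inj: "\<And>y u. y \<in> S \<Longrightarrow> frechet_derivative f (at y) u = 0 \<Longrightarrow> u = 0"
    and V: "open V" "t \<in> V" "\<And>s. s \<in> V \<Longrightarrow> y s \<in> S"
    and y: "(y has_vector_derivative c t) (at t)"
    and c: "(c has_vector_derivative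
      (\<chi> k. - (\<Sum>i\<in>UNIV. \<Sum>j\<in>UNIV. christoffel M \<kappa> (y t) k i j * c t $ i * c t $ j))) (at t)"
  shows "((\<lambda>s. frechet_derivative f (at (y s)) (c s)) has_vector_derivative 0) (at t)"
proof -
  have yt: "y t \<in> S" by (rule V(3)[OF V(2)])
  define w :: "real^'n" where "w = (\<chi> k. \<Sum>i\<in>UNIV. \<Sum>j\<in>UNIV. christoffel M \<kappa> (y t) k i j * c t $ i * c t $ j)"
  have "(\<chi> k. - (\<Sum>i\<in>UNIV. \<Sum>j\<in>UNIV. christoffel M \<kappa> (y t) k i j * c t $ i * c t $ j)) = - w"
    by (simp add: w_def vec_eq_iff)
  then have c': "(c has_vector_derivative (- w)) (at t)" using c by simp
  have lin: "linear (frechet_derivative f (at z))" if "z \<in> S" for z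
    by (rule has_derivative_linear[OF smooth_on_has_derivative[OF f that]])
  define B where "B i = frechet_derivative (\<lambda>z. frechet_derivative f (at z) (axis i 1)) (at (y t)) (c t)" for i :: 'n
  have "((\<lambda>s. (c s $ i) *\<^sub>R frechet_derivative f (at (y s)) (axis i 1)) has_vector_derivative
      (c t $ i) *\<^sub>R B i + ((- w) $ i) *\<^sub>R frechet_derivative f (at (y t)) (axis i 1)) (at t)" for i
  proof (rule has_vector_derivative_scaleR)
    show "((\<lambda>s. c s $ i) has_real_derivative (- w) $ i) (at t)"
      unfolding has_real_derivative_iff_has_vector_derivative
      by (rule bounded_linear.has_vector_derivative[OF bounded_linear_vec_nth c'])
    show "((\<lambda>s. frechet_derivative f (at (y s)) (axis i 1)) has_vector_derivative B i) (at t)"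
      unfolding B_def
      by (rule has_vector_derivative_along_curve[where y = y and t = t, OF smooth_on_has_derivative[OF smooth_on_derivative[OF f] yt] y])
  qed
  then have "((\<lambda>s. \<Sum>i\<in>UNIV. (c s $ i) *\<^sub>R frechet_derivative f (at (y s)) (axis i 1)) has_vector_derivative
      (\<Sum>i\<in>UNIV. (c t $ i) *\<^sub>R B i + ((- w) $ i) *\<^sub>R frechet_derivative f (at (y t)) (axis i 1))) (at t)"
    by (intro has_vector_derivative_sum)
  moreover have "(\<Sum>i\<in>UNIV. (c t $ i) *\<^sub>R B i + ((- w) $ i) *\<^sub>R frechet_derivative f (at (y t)) (axis i 1)) = 0"
  proof -
    have "(\<Sum>i\<in>UNIV. (c t $ i) *\<^sub>R B i) = frechet_derivative (\<lambda>z. frechet_derivative f (at z) (c t)) (at (y t)) (c t)"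
      unfolding B_def by (rule derivative_along_linear[OF f S yt, symmetric])
    also have "\<dots> = frechet_derivative f (at (y t)) w"
      unfolding w_def by (rule christoffel_pullback[OF f S yt g inj[OF yt], symmetric])
    also have "\<dots> = (\<Sum>i\<in>UNIV. (w $ i) *\<^sub>R frechet_derivative f (at (y t)) (axis i 1))"
      by (rule linear_axis[OF lin[OF yt]])
    finally show ?thesis by (simp add: sum_subtractf)
  qed
  ultimately have *: "((\<lambda>s. \<Sum>i\<in>UNIV. (c s $ i) *\<^sub>R frechet_derivative f (at (y s)) (axis i 1)) has_vector_derivative 0) (at t)"
    by simp
  show ?thesis
    by (rule has_vector_derivative_transform_within_open[OF * V(1,2)])
      (rule linear_axis[OF lin[OF V(3)], symmetric])
qed

lemma zero_acceleration_affine: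
  fixes z u :: "real \<Rightarrow> 'e::euclidean_space"
  assumes e: "e > 0" and z: "\<And>t. t \<in> ball t0 e \<Longrightarrow> (z has_vector_derivative u t) (at t)"
    and u: "\<And>t. t \<in> ball t0 e \<Longrightarrow> (u has_vector_derivative 0) (at t)"
  shows "\<exists>a. \<forall>t\<in>ball t0 e. z t = a + t *\<^sub>R u t0"
proof -
  have t0: "t0 \<in> ball t0 e" using e by simp
  have const: "\<exists>c. \<forall>t\<in>ball t0 e. f t = c" if f: "\<And>t. t \<in> ball t0 e \<Longrightarrow> (f has_vector_derivative 0) (at t)" for f :: "real \<Rightarrow> 'e"
  proof -
    have "\<exists>c. \<forall>t\<in>ball t0 e. f t = c"
      using f has_vector_derivative_zero_constant[OF convex_ball, of t0 e f] has_vector_derivative_at_within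
      by (metis (no_types, lifting))
    then show ?thesis .
  qed
  obtain c where c: "\<forall>t\<in>ball t0 e. u t = c" using const[OF u] by blast
  have uc: "u t = u t0" if "t \<in> ball t0 e" for t using c that t0 by simp
  have "((\<lambda>s. z s - s *\<^sub>R u t0) has_vector_derivative 0) (at t)" if t: "t \<in> ball t0 e" for t
  proof -
    have "((\<lambda>s. s *\<^sub>R u t0) has_vector_derivative u t0) (at t)"
      by (auto intro!: derivative_eq_intros simp: has_vector_derivative_def)
    from has_vector_derivative_diff[OF z[OF t] this] show ?thesis by (simp add: uc[OF t])
  qed
  then obtain a where a: "\<forall>t\<in>ball t0 e. z t - t *\<^sub>R u t0 = a" using const by blast
  then have "\<forall>t\<in>ball t0 e. z t = a + t *\<^sub>R u t0" by (simp add: algebra_simps)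
  then show ?thesis by (rule exI)
qed

lemma orbit_coord:
  assumes "\<kappa> \<in> charts (quotient_torus \<Gamma>)" "p \<in> cdom \<kappa>"
  shows "orbit \<Gamma> (coord \<kappa> p) = p"
proof -
  obtain W where W: "\<kappa> = torus_chart \<Gamma> W" "inj_on (orbit \<Gamma>) W" using assms(1) unfolding charts_torus by blast
  have "p \<in> orbit \<Gamma> ` W" using assms(2) unfolding W(1) cdom_torus_chart .
  then show ?thesis unfolding W(1) torus_chart_def by (simp add: f_inv_into_f)
qed

lemma locally_constant_real_set:
  fixes S :: "real set"
  assumes nbhd: "\<And>s. \<exists>e>0. \<forall>s'. \<bar>s' - s\<bar> < e \<longrightarrow> (s' \<in> S \<longleftrightarrow> s \<in> S)" and r: "r \<in> S"
  shows "S = UNIV"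
proof -
  have "\<exists>e>0. \<forall>s'. dist s' s < e \<longrightarrow> s' \<in> S" if s: "s \<in> S" for s
    using nbhd[of s] s unfolding dist_real_def by blast
  then have "open S" unfolding open_dist by blast
  moreover have "\<exists>e>0. \<forall>s'. dist s' s < e \<longrightarrow> s' \<in> - S" if s: "s \<in> - S" for s
    using nbhd[of s] s unfolding dist_real_def by blast
  then have "open (- S)" unfolding open_dist by blast
  ultimately have "S \<inter> UNIV = {} \<or> - S \<inter> UNIV = {}"
    by (intro connectedD[OF connected_UNIV]) auto
  then show ?thesis using r by auto
qed

text \<open>If two lines project to the same curve for a short time, their difference is a continuous curve
  in the discrete group, hence constant.\<close>

lemma orbit_lines_agree:
  assumes \<Gamma>: "discrete_subgroup \<Gamma>" and e: "e > 0"
    and eq: "\<And>t. \<bar>t - s\<bar> < e \<Longrightarrow> orbit \<Gamma> (a + t *\<^sub>R b) = orbit \<Gamma> (a' + t *\<^sub>R b')"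
  shows "orbit \<Gamma> (a + t *\<^sub>R b) = orbit \<Gamma> (a' + t *\<^sub>R b')"
proof -
  define \<delta> where "\<delta> = b' - b"
  have mem: "(a' - a) + t *\<^sub>R \<delta> \<in> \<Gamma>" if "\<bar>t - s\<bar> < e" for t
    using eq[OF that] unfolding orbit_eq_iff[OF \<Gamma>] \<delta>_def by (simp add: algebra_simps)
  obtain r where r: "r > 0" "\<forall>\<gamma>\<in>\<Gamma>. norm \<gamma> < r \<longrightarrow> \<gamma> = 0"
    using discrete_subgroup_separated[OF \<Gamma>] by (elim exE conjE)
  define K where "K = norm \<delta> + 1"
  have K: "K > 0" "norm \<delta> < K" by (simp_all add: K_def add_nonneg_pos)
  define h where "h = min (e / 2) (r / K)"
  have h: "h > 0" "h < e" "h * K \<le> r"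
    using e r(1) K(1) by (simp_all add: h_def min_def field_simps)
  have "(a' - a) + (s + h) *\<^sub>R \<delta> - ((a' - a) + s *\<^sub>R \<delta>) \<in> \<Gamma>"
    using h e by (intro discrete_subgroup_diff[OF \<Gamma>] mem) simp_all
  then have 1: "h *\<^sub>R \<delta> \<in> \<Gamma>" by (simp add: algebra_simps)
  have "norm (h *\<^sub>R \<delta>) < h * K" using h(1) K(2) by simp
  then have 2: "norm (h *\<^sub>R \<delta>) < r" using h(3) by simp
  have "h *\<^sub>R \<delta> = 0" using r(2)[rule_format, OF 1 2] .
  then have d0: "\<delta> = 0" using h(1) by simp
  have "a' - a \<in> \<Gamma>" using mem[of s] e d0 by simp
  moreover have "b' = b" using d0 by (simp add: \<delta>_def)
  ultimately show ?thesis unfolding orbit_eq_iff[OF \<Gamma>] by simp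
qed

text \<open>A manifold with an arbitrary atlas that is isometric to the quotient of Euclidean space by a
  discrete group of translations.\<close>

locale flat_manifold =
  fixes M :: "('a, 'n::finite) riemannian" and \<Gamma> :: "(real^'n) set" and F :: "'a \<Rightarrow> (real^'n) set"
  assumes analytic: "analytic_riemannian M" and \<Gamma>: "discrete_subgroup \<Gamma>"
    and F: "isometry M (quotient_torus \<Gamma>) F"
begin

abbreviation "T \<equiv> quotient_torus \<Gamma>"

lemma analytic_manifold: "analytic_manifold M"
  using analytic by (simp add: analytic_riemannian_def)

lemma regular_M: "chart_regular M"
  by (rule analytic_chart_regular[OF analytic_manifold])

lemma smooth_F: "smooth_map M T F"
  using F by (simp add: isometry_def)

lemma F_point: "p \<in> points M \<Longrightarrow> F p \<in> points T"
  using smooth_F by (auto simp: smooth_map_def)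

lemma F_inj: "p \<in> points M \<Longrightarrow> q \<in> points M \<Longrightarrow> F p = F q \<Longrightarrow> p = q"
  using F by (auto simp: isometry_def bij_betw_def dest: inj_onD)

lemma ginner_pos:
  assumes "\<kappa> \<in> charts_at M p" "u \<noteq> 0"
  shows "ginner M \<kappa> p u u > 0"
  using analytic charts_atD[OF assms(1)] assms(2) unfolding analytic_riemannian_def by simp

lemma drep_F_inner:
  assumes "\<kappa> \<in> charts_at M p" "\<kappa>' \<in> charts_at T (F p)"
  shows "drep \<kappa> F \<kappa>' p u \<bullet> drep \<kappa> F \<kappa>' p w = ginner M \<kappa> p u w"
proof -
  have "p \<in> points M" using charts_atD[OF assms(1)] in_points[of \<kappa> M p] by simp
  from isometry_ginner[OF F this assms] show ?thesis by (simp add: ginner_torus)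
qed

lemma drep_F_zero:
  assumes "\<kappa> \<in> charts_at M p" "\<kappa>' \<in> charts_at T (F p)" "drep \<kappa> F \<kappa>' p u = 0"
  shows "u = 0"
proof (rule ccontr)
  assume "u \<noteq> 0"
  then have "ginner M \<kappa> p u u > 0" by (rule ginner_pos[OF assms(1)])
  then show False using drep_F_inner[OF assms(1,2), of u u] assms(3) by simp
qed

lemma geodesic_locally_line:
  assumes c: "geodesic M c" and \<kappa>: "\<kappa> \<in> charts_at M (c t0)" and \<kappa>': "\<kappa>' \<in> charts_at T (F (c t0))"
  shows "\<exists>e>0. \<exists>a. \<forall>t. \<bar>t - t0\<bar> < e \<longrightarrow>
    F (c t) = orbit \<Gamma> (a + t *\<^sub>R drep \<kappa> F \<kappa>' (c t0) (velocity M c t0 \<kappa>))"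
proof -
  have \<kappa>M: "\<kappa> \<in> charts M" "c t0 \<in> cdom \<kappa>" and \<kappa>'T: "\<kappa>' \<in> charts T" "F (c t0) \<in> cdom \<kappa>'"
    using charts_atD[OF \<kappa>] charts_atD[OF \<kappa>'] by simp_all
  define S where "S = rep_dom \<kappa> F \<kappa>'"
  define f where "f = rep \<kappa> F \<kappa>'"
  define y where "y = (\<lambda>t. coord \<kappa> (c t))"
  obtain c' where O: "open (c -` cdom \<kappa>)" and c': "\<forall>t \<in> c -` cdom \<kappa>.
      (y has_vector_derivative c' t) (at t) \<and> (c' has_vector_derivative
        (\<chi> k. - (\<Sum>i\<in>UNIV. \<Sum>j\<in>UNIV. christoffel M \<kappa> (y t) k i j * c' t $ i * c' t $ j))) (at t)"
    using c \<kappa>M(1) unfolding geodesic_def y_def by blast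
  have S: "open S" unfolding S_def by (rule smooth_map_open[OF smooth_F \<kappa>M(1) \<kappa>'T(1)])
  have f: "smooth_on f S" unfolding S_def f_def by (rule smooth_map_smooth[OF smooth_F \<kappa>M(1) \<kappa>'T(1)])
  have inS: "\<exists>p. p \<in> cdom \<kappa> \<and> F p \<in> cdom \<kappa>' \<and> x = coord \<kappa> p" if "x \<in> S" for x
    using that unfolding S_def rep_dom_def by blast
  have g: "u \<bullet> (gmat M \<kappa> x *v w) = frechet_derivative f (at x) u \<bullet> frechet_derivative f (at x) w"
    and inj: "frechet_derivative f (at x) u = 0 \<Longrightarrow> u = 0" if x: "x \<in> S" for x u w
  proof -
    obtain p where p: "p \<in> cdom \<kappa>" "F p \<in> cdom \<kappa>'" "x = coord \<kappa> p" using inS[OF x] by (elim exE conjE)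
    have at: "\<kappa> \<in> charts_at M p" "\<kappa>' \<in> charts_at T (F p)" using p \<kappa>M(1) \<kappa>'T(1) by (simp_all add: charts_at_def)
    show "u \<bullet> (gmat M \<kappa> x *v w) = frechet_derivative f (at x) u \<bullet> frechet_derivative f (at x) w"
      using drep_F_inner[OF at, of u w] unfolding drep_def ginner_def f_def p(3) by (rule sym)
    show "frechet_derivative f (at x) u = 0 \<Longrightarrow> u = 0"
      using drep_F_zero[OF at, of u] unfolding drep_def f_def p(3) .
  qed
  define V where "V = c -` cdom \<kappa> \<inter> y -` S"
  have "continuous_on (c -` cdom \<kappa>) y"
    using c' by (intro continuous_at_imp_continuous_on ballI) (blast intro: has_vector_derivative_continuous)
  then have V: "open V" unfolding V_def using O S by (rule continuous_open_preimage)
  have "t0 \<in> V"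
    using \<kappa>M(2) in_rep_dom_iff[OF regular_M \<kappa>M, of F \<kappa>'] \<kappa>'T(2) by (simp add: V_def S_def y_def)
  then obtain e where e: "e > 0" "ball t0 e \<subseteq> V" using V openE by metis
  define u where "u t = frechet_derivative f (at (y t)) (c' t)" for t
  have der: "(y has_vector_derivative c' t) (at t)" "(c' has_vector_derivative
        (\<chi> k. - (\<Sum>i\<in>UNIV. \<Sum>j\<in>UNIV. christoffel M \<kappa> (y t) k i j * c' t $ i * c' t $ j))) (at t)"
    if "t \<in> V" for t
    using c'[rule_format, of t] that by (simp_all add: V_def)
  have yS: "y t \<in> S" if "t \<in> V" for t using that by (simp add: V_def)
  have z: "((\<lambda>t. f (y t)) has_vector_derivative u t) (at t)" if "t \<in> V" for t
    unfolding u_def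
    by (rule has_vector_derivative_along_curve[where y = y and t = t, OF smooth_on_has_derivative[OF f yS[OF that]] der(1)[OF that]])
  have u0: "(u has_vector_derivative 0) (at t)" if "t \<in> V" for t
    unfolding u_def
    by (rule geodesic_image_acceleration_free[OF f S g inj V that yS der[OF that]])
  have "\<exists>a. \<forall>t\<in>ball t0 e. f (y t) = a + t *\<^sub>R u t0"
    using e(2) z u0 by (intro zero_acceleration_affine[OF e(1)]) (auto simp: subset_iff)
  then obtain a where a: "\<forall>t\<in>ball t0 e. f (y t) = a + t *\<^sub>R u t0" by (elim exE)
  have "vector_derivative y (at t0) = c' t0" by (rule vector_derivative_at[OF der(1)[OF \<open>t0 \<in> V\<close>]])
  then have "velocity M c t0 \<kappa> = c' t0" using \<kappa> by (simp add: velocity_def y_def)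
  then have ut0: "u t0 = drep \<kappa> F \<kappa>' (c t0) (velocity M c t0 \<kappa>)" by (simp add: u_def f_def y_def drep_def)
  have "F (c t) = orbit \<Gamma> (a + t *\<^sub>R u t0)" if "\<bar>t - t0\<bar> < e" for t
  proof -
    have tb: "t \<in> ball t0 e" using that by (simp add: dist_real_def abs_minus_commute)
    then have tV: "t \<in> V" using e(2) by blast
    then have ct: "c t \<in> cdom \<kappa>" by (simp add: V_def)
    have "coord \<kappa> (c t) \<in> rep_dom \<kappa> F \<kappa>'" using yS[OF tV] by (simp add: S_def y_def)
    then have Fct: "F (c t) \<in> cdom \<kappa>'" unfolding in_rep_dom_iff[OF regular_M \<kappa>M(1) ct] .
    have "f (y t) = coord \<kappa>' (F (c t))" unfolding f_def y_def by (rule rep_coord[OF regular_M \<kappa>M(1) ct])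
    then have "coord \<kappa>' (F (c t)) = a + t *\<^sub>R u t0" using a tb by simp
    then show ?thesis using orbit_coord[OF \<kappa>'T(1) Fct] by simp
  qed
  then show ?thesis using e(1) unfolding ut0 by blast
qed

text \<open>Near each time the geodesic is the projection of a line. The times near which this is the same
  line form a set that is open and closed.\<close>

theorem geodesic_is_line:
  assumes c: "geodesic M c" and \<kappa>: "\<kappa> \<in> charts_at M (c 0)" and \<kappa>': "\<kappa>' \<in> charts_at T (F (c 0))"
    and x: "orbit \<Gamma> x = F (c 0)"
  shows "F (c t) = orbit \<Gamma> (x + t *\<^sub>R drep \<kappa> F \<kappa>' (c 0) (velocity M c 0 \<kappa>))"
proof -
  define b where "b = drep \<kappa> F \<kappa>' (c 0) (velocity M c 0 \<kappa>)"
  obtain e a where ea: "e > 0" "\<forall>t. \<bar>t - 0\<bar> < e \<longrightarrow> F (c t) = orbit \<Gamma> (a + t *\<^sub>R b)"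
    using geodesic_locally_line[OF c \<kappa> \<kappa>'] unfolding b_def by (elim exE conjE)
  define S where "S = {s. \<exists>e>0. \<forall>t. \<bar>t - s\<bar> < e \<longrightarrow> F (c t) = orbit \<Gamma> (a + t *\<^sub>R b)}"
  have germ: "\<exists>e>0. \<exists>a b. \<forall>t. \<bar>t - s\<bar> < e \<longrightarrow> F (c t) = orbit \<Gamma> (a + t *\<^sub>R b)" for s
  proof -
    have "c s \<in> points M" using c by (auto simp: geodesic_def)
    obtain \<kappa> where k: "\<kappa> \<in> charts_at M (c s)"
      using points_charts_at[OF \<open>c s \<in> points M\<close>] by (elim exE)
    obtain \<kappa>' where k': "\<kappa>' \<in> charts_at T (F (c s))"
      using points_charts_at[OF F_point[OF \<open>c s \<in> points M\<close>]] by (elim exE)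
    show ?thesis using geodesic_locally_line[OF c k k'] by blast
  qed
  have dich: "s' \<in> S \<longleftrightarrow> s \<in> S" if e: "\<forall>t. \<bar>t - s\<bar> < e \<longrightarrow> F (c t) = orbit \<Gamma> (a1 + t *\<^sub>R b1)" "e > 0"
    and s': "\<bar>s' - s\<bar> < e" for e s s' a1 b1
  proof -
    have iff: "r \<in> S \<longleftrightarrow> (\<forall>t. orbit \<Gamma> (a + t *\<^sub>R b) = orbit \<Gamma> (a1 + t *\<^sub>R b1))" if r: "\<bar>r - s\<bar> < e" for r
    proof
      assume "r \<in> S"
      then obtain d where d: "d > 0" "\<forall>t. \<bar>t - r\<bar> < d \<longrightarrow> F (c t) = orbit \<Gamma> (a + t *\<^sub>R b)"
        unfolding S_def by blast
      define m where "m = min d (e - \<bar>r - s\<bar>)"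
      have m: "m > 0" using d(1) r by (simp add: m_def)
      have "orbit \<Gamma> (a + t *\<^sub>R b) = orbit \<Gamma> (a1 + t *\<^sub>R b1)" if "\<bar>t - r\<bar> < m" for t
      proof -
        have "\<bar>t - r\<bar> < d" "\<bar>t - r\<bar> < e - \<bar>r - s\<bar>" using that by (simp_all add: m_def)
        moreover from this have "\<bar>t - s\<bar> < e" by linarith
        ultimately have "\<bar>t - r\<bar> < d" "\<bar>t - s\<bar> < e" by simp_all
        then show ?thesis using d(2) e(1) by metis
      qed
      then show "\<forall>t. orbit \<Gamma> (a + t *\<^sub>R b) = orbit \<Gamma> (a1 + t *\<^sub>R b1)"
        using orbit_lines_agree[OF \<Gamma> m] by blast
    next
      assume eq: "\<forall>t. orbit \<Gamma> (a + t *\<^sub>R b) = orbit \<Gamma> (a1 + t *\<^sub>R b1)"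
      have "F (c t) = orbit \<Gamma> (a + t *\<^sub>R b)" if "\<bar>t - r\<bar> < e - \<bar>r - s\<bar>" for t
      proof -
        have "\<bar>t - s\<bar> < e" using that by simp
        then show ?thesis using e(1) eq by simp
      qed
      then show "r \<in> S" unfolding S_def using r by (intro CollectI exI[of _ "e - \<bar>r - s\<bar>"]) simp
    qed
    show ?thesis using iff[OF s'] iff[of s] e(2) by simp
  qed
  have nbhd: "\<exists>e>0. \<forall>s'. \<bar>s' - s\<bar> < e \<longrightarrow> (s' \<in> S \<longleftrightarrow> s \<in> S)" for s
  proof -
    obtain e a1 b1 where e: "e > 0" "\<forall>t. \<bar>t - s\<bar> < e \<longrightarrow> F (c t) = orbit \<Gamma> (a1 + t *\<^sub>R b1)"
      using germ[of s] by (elim exE conjE)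
    show ?thesis using dich[OF e(2,1)] e(1) by blast
  qed
  have "0 \<in> S" using ea unfolding S_def by blast
  then have "S = UNIV" using locally_constant_real_set[of S] nbhd by simp
  then have Ft: "F (c t) = orbit \<Gamma> (a + t *\<^sub>R b)" for t
  proof -
    have "t \<in> S" using \<open>S = UNIV\<close> by simp
    then obtain e where "e > 0" "\<forall>s. \<bar>s - t\<bar> < e \<longrightarrow> F (c s) = orbit \<Gamma> (a + s *\<^sub>R b)" unfolding S_def by blast
    then show ?thesis by simp
  qed
  have "orbit \<Gamma> a = orbit \<Gamma> x" using Ft[of 0] x by simp
  then show ?thesis unfolding b_def[symmetric] Ft orbit_eq_iff[OF \<Gamma>] by (simp add: algebra_simps)
qed

end

section \<open>The exponential map and the focal index\<close>

text \<open>The tangent vector with component \<open>u\<close> in the chart \<open>\<kappa>\<close>.\<close>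

definition tvector :: "('a, 'n::finite) riemannian \<Rightarrow> ('a, 'n) chart \<Rightarrow> 'a \<Rightarrow> real^'n \<Rightarrow> ('a, 'n) tvec" where
  "tvector M \<kappa> p u = (\<lambda>\<kappa>'. if \<kappa>' \<in> charts_at M p then drep \<kappa> id \<kappa>' p u else 0)"

lemma tvector_in_tspace:
  assumes M: "analytic_manifold M" and \<kappa>: "\<kappa> \<in> charts_at M p"
  shows "tvector M \<kappa> p u \<in> tspace M p"
proof -
  have cocycle: "drep \<kappa> id \<kappa>2 p u = drep \<kappa>1 id \<kappa>2 p (drep \<kappa> id \<kappa>1 p u)"
    if \<kappa>1: "\<kappa>1 \<in> charts_at M p" and \<kappa>2: "\<kappa>2 \<in> charts_at M p" for \<kappa>1 \<kappa>2
  proof -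
    have k: "\<kappa> \<in> charts M" "p \<in> cdom \<kappa>" "\<kappa>1 \<in> charts M" "id p \<in> cdom \<kappa>1" "\<kappa>2 \<in> charts M" "id (id p) \<in> cdom \<kappa>2"
      using charts_atD[OF \<kappa>] charts_atD[OF \<kappa>1] charts_atD[OF \<kappa>2] by simp_all
    show ?thesis
      using drep_compose[OF analytic_chart_regular[OF M] analytic_chart_regular[OF M] smooth_map_id[OF M] smooth_map_id[OF M] k, of u]
      by (simp add: id_def comp_def)
  qed
  show ?thesis
    unfolding tspace_def mem_Collect_eq
  proof (intro conjI allI impI ballI)
    fix \<kappa>1 assume "\<kappa>1 \<notin> charts_at M p"
    then show "tvector M \<kappa> p u \<kappa>1 = 0" by (simp add: tvector_def)
  next
    fix \<kappa>1 \<kappa>2 assume k: "\<kappa>1 \<in> charts_at M p" "\<kappa>2 \<in> charts_at M p"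
    have "tvector M \<kappa> p u \<kappa>1 = drep \<kappa> id \<kappa>1 p u" "tvector M \<kappa> p u \<kappa>2 = drep \<kappa> id \<kappa>2 p u"
      using k by (simp_all only: tvector_def if_True)
    then show "tvector M \<kappa> p u \<kappa>2 = drep \<kappa>1 id \<kappa>2 p (tvector M \<kappa> p u \<kappa>1)"
      by (simp only: cocycle[OF k])
  qed
qed

lemma tspace_transition:
  "v \<in> tspace M p \<Longrightarrow> \<kappa> \<in> charts_at M p \<Longrightarrow> \<kappa>' \<in> charts_at M p \<Longrightarrow> v \<kappa>' = drep \<kappa> id \<kappa>' p (v \<kappa>)"
  unfolding tspace_def mem_Collect_eq by blast

lemma tspace_outside: "v \<in> tspace M p \<Longrightarrow> \<kappa> \<notin> charts_at M p \<Longrightarrow> v \<kappa> = 0"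
  unfolding tspace_def mem_Collect_eq by blast

lemma tvector_base:
  assumes M: "analytic_manifold M" and \<kappa>: "\<kappa> \<in> charts_at M p"
  shows "tvector M \<kappa> p u \<kappa> = u"
  using drep_id[OF analytic_chart_regular[OF M], of \<kappa> p] charts_atD[OF \<kappa>] \<kappa> by (simp add: tvector_def)

lemma tspace_eq_tvector:
  assumes \<kappa>: "\<kappa> \<in> charts_at M p" and v: "v \<in> tspace M p"
  shows "v = tvector M \<kappa> p (v \<kappa>)"
proof
  fix \<kappa>'
  show "v \<kappa>' = tvector M \<kappa> p (v \<kappa>) \<kappa>'"
    using tspace_transition[OF v \<kappa>] tspace_outside[OF v]
    unfolding tvector_def by (cases "\<kappa>' \<in> charts_at M p") (simp_all only: if_True if_False)
qed

context flat_manifold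
begin

text \<open>At each point, a chart of \<open>M\<close>, a chart of the torus around the image point and a
  point of Euclidean space above it are fixed. The choice of \<open>chart_M\<close> is the one
  that occurs in \<^const>\<open>tnorm\<close>. The map \<open>L\<close> is the differential of
  \<open>F\<close> in these charts, and \<open>develop\<close> is the resulting linear isometry
  of the tangent space with Euclidean space.\<close>

definition chart_M :: "'a \<Rightarrow> ('a, 'n) chart" where "chart_M p = (SOME \<kappa>. \<kappa> \<in> charts_at M p)"
definition chart_T :: "'a \<Rightarrow> ((real^'n) set, 'n) chart" where "chart_T p = (SOME \<kappa>. \<kappa> \<in> charts_at T (F p))"
definition lift :: "'a \<Rightarrow> real^'n" where "lift p = (SOME x. orbit \<Gamma> x = F p)"
definition L :: "'a \<Rightarrow> real^'n \<Rightarrow> real^'n" where "L p = drep (chart_M p) F (chart_T p) p"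
definition develop :: "'a \<Rightarrow> ('a, 'n) tvec \<Rightarrow> real^'n" where "develop p v = L p (v (chart_M p))"
definition undevelop :: "'a \<Rightarrow> real^'n \<Rightarrow> ('a, 'n) tvec" where
  "undevelop p y = tvector M (chart_M p) p (inv_into UNIV (L p) y)"

context
  fixes p assumes p: "p \<in> points M"
begin

lemma chart_M: "chart_M p \<in> charts_at M p"
  unfolding chart_M_def using points_charts_at[OF p] by (rule someI_ex)

lemma chart_T: "chart_T p \<in> charts_at T (F p)"
  unfolding chart_T_def using points_charts_at[OF F_point[OF p]] by (rule someI_ex)

lemma lift: "orbit \<Gamma> (lift p) = F p"
proof -
  have "\<exists>x. orbit \<Gamma> x = F p" using F_point[OF p] unfolding points_torus[OF \<Gamma>] by (metis imageE)
  then show ?thesis unfolding lift_def by (rule someI_ex)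
qed

lemma L_inner: "L p u \<bullet> L p w = ginner M (chart_M p) p u w"
  unfolding L_def by (rule drep_F_inner[OF chart_M chart_T])

lemma linear_L: "linear (L p)"
  unfolding L_def
  using drep_has_derivative[OF regular_M smooth_F, of "chart_M p" p "chart_T p"] charts_atD[OF chart_M] charts_atD[OF chart_T]
    has_derivative_linear by blast

lemma bij_L: "bij (L p)"
proof -
  have "inj (L p)"
    unfolding linear_injective_0[OF linear_L] unfolding L_def using drep_F_zero[OF chart_M chart_T] by blast
  then show ?thesis
    using linear_injective_imp_surjective[OF linear_L _ refl] by (simp add: bij_def)
qed

lemma L_inv: "L p (inv_into UNIV (L p) y) = y"
  by (rule surj_f_inv_f[OF bij_is_surj[OF bij_L]])

lemma inv_L: "inv_into UNIV (L p) (L p u) = u"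
  by (rule inv_f_f[OF bij_is_inj[OF bij_L]])

lemma linear_inv_L: "linear (inv_into UNIV (L p))"
proof (rule linearI)
  fix x y c
  show "inv_into UNIV (L p) (x + y) = inv_into UNIV (L p) x + inv_into UNIV (L p) y"
    by (rule injD[OF bij_is_inj[OF bij_L]]) (simp only: linear_add[OF linear_L] L_inv)
  show "inv_into UNIV (L p) (c *\<^sub>R x) = c *\<^sub>R inv_into UNIV (L p) x"
    by (rule injD[OF bij_is_inj[OF bij_L]]) (simp only: linear_scale[OF linear_L] L_inv)
qed

lemma undevelop_in: "undevelop p y \<in> tspace M p"
  unfolding undevelop_def by (rule tvector_in_tspace[OF analytic_manifold chart_M])

lemma develop_undevelop: "develop p (undevelop p y) = y"
  unfolding develop_def undevelop_def tvector_base[OF analytic_manifold chart_M] by (rule L_inv)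

lemma undevelop_develop: "v \<in> tspace M p \<Longrightarrow> undevelop p (develop p v) = v"
  unfolding develop_def undevelop_def inv_L by (rule tspace_eq_tvector[OF chart_M, symmetric])

lemma tnorm_develop: "tnorm M p v = norm (develop p v)"
  unfolding tnorm_def chart_M_def[symmetric] Let_def develop_def norm_eq_sqrt_inner L_inner ..

lemma develop_zero: "develop p (\<lambda>_. 0) = 0"
  unfolding develop_def by (rule linear_0[OF linear_L])

lemma undevelop_zero: "undevelop p 0 = (\<lambda>_. 0)"
proof -
  have "(\<lambda>_. 0) \<in> tspace M p"
  proof -
    have "drep \<kappa> id \<kappa>' p 0 = 0" if k: "\<kappa> \<in> charts_at M p" "\<kappa>' \<in> charts_at M p" for \<kappa> \<kappa>'
    proof -
      have "(rep \<kappa> id \<kappa>' has_derivative drep \<kappa> id \<kappa>' p) (at (coord \<kappa> p))"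
        using charts_atD[OF k(1)] charts_atD[OF k(2)]
        by (intro drep_has_derivative[OF regular_M smooth_map_id[OF analytic_manifold]]) simp_all
      from linear_0[OF has_derivative_linear[OF this]] show ?thesis .
    qed
    then show ?thesis by (simp add: tspace_def)
  qed
  from undevelop_develop[OF this] show ?thesis unfolding develop_zero .
qed

end

end

locale complete_flat_manifold = flat_manifold +
  assumes complete: "complete_riemannian M"
begin

lemma mexp_develop:
  assumes p: "p \<in> points M" and v: "v \<in> tspace M p"
  shows "mexp M p v \<in> points M" and "F (mexp M p v) = orbit \<Gamma> (lift p + develop p v)"
proof -
  have line: "c 1 \<in> points M \<and> F (c 1) = orbit \<Gamma> (lift p + develop p v)"
    if c: "geodesic M c" "c 0 = p" "velocity M c 0 = v" for c
  proof
    show "c 1 \<in> points M" using c(1) by (auto simp: geodesic_def)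
    have "chart_M p \<in> charts_at M (c 0)" "chart_T p \<in> charts_at T (F (c 0))" "orbit \<Gamma> (lift p) = F (c 0)"
      unfolding c(2) using chart_M[OF p] chart_T[OF p] lift[OF p] by simp_all
    from geodesic_is_line[OF c(1) this, of 1] show "F (c 1) = orbit \<Gamma> (lift p + develop p v)"
      unfolding c(2,3) by (simp add: develop_def L_def)
  qed
  have pv: "(p, v) \<in> tbundle M" using p v by (simp add: tbundle_def)
  have "\<exists>c. geodesic M c \<and> c 0 = p \<and> velocity M c 0 = v"
    using bspec[OF complete[unfolded complete_riemannian_def] pv] by simp
  then obtain c where c: "geodesic M c" "c 0 = p" "velocity M c 0 = v" by (elim exE conjE)
  have "mexp M p v = c 1"
    unfolding mexp_def
  proof (rule the_equality)
    show "\<exists>c'. geodesic M c' \<and> c' 0 = p \<and> velocity M c' 0 = v \<and> c' 1 = c 1"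
      by (intro exI[of _ c] conjI c refl)
    fix q assume "\<exists>c'. geodesic M c' \<and> c' 0 = p \<and> velocity M c' 0 = v \<and> c' 1 = q"
    then obtain c' where c': "geodesic M c'" "c' 0 = p" "velocity M c' 0 = v" "c' 1 = q" by (elim exE conjE)
    show "q = c 1"
      unfolding c'(4)[symmetric] by (rule F_inj) (simp_all only: line[OF c] line[OF c'(1-3)])
  qed
  then show "mexp M p v \<in> points M" "F (mexp M p v) = orbit \<Gamma> (lift p + develop p v)"
    by (simp_all only: line[OF c])
qed

lemma finite_on_bisector: "finite {\<gamma>\<in>\<Gamma>. on_bisector \<gamma> y}"
proof (rule finite_subset[OF _ discrete_subgroup_finite[OF \<Gamma>, of "2 * norm y"]])
  show "{\<gamma> \<in> \<Gamma>. on_bisector \<gamma> y} \<subseteq> {\<gamma> \<in> \<Gamma>. norm \<gamma> \<le> 2 * norm y}"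
    using bisector_far(2)[of y] by (auto simp: not_less[symmetric])
qed

text \<open>The vectors \<open>w\<close> with the same endpoint as \<open>v\<close> develop to the points
  \<open>y - \<gamma>\<close> with \<open>\<gamma> \<in> \<Gamma>\<close>, where
  \<open>y\<close> is the development of \<open>v\<close>. Such a point has the norm of
  \<open>y\<close> exactly if \<open>y\<close> is on the bisector of \<open>\<gamma>\<close>.\<close>

theorem focal_index_eq_card_bisectors:
  assumes p: "p \<in> points M" and v: "v \<in> tspace M p"
  shows "focal_index M p v = enat (card {\<gamma>\<in>\<Gamma>. on_bisector \<gamma> (develop p v)})"
proof -
  define y where "y = develop p v"
  define W where "W = {w \<in> tspace M p. tnorm M p w = tnorm M p v \<and> mexp M p w = mexp M p v}"
  have mem: "w \<in> W \<longleftrightarrow> y - develop p w \<in> \<Gamma> \<and> on_bisector (y - develop p w) y" if w: "w \<in> tspace M p" for w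
  proof -
    have "mexp M p w = mexp M p v \<longleftrightarrow> F (mexp M p w) = F (mexp M p v)"
    proof
      show "F (mexp M p w) = F (mexp M p v) \<Longrightarrow> mexp M p w = mexp M p v"
        by (rule F_inj[OF mexp_develop(1)[OF p w] mexp_develop(1)[OF p v]])
    qed (rule arg_cong)
    also have "\<dots> \<longleftrightarrow> y - develop p w \<in> \<Gamma>"
      unfolding mexp_develop(2)[OF p w] mexp_develop(2)[OF p v] orbit_eq_iff[OF \<Gamma>] y_def by simp
    finally have 1: "mexp M p w = mexp M p v \<longleftrightarrow> y - develop p w \<in> \<Gamma>" .
    have "tnorm M p w = tnorm M p v \<longleftrightarrow> develop p w \<bullet> develop p w = y \<bullet> y"
      unfolding tnorm_develop[OF p] y_def norm_eq_sqrt_inner by simp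
    also have "\<dots> \<longleftrightarrow> on_bisector (y - develop p w) y"
      unfolding on_bisector_def
      by (simp add: inner_diff_left inner_diff_right inner_commute[of "develop p w" y] algebra_simps) linarith
    finally show ?thesis using w unfolding W_def mem_Collect_eq 1 by blast
  qed
  have "bij_betw (\<lambda>w. y - develop p w) W {\<gamma>\<in>\<Gamma>. on_bisector \<gamma> y}"
  proof (rule bij_betw_byWitness[where f' = "\<lambda>\<gamma>. undevelop p (y - \<gamma>)"])
    have sub: "w \<in> tspace M p" if "w \<in> W" for w using that by (simp add: W_def)
    show "\<forall>w\<in>W. undevelop p (y - (y - develop p w)) = w" using undevelop_develop[OF p] sub by simp
    show "\<forall>\<gamma>\<in>{\<gamma>\<in>\<Gamma>. on_bisector \<gamma> y}. y - develop p (undevelop p (y - \<gamma>)) = \<gamma>"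
      by (simp add: develop_undevelop[OF p])
    show "(\<lambda>w. y - develop p w) ` W \<subseteq> {\<gamma>\<in>\<Gamma>. on_bisector \<gamma> y}"
    proof (rule image_subsetI)
      fix w assume w: "w \<in> W"
      show "y - develop p w \<in> {\<gamma>\<in>\<Gamma>. on_bisector \<gamma> y}" using mem[OF sub[OF w]] w by simp
    qed
    show "(\<lambda>\<gamma>. undevelop p (y - \<gamma>)) ` {\<gamma>\<in>\<Gamma>. on_bisector \<gamma> y} \<subseteq> W"
    proof (rule image_subsetI)
      fix \<gamma> assume \<gamma>: "\<gamma> \<in> {\<gamma>\<in>\<Gamma>. on_bisector \<gamma> y}"
      show "undevelop p (y - \<gamma>) \<in> W"
        using \<gamma> unfolding mem[OF undevelop_in[OF p]] develop_undevelop[OF p] by simp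
    qed
  qed
  then have "card W = card {\<gamma>\<in>\<Gamma>. on_bisector \<gamma> y}" "finite W \<longleftrightarrow> finite {\<gamma>\<in>\<Gamma>. on_bisector \<gamma> y}"
    by (rule bij_betw_same_card, rule bij_betw_finite)
  then show ?thesis
    unfolding focal_index_def W_def[symmetric] Let_def y_def[symmetric] by (simp add: finite_on_bisector)
qed

lemma focal_index_ge_1:
  assumes p: "p \<in> points M" and v: "v \<in> tspace M p"
  shows "focal_index M p v \<ge> 1"
proof -
  have "0 \<in> {\<gamma>\<in>\<Gamma>. on_bisector \<gamma> (develop p v)}"
    using discrete_subgroup_zero[OF \<Gamma>] by (simp add: on_bisector_def)
  then have "card {\<gamma>\<in>\<Gamma>. on_bisector \<gamma> (develop p v)} > 0"
    using finite_on_bisector card_gt_0_iff by blast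
  then show ?thesis unfolding focal_index_eq_card_bisectors[OF p v] one_enat_def by simp
qed

lemma card_bisectors_regular:
  "regular \<Gamma> y \<longleftrightarrow> card {\<gamma>\<in>\<Gamma>. on_bisector \<gamma> y} \<le> 1"
proof -
  have 0: "0 \<in> {\<gamma>\<in>\<Gamma>. on_bisector \<gamma> y}" using discrete_subgroup_zero[OF \<Gamma>] by (simp add: on_bisector_def)
  show ?thesis
  proof
    assume "regular \<Gamma> y"
    then have "{\<gamma>\<in>\<Gamma>. on_bisector \<gamma> y} \<subseteq> {0}" by (auto simp: regular_def)
    then show "card {\<gamma>\<in>\<Gamma>. on_bisector \<gamma> y} \<le> 1" using card_mono[of "{0}"] by simp
  next
    assume "card {\<gamma>\<in>\<Gamma>. on_bisector \<gamma> y} \<le> 1"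
    then have "\<forall>\<gamma>\<in>{\<gamma>\<in>\<Gamma>. on_bisector \<gamma> y}. \<forall>\<delta>\<in>{\<gamma>\<in>\<Gamma>. on_bisector \<gamma> y}. \<gamma> = \<delta>"
      using card_le_Suc0_iff_eq[OF finite_on_bisector] by simp
    then show "regular \<Gamma> y" using 0 by (simp add: regular_def)
  qed
qed

lemma card_bisectors_simple:
  "simple \<Gamma> y \<longleftrightarrow> card {\<gamma>\<in>\<Gamma>. on_bisector \<gamma> y} \<le> 2"
proof -
  let ?S = "{\<gamma>\<in>\<Gamma>. on_bisector \<gamma> y}"
  have 0: "0 \<in> ?S" using discrete_subgroup_zero[OF \<Gamma>] by (simp add: on_bisector_def)
  have "card ?S = Suc (card (?S - {0}))" using card_Suc_Diff1[OF finite_on_bisector 0] by simp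
  then have "card ?S \<le> 2 \<longleftrightarrow> card (?S - {0}) \<le> Suc 0" by simp
  also have "\<dots> \<longleftrightarrow> (\<forall>\<gamma>\<in>?S - {0}. \<forall>\<delta>\<in>?S - {0}. \<gamma> = \<delta>)"
    by (rule card_le_Suc0_iff_eq) (simp add: finite_on_bisector)
  also have "\<dots> \<longleftrightarrow> simple \<Gamma> y" unfolding simple_def by auto
  finally show ?thesis by simp
qed

end

section \<open>The topology of the tangent bundle\<close>

lemma tcoord_inj:
  assumes "chart_regular M" "\<kappa> \<in> charts M"
  shows "inj_on (tcoord \<kappa>) (tdom M \<kappa>)"
proof (rule inj_onI)
  fix e e' assume e: "e \<in> tdom M \<kappa>" "e' \<in> tdom M \<kappa>" "tcoord \<kappa> e = tcoord \<kappa> e'"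
  obtain p v p' v' where pv: "e = (p, v)" "e' = (p', v')" by (metis prod.collapse)
  have m: "p \<in> cdom \<kappa>" "v \<in> tspace M p" "p' \<in> cdom \<kappa>" "v' \<in> tspace M p'"
    using e(1,2) by (simp_all add: tdom_def pv)
  have c: "coord \<kappa> p = coord \<kappa> p'" "v \<kappa> = v' \<kappa>" using e(3) by (simp_all add: tcoord_def pv)
  have pp: "p = p'" using inj_onD[OF chart_regular_inj[OF assms] c(1) m(1,3)] .
  have \<kappa>: "\<kappa> \<in> charts_at M p" using assms(2) m(1) by (simp add: charts_at_def)
  have "v = tvector M \<kappa> p (v \<kappa>)" "v' = tvector M \<kappa> p (v' \<kappa>)"
    using tspace_eq_tvector[OF \<kappa> m(2)] tspace_eq_tvector[OF \<kappa> m(4)[folded pp]] .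
  then have "v = v'" unfolding c(2) by (rule trans[OF _ sym])
  then show "e = e'" using pp pv by simp
qed

lemma openin_ttop:
  assumes M: "chart_regular M"
  shows "openin (ttop M) U \<longleftrightarrow> U \<subseteq> tbundle M \<and> (\<forall>\<kappa>\<in>charts M. open (tcoord \<kappa> ` (U \<inter> tdom M \<kappa>)))"
proof -
  have "istopology (\<lambda>U. U \<subseteq> tbundle M \<and> (\<forall>\<kappa>\<in>charts M. open (tcoord \<kappa> ` (U \<inter> tdom M \<kappa>))))"
    unfolding istopology_def
  proof (intro conjI allI impI ballI)
    fix S U \<kappa> assume S: "S \<subseteq> tbundle M \<and> (\<forall>\<kappa>\<in>charts M. open (tcoord \<kappa> ` (S \<inter> tdom M \<kappa>)))"
      and U: "U \<subseteq> tbundle M \<and> (\<forall>\<kappa>\<in>charts M. open (tcoord \<kappa> ` (U \<inter> tdom M \<kappa>)))"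
    show "S \<inter> U \<subseteq> tbundle M" using S by blast
    assume \<kappa>: "\<kappa> \<in> charts M"
    have "tcoord \<kappa> ` ((S \<inter> tdom M \<kappa>) \<inter> (U \<inter> tdom M \<kappa>))
        = tcoord \<kappa> ` (S \<inter> tdom M \<kappa>) \<inter> tcoord \<kappa> ` (U \<inter> tdom M \<kappa>)"
      by (rule inj_on_image_Int[OF tcoord_inj[OF M \<kappa>]]) auto
    moreover have "(S \<inter> tdom M \<kappa>) \<inter> (U \<inter> tdom M \<kappa>) = S \<inter> U \<inter> tdom M \<kappa>" by blast
    moreover have "open (tcoord \<kappa> ` (S \<inter> tdom M \<kappa>))" "open (tcoord \<kappa> ` (U \<inter> tdom M \<kappa>))" using S U \<kappa> by simp_all
    ultimately show "open (tcoord \<kappa> ` (S \<inter> U \<inter> tdom M \<kappa>))" using open_Int by metis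
  next
    fix \<U> assume *: "\<forall>U\<in>\<U>. U \<subseteq> tbundle M \<and> (\<forall>\<kappa>\<in>charts M. open (tcoord \<kappa> ` (U \<inter> tdom M \<kappa>)))"
    then show "\<Union>\<U> \<subseteq> tbundle M" by (simp add: Sup_le_iff)
    fix \<kappa> assume \<kappa>: "\<kappa> \<in> charts M"
    have "tcoord \<kappa> ` (\<Union>\<U> \<inter> tdom M \<kappa>) = (\<Union>U\<in>\<U>. tcoord \<kappa> ` (U \<inter> tdom M \<kappa>))" by blast
    moreover have "open (\<Union>U\<in>\<U>. tcoord \<kappa> ` (U \<inter> tdom M \<kappa>))" using * \<kappa> by (intro open_UN) simp
    ultimately show "open (tcoord \<kappa> ` (\<Union>\<U> \<inter> tdom M \<kappa>))" by simp
  qed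
  from topology_inverse'[OF this] show ?thesis unfolding ttop_def by simp
qed

text \<open>The charts of the tangent bundle are continuous: a coordinate change \<open>\<tau>\<close> acts
  on them by \<open>(x, w) \<mapsto> (\<tau> x, D\<tau>(x) w)\<close>, which is jointly
  continuous because \<open>\<tau>\<close> is continuously differentiable.\<close>

lemma openin_tangent_chart:
  fixes M :: "('a, 'n::finite) riemannian"
  assumes M: "analytic_manifold M" and \<kappa>: "\<kappa> \<in> charts M" and V: "open V"
  shows "openin (ttop M) {e \<in> tdom M \<kappa>. tcoord \<kappa> e \<in> V}"
  unfolding openin_ttop[OF analytic_chart_regular[OF M]]
proof (intro conjI ballI)
  note reg = analytic_chart_regular[OF M]
  show "{e \<in> tdom M \<kappa>. tcoord \<kappa> e \<in> V} \<subseteq> tbundle M"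
    using in_points[OF \<kappa>] by (auto simp: tdom_def tbundle_def)
  fix \<kappa>2 assume \<kappa>2: "\<kappa>2 \<in> charts M"
  define R where "R = rep_dom \<kappa>2 id \<kappa>"
  define \<tau> where "\<tau> = rep \<kappa>2 id \<kappa>"
  have R: "open R" unfolding R_def by (rule smooth_map_open[OF smooth_map_id[OF M] \<kappa>2 \<kappa>])
  have \<tau>: "smooth_on \<tau> R" unfolding R_def \<tau>_def by (rule smooth_map_smooth[OF smooth_map_id[OF M] \<kappa>2 \<kappa>])
  define \<Phi> where "\<Phi> = (\<lambda>z. (\<tau> (fst z), frechet_derivative \<tau> (at (fst z)) (snd z)))"
  have "continuous_on (R \<times> UNIV) (\<lambda>z. \<Sum>i\<in>UNIV. (snd z $ i) *\<^sub>R frechet_derivative \<tau> (at (fst z)) (axis i 1))"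
    by (intro continuous_intros continuous_on_compose2[OF smooth_on_continuous[OF smooth_on_derivative[OF \<tau>]]]) auto
  moreover have "(\<Sum>i\<in>UNIV. (snd z $ i) *\<^sub>R frechet_derivative \<tau> (at (fst z)) (axis i 1)) = frechet_derivative \<tau> (at (fst z)) (snd z)"
    if z: "z \<in> R \<times> UNIV" for z
  proof -
    have "fst z \<in> R" using z by auto
    then show ?thesis
      by (intro linear_axis[symmetric] has_derivative_linear[OF smooth_on_has_derivative[OF \<tau>]])
  qed
  ultimately have c2: "continuous_on (R \<times> UNIV) (\<lambda>z. frechet_derivative \<tau> (at (fst z)) (snd z))"
    by (simp cong: continuous_on_cong)
  have c1: "continuous_on (R \<times> UNIV) (\<lambda>z. \<tau> (fst z))"
    by (intro continuous_on_compose2[OF smooth_on_continuous[OF \<tau>]] continuous_intros) auto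
  have "open ((R \<times> UNIV) \<inter> \<Phi> -` V)"
    unfolding \<Phi>_def by (intro continuous_open_preimage continuous_on_Pair c1 c2 open_Times R open_UNIV V)
  moreover have "tcoord \<kappa>2 ` ({e \<in> tdom M \<kappa>. tcoord \<kappa> e \<in> V} \<inter> tdom M \<kappa>2) = (R \<times> UNIV) \<inter> \<Phi> -` V" (is "?A = ?B")
  proof -
    have key: "coord \<kappa>2 p \<in> R" "\<Phi> (coord \<kappa>2 p, v \<kappa>2) = tcoord \<kappa> (p, v)"
      if p: "p \<in> cdom \<kappa>" "p \<in> cdom \<kappa>2" and v: "v \<in> tspace M p" for p v
    proof -
      show "coord \<kappa>2 p \<in> R" unfolding R_def in_rep_dom_iff[OF reg \<kappa>2 p(2)] using p(1) by simp
      have at: "\<kappa> \<in> charts_at M p" "\<kappa>2 \<in> charts_at M p" using p \<kappa> \<kappa>2 by (simp_all add: charts_at_def)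
      have v\<kappa>: "v \<kappa> = drep \<kappa>2 id \<kappa> p (v \<kappa>2)" by (rule tspace_transition[OF v at(2,1)])
      have \<tau>p: "\<tau> (coord \<kappa>2 p) = coord \<kappa> p" unfolding \<tau>_def rep_coord[OF reg \<kappa>2 p(2)] by simp
      show "\<Phi> (coord \<kappa>2 p, v \<kappa>2) = tcoord \<kappa> (p, v)"
        unfolding \<Phi>_def tcoord_def fst_conv snd_conv \<tau>p case_prod_conv
        unfolding v\<kappa> drep_def \<tau>_def ..
    qed
    show ?thesis
    proof (intro equalityI subsetI)
      fix z assume "z \<in> ?A"
      then obtain p v where pv: "(p, v) \<in> tdom M \<kappa>" "tcoord \<kappa> (p, v) \<in> V" "(p, v) \<in> tdom M \<kappa>2" "z = tcoord \<kappa>2 (p, v)"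
        by auto
      then have "p \<in> cdom \<kappa>" "p \<in> cdom \<kappa>2" "v \<in> tspace M p" by (simp_all add: tdom_def)
      from key[OF this] show "z \<in> ?B" using pv(2,4) by (simp add: tcoord_def)
    next
      fix z assume z: "z \<in> ?B"
      obtain x w where xw: "z = (x, w)" by (metis prod.collapse)
      have "x \<in> R" using z xw by simp
      then obtain p where p: "p \<in> cdom \<kappa>2" "p \<in> cdom \<kappa>" "x = coord \<kappa>2 p" unfolding R_def rep_dom_def by auto
      have at: "\<kappa>2 \<in> charts_at M p" using p \<kappa>2 by (simp add: charts_at_def)
      define v where "v = tvector M \<kappa>2 p w"
      have v: "v \<in> tspace M p" unfolding v_def by (rule tvector_in_tspace[OF M at])
      have vw: "v \<kappa>2 = w" unfolding v_def by (rule tvector_base[OF M at])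
      have "tcoord \<kappa> (p, v) \<in> V" using key(2)[OF p(2,1) v] z xw p(3) vw by simp
      moreover have "(p, v) \<in> tdom M \<kappa>" "(p, v) \<in> tdom M \<kappa>2" using p v by (simp_all add: tdom_def)
      moreover have "z = tcoord \<kappa>2 (p, v)" by (simp add: tcoord_def xw p(3) vw)
      ultimately show "z \<in> ?A" by blast
    qed
  qed
  ultimately show "open (tcoord \<kappa>2 ` ({e \<in> tdom M \<kappa>. tcoord \<kappa> e \<in> V} \<inter> tdom M \<kappa>2))" by simp
qed

lemma topspace_ttop:
  assumes M: "analytic_manifold M"
  shows "topspace (ttop M) = tbundle M"
proof (rule antisym)
  have "openin (ttop M) (topspace (ttop M))" by simp
  then show "topspace (ttop M) \<subseteq> tbundle M" unfolding openin_ttop[OF analytic_chart_regular[OF M]] by blast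
  have "(\<Union>\<kappa>\<in>charts M. {e \<in> tdom M \<kappa>. tcoord \<kappa> e \<in> UNIV}) = tbundle M"
    by (auto simp: tbundle_def tdom_def points_def)
  moreover have "openin (ttop M) (\<Union>\<kappa>\<in>charts M. {e \<in> tdom M \<kappa>. tcoord \<kappa> e \<in> UNIV})"
    by (intro openin_Union) (auto intro!: openin_tangent_chart[OF M _ open_UNIV, simplified])
  ultimately show "tbundle M \<subseteq> topspace (ttop M)" using openin_subset by metis
qed

section \<open>Focally equivalent flat tori\<close>

text \<open>The inclusion of a fibre into the tangent bundle is continuous, and so is the coordinate reading
  on the target fibre.\<close>

lemma fibre_map_continuous:
  fixes M1 :: "('a, 'n::finite) riemannian" and M2 :: "('b, 'n) riemannian"
  assumes M1: "flat_manifold M1 \<Gamma>1 F1" and M2: "flat_manifold M2 \<Gamma>2 F2"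
    and \<phi>: "continuous_map (ttop M1) (ttop M2) \<phi>" and p: "p \<in> points M1" and q: "q \<in> points M2"
    and fibre: "\<phi> ` ({p} \<times> tspace M1 p) \<subseteq> {q} \<times> tspace M2 q"
  shows "continuous_on UNIV (\<lambda>y. flat_manifold.develop M2 \<Gamma>2 F2 q (snd (\<phi> (p, flat_manifold.undevelop M1 \<Gamma>1 F1 p y))))"
proof -
  interpret A: flat_manifold M1 \<Gamma>1 F1 by (rule M1)
  interpret B: flat_manifold M2 \<Gamma>2 F2 by (rule M2)
  define h where "h y = B.develop q (snd (\<phi> (p, A.undevelop p y)))" for y
  define \<kappa>1 where "\<kappa>1 = A.chart_M p"
  define \<kappa>2 where "\<kappa>2 = B.chart_M q"
  have \<kappa>1: "\<kappa>1 \<in> charts M1" "p \<in> cdom \<kappa>1" and \<kappa>2: "\<kappa>2 \<in> charts M2" "q \<in> cdom \<kappa>2"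
    using charts_atD[OF A.chart_M[OF p]] charts_atD[OF B.chart_M[OF q]] by (simp_all add: \<kappa>1_def \<kappa>2_def)
  have "open (h -` V)" if V: "open V" for V
  proof -
    have "continuous_on UNIV (\<lambda>z. B.L q (snd z))"
      by (intro continuous_on_compose2[OF linear_continuous_on[OF linear_conv_bounded_linear[THEN iffD1, OF B.linear_L[OF q]]]]
        continuous_intros) auto
    then have "open ((\<lambda>z :: (real^'n) \<times> (real^'n). B.L q (snd z)) -` V)"
      using V by (rule open_vimage[rotated])
    then have "openin (ttop M2) {e \<in> tdom M2 \<kappa>2. tcoord \<kappa>2 e \<in> (\<lambda>z. B.L q (snd z)) -` V}" (is "openin _ ?U")
      by (rule openin_tangent_chart[OF B.analytic_manifold \<kappa>2(1)])
    then have "openin (ttop M1) {e \<in> tbundle M1. \<phi> e \<in> ?U}" (is "openin _ ?P")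
      using \<phi> unfolding continuous_map_def topspace_ttop[OF A.analytic_manifold] by blast
    then have "open (tcoord \<kappa>1 ` (?P \<inter> tdom M1 \<kappa>1))"
      using \<kappa>1(1) unfolding openin_ttop[OF A.regular_M] by blast
    moreover have "continuous_on UNIV (\<lambda>y. (coord \<kappa>1 p, inv_into UNIV (A.L p) y))"
      by (intro continuous_on_Pair continuous_on_const
          linear_continuous_on[OF linear_conv_bounded_linear[THEN iffD1, OF A.linear_inv_L[OF p]]])
    ultimately have "open ((\<lambda>y. (coord \<kappa>1 p, inv_into UNIV (A.L p) y)) -` (tcoord \<kappa>1 ` (?P \<inter> tdom M1 \<kappa>1)))"
      by (rule open_vimage)
    moreover have "(coord \<kappa>1 p, inv_into UNIV (A.L p) y) \<in> tcoord \<kappa>1 ` (?P \<inter> tdom M1 \<kappa>1) \<longleftrightarrow> h y \<in> V" for y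
    proof -
      define e where "e = (p, A.undevelop p y)"
      have v: "A.undevelop p y \<in> tspace M1 p" by (rule A.undevelop_in[OF p])
      have e: "e \<in> tdom M1 \<kappa>1" "e \<in> tbundle M1" using v \<kappa>1(2) p by (simp_all add: e_def tdom_def tbundle_def)
      have te: "tcoord \<kappa>1 e = (coord \<kappa>1 p, inv_into UNIV (A.L p) y)"
        using tvector_base[OF A.analytic_manifold A.chart_M[OF p]]
        by (simp add: e_def tcoord_def A.undevelop_def \<kappa>1_def)
      have "(coord \<kappa>1 p, inv_into UNIV (A.L p) y) \<in> tcoord \<kappa>1 ` (?P \<inter> tdom M1 \<kappa>1) \<longleftrightarrow> e \<in> ?P"
      proof
        assume "(coord \<kappa>1 p, inv_into UNIV (A.L p) y) \<in> tcoord \<kappa>1 ` (?P \<inter> tdom M1 \<kappa>1)"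
        then obtain e' where e': "e' \<in> ?P" "e' \<in> tdom M1 \<kappa>1" "tcoord \<kappa>1 e = tcoord \<kappa>1 e'" unfolding te[symmetric] by blast
        have "e = e'" by (rule inj_onD[OF tcoord_inj[OF A.regular_M \<kappa>1(1)] e'(3) e(1) e'(2)])
        then show "e \<in> ?P" using e'(1) by simp
      next
        assume "e \<in> ?P"
        then show "(coord \<kappa>1 p, inv_into UNIV (A.L p) y) \<in> tcoord \<kappa>1 ` (?P \<inter> tdom M1 \<kappa>1)"
          unfolding te[symmetric] using e(1) by blast
      qed
      also have "\<dots> \<longleftrightarrow> \<phi> e \<in> ?U" using e(2) by blast
      also have "\<dots> \<longleftrightarrow> h y \<in> V"
      proof -
        have "\<phi> e \<in> {q} \<times> tspace M2 q" using fibre v unfolding e_def by blast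
        then obtain w where w: "\<phi> e = (q, w)" "w \<in> tspace M2 q" by blast
        then have "\<phi> e \<in> tdom M2 \<kappa>2" using \<kappa>2(2) by (simp add: tdom_def)
        moreover have "h y = B.L q (w \<kappa>2)" using w(1) by (simp add: h_def e_def B.develop_def \<kappa>2_def)
        ultimately show ?thesis using w(1) by (simp add: tcoord_def)
      qed
      finally show ?thesis .
    qed
    then have "(\<lambda>y. (coord \<kappa>1 p, inv_into UNIV (A.L p) y)) -` (tcoord \<kappa>1 ` (?P \<inter> tdom M1 \<kappa>1)) = h -` V"
      unfolding vimage_def by (intro Collect_cong)
    ultimately show ?thesis by simp
  qed
  then have "continuous_on UNIV h" by (simp add: continuous_on_open_vimage)
  then show ?thesis unfolding h_def .
qed

lemma flat_torus_complete_flat_manifold: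
  assumes "flat_torus M" "complete_riemannian M"
  shows "\<exists>\<Gamma> F. lattice_of_full_rank \<Gamma> \<and> complete_flat_manifold M \<Gamma> F"
proof -
  obtain \<Gamma> F where *: "analytic_riemannian M" "lattice_of_full_rank \<Gamma>" "isometry M (quotient_torus \<Gamma>) F"
    using assms(1) unfolding flat_torus_def isometric_def by (elim conjE exE)
  have "complete_flat_manifold M \<Gamma> F"
    by unfold_locales (rule *(1), rule lattice_discrete_subgroup[OF *(2)], rule *(3), rule assms(2))
  then show ?thesis using *(2) by (intro exI conjI)
qed

text \<open>A single fibre of the focal equivalence suffices. Only continuity of the fibre map has to be
  checked, since a continuous bijection of Euclidean space is a homeomorphism by invariance of
  domain.\<close>

lemma focally_equivalent_arrangement_homeo:
  fixes M1 :: "('a, 'n::finite) riemannian" and M2 :: "('b, 'n) riemannian"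
  assumes M1: "complete_flat_manifold M1 \<Gamma>1 F1" and M2: "complete_flat_manifold M2 \<Gamma>2 F2"
    and equiv: "focally_equivalent M1 M2"
  shows "\<exists>h k. arrangement_homeo \<Gamma>1 \<Gamma>2 h k"
proof -
  interpret A: complete_flat_manifold M1 \<Gamma>1 F1 by (rule M1)
  interpret B: complete_flat_manifold M2 \<Gamma>2 F2 by (rule M2)
  obtain \<phi> \<psi> where homeo: "homeomorphic_map (ttop M1) (ttop M2) \<phi>"
    and fib: "\<forall>p\<in>points M1. \<phi> ` ({p} \<times> tspace M1 p) \<subseteq> {\<psi> p} \<times> tspace M2 (\<psi> p) \<and>
           \<phi> (p, \<lambda>_. 0) = (\<psi> p, \<lambda>_. 0) \<and>
           (\<forall>i\<ge>1. \<phi> ` ({p} \<times> focal_component M1 i p) = {\<psi> p} \<times> focal_component M2 i (\<psi> p))"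
    using equiv unfolding focally_equivalent_def by (elim conjE exE)
  have "orbit \<Gamma>1 0 \<in> F1 ` points M1"
    using A.F points_torus[OF A.\<Gamma>] by (simp add: isometry_def bij_betw_def)
  then obtain p where p: "p \<in> points M1" by blast
  define q where "q = \<psi> p"
  have fibre: "\<phi> ` ({p} \<times> tspace M1 p) \<subseteq> {q} \<times> tspace M2 q" and \<phi>0: "\<phi> (p, \<lambda>_. 0) = (q, \<lambda>_. 0)"
    and comp: "\<And>i. i \<ge> 1 \<Longrightarrow> \<phi> ` ({p} \<times> focal_component M1 i p) = {q} \<times> focal_component M2 i q"
    using fib[rule_format, OF p] by (simp_all add: q_def)
  have top1: "topspace (ttop M1) = tbundle M1" by (rule topspace_ttop[OF A.analytic_manifold])
  have top2: "topspace (ttop M2) = tbundle M2" by (rule topspace_ttop[OF B.analytic_manifold])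
  have \<phi>_inj: "inj_on \<phi> (tbundle M1)" and \<phi>_img: "\<phi> ` tbundle M1 = tbundle M2"
    using homeomorphic_imp_injective_map[OF homeo] homeomorphic_imp_surjective_map[OF homeo]
    unfolding top1 top2 .
  have \<phi>_cont: "continuous_map (ttop M1) (ttop M2) \<phi>" by (rule homeomorphic_imp_continuous_map[OF homeo])
  have in1: "(p, v) \<in> tbundle M1" if "v \<in> tspace M1 p" for v using that p by (simp add: tbundle_def)
  have "(\<lambda>_. 0) \<in> tspace M1 p" using A.undevelop_in[OF p, of 0] unfolding A.undevelop_zero[OF p] .
  then have "\<phi> (p, \<lambda>_. 0) \<in> tbundle M2" using in1 \<phi>_img by blast
  then have q: "q \<in> points M2" unfolding \<phi>0 by (simp add: tbundle_def)
  define \<theta> where "\<theta> v = snd (\<phi> (p, v))" for v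
  have \<theta>: "\<phi> (p, v) = (q, \<theta> v)" "\<theta> v \<in> tspace M2 q" if "v \<in> tspace M1 p" for v
  proof -
    have "\<phi> (p, v) \<in> {q} \<times> tspace M2 q" using fibre that by blast
    then show "\<phi> (p, v) = (q, \<theta> v)" "\<theta> v \<in> tspace M2 q" by (auto simp: \<theta>_def)
  qed
  define h where "h y = B.develop q (\<theta> (A.undevelop p y))" for y
  have cont: "continuous_on UNIV h"
    unfolding h_def \<theta>_def
    by (rule fibre_map_continuous[OF A.flat_manifold_axioms B.flat_manifold_axioms \<phi>_cont p q fibre])
  have index: "focal_index M2 q (\<theta> v) = focal_index M1 p v" if v: "v \<in> tspace M1 p" for v
  proof -
    have "(p, v) \<in> {p} \<times> focal_component M1 (focal_index M1 p v) p"
      using v by (simp add: focal_component_def)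
    then have "\<phi> (p, v) \<in> {q} \<times> focal_component M2 (focal_index M1 p v) q"
      using comp[OF A.focal_index_ge_1[OF p v]] by blast
    then show ?thesis unfolding \<theta>(1)[OF v] by (simp add: focal_component_def)
  qed
  have card_eq: "card {\<gamma>\<in>\<Gamma>2. on_bisector \<gamma> (h y)} = card {\<gamma>\<in>\<Gamma>1. on_bisector \<gamma> y}" for y
  proof -
    have v: "A.undevelop p y \<in> tspace M1 p" by (rule A.undevelop_in[OF p])
    show ?thesis
      using index[OF v] unfolding h_def A.focal_index_eq_card_bisectors[OF p v]
        B.focal_index_eq_card_bisectors[OF q \<theta>(2)[OF v]] A.develop_undevelop[OF p] by simp
  qed
  have inj: "inj h"
  proof (rule injI)
    fix y y' assume eq: "h y = h y'"
    have v: "A.undevelop p y \<in> tspace M1 p" "A.undevelop p y' \<in> tspace M1 p" by (rule A.undevelop_in[OF p])+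
    have "B.undevelop q (h y) = \<theta> (A.undevelop p y)"
      unfolding h_def by (rule B.undevelop_develop[OF q \<theta>(2)[OF v(1)]])
    moreover have "B.undevelop q (h y') = \<theta> (A.undevelop p y')"
      unfolding h_def by (rule B.undevelop_develop[OF q \<theta>(2)[OF v(2)]])
    ultimately have "\<theta> (A.undevelop p y) = \<theta> (A.undevelop p y')" using eq by simp
    then have "\<phi> (p, A.undevelop p y) = \<phi> (p, A.undevelop p y')" unfolding \<theta>(1)[OF v(1)] \<theta>(1)[OF v(2)] by simp
    from inj_onD[OF \<phi>_inj this in1[OF v(1)] in1[OF v(2)]]
    have "A.undevelop p y = A.undevelop p y'" by simp
    from arg_cong[OF this, of "A.develop p"] show "y = y'" unfolding A.develop_undevelop[OF p] .
  qed
  have surj: "h ` UNIV = UNIV"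
  proof -
    have "\<exists>y. w = h y" for w
    proof -
      define v' where "v' = B.undevelop q w"
      have v': "v' \<in> tspace M2 q" unfolding v'_def by (rule B.undevelop_in[OF q])
      have "(q, v') \<in> {q} \<times> focal_component M2 (focal_index M2 q v') q" using v' by (simp add: focal_component_def)
      then have "(q, v') \<in> \<phi> ` ({p} \<times> focal_component M1 (focal_index M2 q v') p)"
        unfolding comp[OF B.focal_index_ge_1[OF q v']] .
      then obtain v where "v \<in> focal_component M1 (focal_index M2 q v') p" "(q, v') = \<phi> (p, v)" by auto
      then have v: "v \<in> tspace M1 p" "\<phi> (p, v) = (q, v')" by (simp_all add: focal_component_def)
      then have "\<theta> v = v'" by (simp add: \<theta>_def)
      then have "h (A.develop p v) = w"
        unfolding h_def A.undevelop_develop[OF p v(1)] v'_def by (simp add: B.develop_undevelop[OF q])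
      then show ?thesis by (intro exI[of _ "A.develop p v"]) simp
    qed
    then show ?thesis by blast
  qed
  obtain k where "homeomorphism UNIV (h ` UNIV) h k"
    using invariance_of_domain_homeomorphism[OF open_UNIV cont _ inj] by auto
  then have hk: "homeomorphism UNIV UNIV h k" unfolding surj .
  have h0: "h 0 = 0"
  proof -
    have "\<theta> (\<lambda>_. 0) = (\<lambda>_. 0)" using \<phi>0 by (simp add: \<theta>_def)
    then show ?thesis unfolding h_def A.undevelop_zero[OF p] by (simp add: B.develop_zero[OF q])
  qed
  have "arrangement_homeo \<Gamma>1 \<Gamma>2 h k"
  proof
    show "regular \<Gamma>2 (h v) \<longleftrightarrow> regular \<Gamma>1 v" for v
      unfolding A.card_bisectors_regular B.card_bisectors_regular card_eq ..
    show "simple \<Gamma>2 (h v) \<longleftrightarrow> simple \<Gamma>1 v" for v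
      unfolding A.card_bisectors_simple B.card_bisectors_simple card_eq ..
  qed (rule A.\<Gamma> B.\<Gamma> hk h0)+
  then show ?thesis by (intro exI)
qed

text \<open>The similarity of the lattices gives an isometry of the quotient tori up to scale, which is
  composed with the given isometries of \<open>M\<^sub>1\<close> and \<open>M\<^sub>2\<close>
  with these tori.\<close>

theorem theoremA:
  fixes M\<^sub>1 :: "('a, 'n::finite) riemannian" and M\<^sub>2 :: "('b, 'n) riemannian"
  assumes "CARD('n) \<ge> 2"
    and "flat_torus M\<^sub>1" and "flat_torus M\<^sub>2"
    and "focally_equivalent M\<^sub>1 M\<^sub>2"
  shows "\<exists>c>0. isometric M\<^sub>1 (rescale c M\<^sub>2)"
proof -
  have complete: "complete_riemannian M\<^sub>1" "complete_riemannian M\<^sub>2"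
    using assms(4) unfolding focally_equivalent_def by blast+
  obtain \<Gamma>1 F1 where M1: "lattice_of_full_rank \<Gamma>1" "complete_flat_manifold M\<^sub>1 \<Gamma>1 F1"
    using flat_torus_complete_flat_manifold[OF assms(2) complete(1)] by (elim exE conjE)
  obtain \<Gamma>2 F2 where M2: "lattice_of_full_rank \<Gamma>2" "complete_flat_manifold M\<^sub>2 \<Gamma>2 F2"
    using flat_torus_complete_flat_manifold[OF assms(3) complete(2)] by (elim exE conjE)
  interpret A: complete_flat_manifold M\<^sub>1 \<Gamma>1 F1 by (rule M1(2))
  interpret B: complete_flat_manifold M\<^sub>2 \<Gamma>2 F2 by (rule M2(2))
  obtain h k where hk: "arrangement_homeo \<Gamma>1 \<Gamma>2 h k"
    using focally_equivalent_arrangement_homeo[OF M1(2) M2(2) assms(4)] by (elim exE)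
  obtain f Q where Q: "Q > 0" and bij: "bij_betw f \<Gamma>1 \<Gamma>2"
    and f: "\<forall>x\<in>\<Gamma>1. f x \<bullet> f x = Q * (x \<bullet> x) \<and> (\<forall>y\<in>\<Gamma>1. f (x + y) = f x + f y)"
    using arrangement_homeo.lattices_similar[OF hk] by (elim exE conjE)
  obtain S where S: "linear S" "\<And>x y. S x \<bullet> S y = Q * (x \<bullet> y)" "\<And>\<gamma>. \<gamma> \<in> \<Gamma>1 \<Longrightarrow> S \<gamma> = f \<gamma>"
    using lattice_similarity_extends[OF M1(1), of f Q] f by auto
  have "S ` \<Gamma>1 = \<Gamma>2" using S(3) bij by (simp add: bij_betw_def cong: image_cong)
  then have "isometric (quotient_torus \<Gamma>1) (rescale (1 / Q) (quotient_torus \<Gamma>2))"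
    by (rule similar_tori_isometric[OF A.\<Gamma> B.\<Gamma> S(1,2) Q])
  then obtain G where G: "isometry (quotient_torus \<Gamma>1) (rescale (1 / Q) (quotient_torus \<Gamma>2)) G"
    unfolding isometric_def by (elim exE)
  have T2: "chart_regular (rescale (1 / Q) (quotient_torus \<Gamma>2))" by (rule chart_regular_rescale[OF chart_regular_torus])
  have "isometry (rescale (1 / Q) (quotient_torus \<Gamma>2)) (rescale (1 / Q) M\<^sub>2) (inv_into (points M\<^sub>2) F2)"
    by (rule isometry_rescale[OF isometry_inverse[OF B.regular_M chart_regular_torus B.F]])
  from isometry_compose[OF chart_regular_torus T2 chart_regular_rescale[OF B.regular_M] G this]
  have "isometry (quotient_torus \<Gamma>1) (rescale (1 / Q) M\<^sub>2) (inv_into (points M\<^sub>2) F2 \<circ> G)" .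
  from isometry_compose[OF A.regular_M chart_regular_torus chart_regular_rescale[OF B.regular_M] A.F this]
  have "isometric M\<^sub>1 (rescale (1 / Q) M\<^sub>2)"
    unfolding isometric_def by (rule exI[of _ "inv_into (points M\<^sub>2) F2 \<circ> G \<circ> F1"])
  then show ?thesis using Q by (intro exI[of _ "1 / Q"]) simp
qed

end
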